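(* Let $\mathbf{U}_l,\mathbf{V}_l,\mathbf{N}_l,\mathbf{M}_l,\mathbf{U}_r,\mathbf{V}_r,\mathbf{N}_r,\mathbf{M}_r\in\mathcal{RH}_\infty$ be a doubly-coprime factorization of the plant $\mathbf{G}$, so that in particular $\mathbf{G}=\mathbf{M}_l^{-1}\mathbf{N}_l$, and let $\mathbf{M}_l,\mathbf{N}_l$ have the state-space realization $$\mathbf{M}_l(z)=C(zI-A)^{-1}B_M+D_M,\qquad \mathbf{N}_l(z)=C(zI-A)^{-1}B_N+D_N.$$ The controller $\mathbf{K}$ internally stabilizes $\mathbf{G}$ if and only if there exist symmetric matrices $X,Z$ and matrices $Q,F,L_X,L_Y,R_X,R_Y$ of compatible size such that $$\begin{bmatrix} X & Z & f_1 & f_2 & f_3 & 0\\ \star & Z & Q & Q & F & 0\\ \star & \star & X & Z & 0 & f_4\\ \star & \star & \star & Z & 0 & f_5\\ \star & \star & \star & \star & I & f_6\\ \star & \star & \star & \star & \star & \epsilon^2 I \end{bmatrix}\succ 0\qquad\text{holds with }\epsilon=1,$$ where $$\begin{aligned} f_1&=AX+B_ML_X-B_NL_Y, & f_2&=AZ+B_ML_X-B_NL_Y,\\ f_3&=B_MR_X-B_NR_Y, & f_4&=X^{\mathsf T}C^{\mathsf T}+L_X^{\mathsf T}D_M^{\mathsf T}-L_Y^{\mathsf T}D_N^{\mathsf T},\\ f_5&=Z^{\mathsf T}C^{\mathsf T}+L_X^{\mathsf T}D_M^{\mathsf T}-L_Y^{\mathsf T}D_N^{\mathsf T}, & f_6&=R_X^{\mathsf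 T}D_M^{\mathsf T}-R_Y^{\mathsf T}D_N^{\mathsf T}-I. \end{aligned}$$ If this matrix inequality holds with $\epsilon=1$, then the following controller $\mathbf{K}$ internally stabilizes $\mathbf{G}$: $\mathbf{K}=\mathbf{Y}\mathbf{X}^{-1}$, with state-space realization $\mathbf{K}(z)=C_K(zI-A_K)^{-1}B_K+D_K$, where $$A_K=\hat A-\hat B\hat D_X^{-1}\hat C_X,\quad B_K=-\hat B\hat D_X^{-1},\quad C_K=-\hat C_Y+\hat D_Y\hat D_X^{-1}\hat C_X,\quad D_K=\hat D_Y\hat D_X^{-1}.$$ Here $\mathbf{X}(z)=\hat C_X(zI-\hat A)^{-1}\hat B+\hat D_X$ and $\mathbf{Y}(z)=\hat C_Y(zI-\hat A)^{-1}\hat B+\hat D_Y$ with $$\begin{bmatrix}\hat A&\hat B\\\hat C_X&\hat D_X\\\hat C_Y&\hat D_Y\end{bmatrix}=\begin{bmatrix}U^{\mathsf T}Z^{-1}&0&0\\0&I&0\\0&0&I\end{bmatrix}\begin{bmatrix}Q&F\\L_X&R_X\\L_Y&R_Y\end{bmatrix}\begin{bmatrix}U^{-1}&0\\0&I\end{bmatrix}^{\mathsf T},$$ and $U$ is an arbitrary non-singular matrix.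
   Context: $\mathcal{RH}_\infty$ denotes the set of real-rational proper stable transfer matrices in discrete time (all poles in the open unit disc), of whatever dimensions are compatible. All matrices are real. In the block matrix, $\star$ denotes the blocks determined by symmetry, and $\succ0$ means symmetric positive definite. The transfer matrices $\mathbf{X},\mathbf{Y}$ and the matrix variable $X$ are different objects. Plant: $x[t+1]=A_p x[t]+B_p u[t]+\delta_x[t]$, $y[t]=C_p x[t]+\delta_y[t]$, with $x[t]\in\mathbb{R}^n$, $u[t]\in\mathbb{R}^m$, $y[t]\in\mathbb{R}^p$, where $(A_p,B_p)$ is stabilizable and $(C_p,A_p)$ is detectable. Its transfer matrix is the strictly proper $\mathbf{G}(z)=C_p(zI-A_p)^{-1}B_p$. Controller: an output-feedback LTI dynamical controller $\mathbf{u}=\mathbf{K}\mathbf{y}+\delta_{\mathbf{u}}$ with state-space realization $\xi[t+1]=A_K\xi[t]+B_K y[t]$, $u[t]=C_K\xi[t]+D_K y[t]+\delta_u[t]$, $\xi[t]\in\mathbb{R}^q$. $\mathbf{K}$ internally stabilizes $\mathbf{G}$ if the closed loop is well-posed (automatic here, as the plant is strictly proper) and, with all disturbances $\delta_x,\delta_y,\delta_u$ zero, $(x[t],\xi[t])\to 0$ as $t\to\infty$ for all initial states $(x[0],\xi[0])$. Doubly-coprime factorization of $\mathbf{G}$: a collection $\mathbf{U}_l,\mathbf{V}_l,\mathbf{N}_l,\mathbf{M}_l,\mathbf{U}_r,\mathbf{V}_r,\mathbf{N}_r,\mathbf{M}_r\in\mathcal{RH}_\infty$ such that $\mathbf{G}=\mathbf{N}_r\mathbf{M}_r^{-1}=\mathbf{M}_l^{-1}\mathbf{N}_l$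 and $$\begin{bmatrix}\mathbf{U}_l&-\mathbf{V}_l\\-\mathbf{N}_l&\mathbf{M}_l\end{bmatrix}\begin{bmatrix}\mathbf{M}_r&\mathbf{V}_r\\\mathbf{N}_r&\mathbf{U}_r\end{bmatrix}=I.$$ Dimensions: $\mathbf{M}_l$ and $\mathbf{X}$ are $p\times p$, $\mathbf{N}_l$ is $p\times m$, $\mathbf{Y}$ is $m\times p$; if $A$ is $k\times k$ then $X,Z,Q,U\in\mathbb{R}^{k\times k}$, $F\in\mathbb{R}^{k\times p}$, $L_X\in\mathbb{R}^{p\times k}$, $L_Y\in\mathbb{R}^{m\times k}$, $R_X\in\mathbb{R}^{p\times p}$, $R_Y\in\mathbb{R}^{m\times p}$. (The matrices $A,C$ of the realization of $\mathbf{M}_l,\mathbf{N}_l$ need not equal $A_p,C_p$.)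
   Formalization: The equivalence is read as "some internally stabilizing controller K exists iff the inequality is feasible", since for a fixed K it is false, and it assumes that A has all eigenvalues in the open unit disc, without which it fails. *)

theory Defs
  imports
    Complex_Main
    "HOL-Computational_Algebra.Fraction_Field"
    "Jordan_Normal_Form.Gauss_Jordan_Elimination"
    "Jordan_Normal_Form.Char_Poly"
begin

section \<open>Matrices\<close>

notation transpose_mat ("(_\<^sup>T)" [1000] 1000)

text \<open>Only meaningful for invertible \<open>A\<close>: otherwise \<^const>\<open>mat_inverse\<close> yields \<open>None\<close>
  and the value is unspecified.\<close>

definition minv :: "'a::field mat \<Rightarrow> 'a mat" where
  "minv A = the (mat_inverse A)"

definition append_cols :: "'a::zero mat \<Rightarrow> 'a mat \<Rightarrow> 'a mat" where
  "append_cols A B = four_block_mat A B (0\<^sub>m 0 (dim_col A)) (0\<^sub>m 0 (dim_col B))"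

text \<open>A block matrix from the list of its block rows. The \<open>0 \<times> 0\<close> matrix is a right unit
  for both ways of appending.\<close>

definition block_mat :: "'a::zero mat list list \<Rightarrow> 'a mat" where
  "block_mat Rs = foldr append_rows (map (\<lambda>R. foldr append_cols R (0\<^sub>m 0 0)) Rs) (0\<^sub>m 0 0)"

definition symmetric_mat :: "'a mat \<Rightarrow> bool" where
  "symmetric_mat A \<longleftrightarrow> A\<^sup>T = A"

definition pos_def :: "real mat \<Rightarrow> bool" where
  "pos_def A \<longleftrightarrow> symmetric_mat A \<and>
     (\<forall>v \<in> carrier_vec (dim_row A). v \<noteq> 0\<^sub>v (dim_row A) \<longrightarrow> v \<bullet> (A *\<^sub>v v) > 0)"

definition schur_stable :: "real mat \<Rightarrow> bool" where
  "schur_stable A \<longleftrightarrow> square_mat A \<and>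
     (\<forall>\<mu>. eigenvalue (map_mat complex_of_real A) \<mu> \<longrightarrow> cmod \<mu> < 1)"

definition stabilizable :: "real mat \<Rightarrow> real mat \<Rightarrow> bool" where
  "stabilizable A B \<longleftrightarrow> (\<exists>K \<in> carrier_mat (dim_col B) (dim_row A). schur_stable (A + B * K))"

definition detectable :: "real mat \<Rightarrow> real mat \<Rightarrow> bool" where
  "detectable C A \<longleftrightarrow> (\<exists>L \<in> carrier_mat (dim_row A) (dim_row C). schur_stable (A + L * C))"


section \<open>Transfer matrices\<close>

text \<open>A real-rational transfer matrix is a matrix over the field of fractions of the
  polynomial ring over the reals, whose indeterminate plays the role of \<open>z\<close>.\<close>

type_synonym tf_mat = "real poly fract mat"

abbreviation const_tf :: "real mat \<Rightarrow> tf_mat" where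
  "const_tf \<equiv> map_mat (\<lambda>a. Fraction_Field.Fract [:a:] 1)"

text \<open>\<open>transfer_mat A B C D\<close> is \<open>C (z I - A)\<^sup>-\<^sup>1 B + D\<close>. Over the field of fractions
  \<open>z I - A\<close> is always invertible.\<close>

definition transfer_mat :: "real mat \<Rightarrow> real mat \<Rightarrow> real mat \<Rightarrow> real mat \<Rightarrow> tf_mat" where
  "transfer_mat A B C D =
     const_tf C * minv (Fraction_Field.Fract [:0, 1:] 1 \<cdot>\<^sub>m 1\<^sub>m (dim_row A) - const_tf A) * const_tf B
       + const_tf D"

text \<open>Coprimality makes the roots of the denominator exactly the poles.\<close>

definition proper_stable :: "real poly fract \<Rightarrow> bool" where
  "proper_stable r \<longleftrightarrow> (\<exists>a b. b \<noteq> 0 \<and> coprime a b \<and> r = Fraction_Field.Fract a b \<and>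
     degree a \<le> degree b \<and>
     (\<forall>z. poly (map_poly complex_of_real b) z = 0 \<longrightarrow> cmod z < 1))"

definition RH_inf :: "nat \<Rightarrow> nat \<Rightarrow> tf_mat set" where
  "RH_inf nr nc = {T \<in> carrier_mat nr nc. \<forall>i < nr. \<forall>j < nc. proper_stable (T $$ (i, j))}"

definition doubly_coprime_factorization ::
  "nat \<Rightarrow> nat \<Rightarrow> tf_mat \<Rightarrow> tf_mat \<Rightarrow> tf_mat \<Rightarrow> tf_mat \<Rightarrow> tf_mat \<Rightarrow> tf_mat \<Rightarrow> tf_mat \<Rightarrow> tf_mat \<Rightarrow> tf_mat \<Rightarrow> bool"
where
  "doubly_coprime_factorization p m G Ul Vl Nl Ml Ur Vr Nr Mr \<longleftrightarrow>
     Ul \<in> RH_inf m m \<and> Vl \<in> RH_inf m p \<and> Nl \<in> RH_inf p m \<and> Ml \<in> RH_inf p p \<and>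
     Ur \<in> RH_inf p p \<and> Vr \<in> RH_inf m p \<and> Nr \<in> RH_inf p m \<and> Mr \<in> RH_inf m m \<and>
     invertible_mat Mr \<and> G = Nr * minv Mr \<and>
     invertible_mat Ml \<and> G = minv Ml * Nl \<and>
     four_block_mat Ul (- Vl) (- Nl) Ml * four_block_mat Mr Vr Nr Ur = 1\<^sub>m (m + p)"


section \<open>Internal stability of the feedback interconnection\<close>

text \<open>The plant is \<open>(A\<^sub>p, B\<^sub>p, C\<^sub>p)\<close>, the controller \<open>(A\<^sub>K, B\<^sub>K, C\<^sub>K, D\<^sub>K)\<close>, interconnected by
  positive feedback with all disturbances zero. The plant is strictly proper, so every initial
  state \<open>(x 0, \<xi> 0)\<close> determines exactly one trajectory and the loop is well-posed.\<close>

definition internally_stabilizes ::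
  "real mat \<Rightarrow> real mat \<Rightarrow> real mat \<Rightarrow> real mat \<Rightarrow> real mat \<Rightarrow> real mat \<Rightarrow> real mat \<Rightarrow> bool"
where
  "internally_stabilizes AK BK CK DK Ap Bp Cp \<longleftrightarrow>
     (\<forall>x \<xi> u y :: nat \<Rightarrow> real vec.
        (\<forall>t. x t \<in> carrier_vec (dim_row Ap) \<and> \<xi> t \<in> carrier_vec (dim_row AK) \<and>
             x (Suc t) = Ap *\<^sub>v x t + Bp *\<^sub>v u t \<and>
             y t = Cp *\<^sub>v x t \<and>
             \<xi> (Suc t) = AK *\<^sub>v \<xi> t + BK *\<^sub>v y t \<and>
             u t = CK *\<^sub>v \<xi> t + DK *\<^sub>v y t) \<longrightarrow>
        (\<forall>i < dim_row Ap. (\<lambda>t. x t $ i) \<longlonglongrightarrow> 0) \<and>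
        (\<forall>i < dim_row AK. (\<lambda>t. \<xi> t $ i) \<longlonglongrightarrow> 0))"


section \<open>The linear matrix inequality\<close>

definition lmi_vars ::
  "nat \<Rightarrow> nat \<Rightarrow> nat \<Rightarrow> real mat \<Rightarrow> real mat \<Rightarrow> real mat \<Rightarrow> real mat \<Rightarrow> real mat \<Rightarrow> real mat \<Rightarrow> real mat \<Rightarrow> real mat \<Rightarrow> bool"
where
  "lmi_vars k p m X Z Q F LX LY RX RY \<longleftrightarrow>
     X \<in> carrier_mat k k \<and> symmetric_mat X \<and> Z \<in> carrier_mat k k \<and> symmetric_mat Z \<and>
     Q \<in> carrier_mat k k \<and> F \<in> carrier_mat k p \<and>
     LX \<in> carrier_mat p k \<and> LY \<in> carrier_mat m k \<and>
     RX \<in> carrier_mat p p \<and> RY \<in> carrier_mat m p"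

text \<open>The arguments after \<open>\<epsilon>\<close> start with the realization
  \<open>M\<^sub>l = C (z I - A)\<^sup>-\<^sup>1 B\<^sub>M + D\<^sub>M\<close>, \<open>N\<^sub>l = C (z I - A)\<^sup>-\<^sup>1 B\<^sub>N + D\<^sub>N\<close>, with \<open>D\<^sub>M\<close> and \<open>D\<^sub>N\<close> following \<open>C\<close>.\<close>

definition lmi_mat ::
  "nat \<Rightarrow> nat \<Rightarrow> real \<Rightarrow> real mat \<Rightarrow> real mat \<Rightarrow> real mat \<Rightarrow> real mat \<Rightarrow> real mat \<Rightarrow> real mat \<Rightarrow>
   real mat \<Rightarrow> real mat \<Rightarrow> real mat \<Rightarrow> real mat \<Rightarrow> real mat \<Rightarrow> real mat \<Rightarrow> real mat \<Rightarrow> real mat \<Rightarrow> real mat"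
where
  "lmi_mat k p \<epsilon> A BM BN C DM DN X Z Q F LX LY RX RY =
    (let f1 = A * X + BM * LX - BN * LY;
         f2 = A * Z + BM * LX - BN * LY;
         f3 = BM * RX - BN * RY;
         f4 = X\<^sup>T * C\<^sup>T + LX\<^sup>T * DM\<^sup>T - LY\<^sup>T * DN\<^sup>T;
         f5 = Z\<^sup>T * C\<^sup>T + LX\<^sup>T * DM\<^sup>T - LY\<^sup>T * DN\<^sup>T;
         f6 = RX\<^sup>T * DM\<^sup>T - RY\<^sup>T * DN\<^sup>T - 1\<^sub>m p
     in block_mat
       [[X, Z, f1, f2, f3, 0\<^sub>m k p],
        [Z\<^sup>T, Z, Q, Q, F, 0\<^sub>m k p],
        [f1\<^sup>T, Q\<^sup>T, X, Z, 0\<^sub>m k p, f4],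
        [f2\<^sup>T, Q\<^sup>T, Z\<^sup>T, Z, 0\<^sub>m k p, f5],
        [f3\<^sup>T, F\<^sup>T, 0\<^sub>m p k, 0\<^sub>m p k, 1\<^sub>m p, f6],
        [0\<^sub>m p k, 0\<^sub>m p k, f4\<^sup>T, f5\<^sup>T, f6\<^sup>T, \<epsilon>\<^sup>2 \<cdot>\<^sub>m 1\<^sub>m p]])"

end

theory Submission
  imports Defs "Jordan_Normal_Form.Spectral_Radius"
begin

text \<open>
  Put a state \<open>x\<close> of the common realization of the left factors \<open>M\<^sub>l\<close>, \<open>N\<^sub>l\<close> and a state \<open>\<xi>\<close> of the
  pair \<open>(\<^bold>X, \<^bold>Y)\<close> side by side, drive \<open>(\<^bold>X, \<^bold>Y)\<close> by \<open>w\<close> and let \<open>z = M\<^sub>l \<^bold>X w - N\<^sub>l \<^bold>Y w - w\<close>. The matrix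
  inequality is the bounded real inequality for the map from \<open>w\<close> to \<open>z\<close>: with the
  quadratic form of the inverse of \<open>P = [X Z; Z Z]\<close> as storage, the gain in storage plus \<open>|z|\<^sup>2\<close> in one
  step is strictly less than \<open>|w|\<^sup>2\<close>, unless state and input vanish (\<open>lmi_dissipation\<close>). Along a mode
  with \<open>|\<mu>| \<ge> 1\<close> the storage does not decrease, so no such mode can have \<open>z = - w\<close>
  (\<open>lmi_no_unstable_mode\<close>). In other words \<open>M\<^sub>l \<^bold>X - N\<^sub>l \<^bold>Y\<close> is a small perturbation of the identity
  and a unit of the stable ring.

  From the inequality to the controller (\<open>lmi_controller_stabilizes\<close>): an unstable mode of the closed
  loop has \<open>y = \<^bold>X w\<close> and \<open>u = \<^bold>Y w\<close> for some \<open>w\<close>. As \<open>M\<^sub>l G = N\<^sub>l\<close> and the plant is stabilizable,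
  \<open>M\<^sub>l y = N\<^sub>l u\<close> at \<open>\<mu>\<close>, even if \<open>\<mu>\<close> is a pole of \<open>G\<close>
  (\<open>coprime_factor_annihilates_modes\<close>). This is \<open>z = - w\<close>, so the mode has \<open>w = 0\<close> and
  reduces to an unstable plant mode with zero output, which detectability excludes.

  To the inequality (\<open>lmi_feasible\<close>): the Bezout identity \<open>M\<^sub>l U\<^sub>r - N\<^sub>l V\<^sub>r = I\<close>, evaluated outside
  the open disc, yields the Hautus condition for \<open>(A - B\<^sub>M D\<^sub>M\<^sup>-\<^sup>1 C, B\<^sub>N)\<close> (\<open>bezout_hautus\<close>). A complex
  stabilizing feedback results from moving unstable eigenvalues to \<open>0\<close> one at a time. The real parts of
  the powers of the closed-loop matrix then steer the real system to the origin, and a finite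
  sum over this steering sequence solves the real matrix inequality for state feedback
  (\<open>steering_lmi\<close>). The feedback yields
  \<open>\<^bold>X\<close> and \<open>\<^bold>Y\<close> of the order of \<open>A\<close> with \<open>M\<^sub>l \<^bold>X - N\<^sub>l \<^bold>Y = I\<close>, and in
  suitable coordinates the large matrix inequality is the direct sum of two inequalities of that kind.

  Rational matrices are related to complex ones by taking limits of their entries at \<open>\<mu>\<close> or at
  infinity (\<open>has_value\<close>), which is a partial ring homomorphism.
\<close>

section \<open>Matrix algebra with dimension side conditions\<close>

text \<open>
  The rules of this section have dimension equations as premises, where the library has carrier
  conditions. The simplifier proves the former by computing dimensions; a carrier condition mentions
  dimensions that are absent from the conclusion and would have to be guessed.
\<close>

lemma mult_assoc_dim:
  fixes A B C :: "'a::semiring_0 mat"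
  assumes "dim_col A = dim_row B" "dim_col B = dim_row C"
  shows "(A * B) * C = A * (B * C)"
  using assms by (intro assoc_mult_mat[of _ "dim_row A" "dim_row B" _ "dim_row C" _ "dim_col C"]) auto

lemma mult_vec_assoc_dim:
  fixes A B :: "'a::semiring_0 mat"
  assumes "dim_col A = dim_row B" "dim_col B = dim_vec v"
  shows "(A * B) *\<^sub>v v = A *\<^sub>v (B *\<^sub>v v)"
  using assms by (intro assoc_mult_mat_vec[of _ "dim_row A" "dim_row B" _ "dim_vec v"] carrier_vecI) auto

lemma mat_vec_distrib_dim:
  fixes A B :: "'a::ring mat"
  shows "dim_row A = dim_row B \<Longrightarrow> dim_col A = dim_col B \<Longrightarrow> dim_col A = dim_vec v \<Longrightarrow>
      (A + B) *\<^sub>v v = A *\<^sub>v v + B *\<^sub>v v"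
    "dim_row A = dim_row B \<Longrightarrow> dim_col A = dim_col B \<Longrightarrow> dim_col A = dim_vec v \<Longrightarrow>
      (A - B) *\<^sub>v v = A *\<^sub>v v - B *\<^sub>v v"
    "dim_col A = dim_vec v \<Longrightarrow> (- A) *\<^sub>v v = - (A *\<^sub>v v)"
    "dim_col A = dim_vec v \<Longrightarrow> dim_vec v = dim_vec w \<Longrightarrow> A *\<^sub>v (v + w) = A *\<^sub>v v + A *\<^sub>v w"
    "dim_col A = dim_vec v \<Longrightarrow> dim_vec v = dim_vec w \<Longrightarrow> A *\<^sub>v (v - w) = A *\<^sub>v v - A *\<^sub>v w"
    "dim_col A = dim_vec v \<Longrightarrow> A *\<^sub>v (- v) = - (A *\<^sub>v v)"
  by (auto intro!: add_mult_distrib_mat_vec[of _ "dim_row A" "dim_col A"]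
      minus_mult_distrib_mat_vec[of _ "dim_row A" "dim_col A"]
      mult_add_distrib_mat_vec[of _ "dim_row A" "dim_col A"]
      mult_minus_distrib_mat_vec[of _ "dim_row A" "dim_col A"] carrier_vecI)

lemma mat_vec_zero_dim:
  fixes A :: "'a::semiring_0 mat"
  shows "dim_col A = n \<Longrightarrow> A *\<^sub>v 0\<^sub>v n = 0\<^sub>v (dim_row A)"
    "m = dim_vec v \<Longrightarrow> 0\<^sub>m n m *\<^sub>v v = 0\<^sub>v n"
  by (intro eq_vecI; simp add: scalar_prod_def)+

lemma mat_vec_smult_dim:
  fixes A :: "'a::comm_ring mat"
  shows "dim_col A = dim_vec v \<Longrightarrow> A *\<^sub>v (c \<cdot>\<^sub>v v) = c \<cdot>\<^sub>v (A *\<^sub>v v)"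
    "dim_col A = dim_vec v \<Longrightarrow> (c \<cdot>\<^sub>m A) *\<^sub>v v = c \<cdot>\<^sub>v (A *\<^sub>v v)"
   by (intro eq_vecI; simp add: scalar_prod_def sum_distrib_left mult.left_commute mult.assoc)+

lemma mat_distrib_dim:
  fixes A B C :: "'a::ring mat"
  shows "dim_row A = dim_row B \<Longrightarrow> dim_col A = dim_col B \<Longrightarrow> dim_col A = dim_row C \<Longrightarrow>
      (A + B) * C = A * C + B * C"
    "dim_row A = dim_row B \<Longrightarrow> dim_col A = dim_col B \<Longrightarrow> dim_col A = dim_row C \<Longrightarrow>
      (A - B) * C = A * C - B * C"
    "dim_row B = dim_row C \<Longrightarrow> dim_col B = dim_col C \<Longrightarrow> dim_col A = dim_row C \<Longrightarrow>
      A * (B + C) = A * B + A * C"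
    "dim_row B = dim_row C \<Longrightarrow> dim_col B = dim_col C \<Longrightarrow> dim_col A = dim_row C \<Longrightarrow>
      A * (B - C) = A * B - A * C"
    "dim_col A = dim_row C \<Longrightarrow> (- A) * C = - (A * C)"
    "dim_col A = dim_row C \<Longrightarrow> A * (- C) = - (A * C)"
  subgoal by (auto intro!: add_mult_distrib_mat[of _ "dim_row A" "dim_col A"])
  subgoal by (auto intro!: minus_mult_distrib_mat[of _ "dim_row A" "dim_col A"])
  subgoal by (auto intro!: mult_add_distrib_mat[of _ "dim_row A" "dim_col A"])
  subgoal by (auto intro!: mult_minus_distrib_mat[of _ "dim_row A" "dim_col A"])
  subgoal by (intro eq_matI; simp add: scalar_prod_def sum_negf)
  subgoal by (intro eq_matI; simp add: scalar_prod_def sum_negf)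
  done

lemma scalar_prod_distrib_dim:
  fixes u v w :: "'a::ring vec"
  shows "dim_vec v = dim_vec u \<Longrightarrow> dim_vec w = dim_vec u \<Longrightarrow> u \<bullet> (v + w) = u \<bullet> v + u \<bullet> w"
    "dim_vec v = dim_vec u \<Longrightarrow> dim_vec w = dim_vec u \<Longrightarrow> u \<bullet> (v - w) = u \<bullet> v - u \<bullet> w"
    "dim_vec v = dim_vec u \<Longrightarrow> dim_vec w = dim_vec u \<Longrightarrow> (v + w) \<bullet> u = v \<bullet> u + w \<bullet> u"
    "dim_vec v = dim_vec u \<Longrightarrow> dim_vec w = dim_vec u \<Longrightarrow> (v - w) \<bullet> u = v \<bullet> u - w \<bullet> u"
    "dim_vec v = dim_vec u \<Longrightarrow> (- v) \<bullet> u = - (v \<bullet> u)"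
    "dim_vec v = dim_vec u \<Longrightarrow> u \<bullet> (- v) = - (u \<bullet> v)"
  by (simp_all add: scalar_prod_def sum.distrib sum_subtractf sum_negf algebra_simps)

lemma scalar_prod_smult_dim:
  fixes u v :: "'a::comm_ring vec"
  shows "dim_vec v = dim_vec u \<Longrightarrow> (c \<cdot>\<^sub>v v) \<bullet> u = c * (v \<bullet> u)"
    "dim_vec v = dim_vec u \<Longrightarrow> u \<bullet> (c \<cdot>\<^sub>v v) = c * (u \<bullet> v)"
  by (simp_all add: scalar_prod_def sum_distrib_left algebra_simps)

lemma scalar_prod_zero_dim:
  fixes v :: "'a::semiring_0 vec"
  shows "n = dim_vec v \<Longrightarrow> 0\<^sub>v n \<bullet> v = 0" "n = dim_vec v \<Longrightarrow> v \<bullet> 0\<^sub>v n = 0"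
  by (simp_all add: scalar_prod_def)

lemma transpose_mult_dim:
  fixes A B :: "'a::comm_semiring_0 mat"
  shows "dim_col A = dim_row B \<Longrightarrow> (A * B)\<^sup>T = B\<^sup>T * A\<^sup>T"
  by (rule transpose_mult[of _ "dim_row A" "dim_row B" _ "dim_col B"]) auto

lemma transpose_arith_dim:
  shows "dim_row A = dim_row B \<Longrightarrow> dim_col A = dim_col B \<Longrightarrow> (A + B)\<^sup>T = A\<^sup>T + B\<^sup>T"
    "dim_row A = dim_row B \<Longrightarrow> dim_col A = dim_col B \<Longrightarrow> (A - B)\<^sup>T = A\<^sup>T - B\<^sup>T"
  by (intro eq_matI; simp)+

lemma transpose_scalar_dim:
  fixes A :: "'a::comm_semiring_0 mat"
  assumes "dim_row A = dim_vec u" "dim_col A = dim_vec v"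
  shows "v \<bullet> (A\<^sup>T *\<^sub>v u) = u \<bullet> (A *\<^sub>v v)"
proof -
  have "v \<bullet> (A\<^sup>T *\<^sub>v u) = (A\<^sup>T *\<^sub>v u) \<bullet> v"
    using assms by (intro comm_scalar_prod[of _ "dim_vec v"] carrier_vecI) auto
  also have "\<dots> = u \<bullet> (A *\<^sub>v v)"
    using assms by (intro transpose_vec_mult_scalar[of _ "dim_vec u" "dim_vec v"] carrier_vecI carrier_matI) auto
  finally show ?thesis .
qed

lemmas mat_vec_expand = mult_vec_assoc_dim mat_vec_distrib_dim mat_vec_zero_dim mat_vec_smult_dim

lemma append_vec_zero_right: "dim_vec w = 0 \<Longrightarrow> v @\<^sub>v w = v"
  by (intro eq_vecI) auto

lemma append_cols_mult_vec:
  fixes A B :: "'a::ring mat"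
  assumes "dim_row A = dim_row B" "dim_col A = dim_vec v" "dim_col B = dim_vec w"
  shows "append_cols A B *\<^sub>v (v @\<^sub>v w) = A *\<^sub>v v + B *\<^sub>v w"
proof -
  have "append_cols A B *\<^sub>v (v @\<^sub>v w) = (A *\<^sub>v v + B *\<^sub>v w)
     @\<^sub>v (0\<^sub>m 0 (dim_col A) *\<^sub>v v + 0\<^sub>m 0 (dim_col B) *\<^sub>v w)"
    unfolding append_cols_def using assms
    by (intro four_block_mat_mult_vec[where ?nr1.0="dim_row A"]) (auto intro: carrier_vecI)
  then show ?thesis by (simp add: append_vec_zero_right)
qed

lemma append_cols_dim [simp]:
  "dim_row (append_cols A B) = dim_row A" "dim_col (append_cols A B) = dim_col A + dim_col B"
  by (simp_all add: append_cols_def)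

lemma append_rows_dim [simp]:
  "dim_row (A @\<^sub>r B) = dim_row A + dim_row B" "dim_col (A @\<^sub>r B) = dim_col A"
  by (simp_all add: append_rows_def)

lemma append_cols_empty [simp]: "append_cols A (0\<^sub>m 0 0) = A"
  by (rule eq_matI) (auto simp: append_cols_def)

lemma append_rows_empty [simp]: "A @\<^sub>r 0\<^sub>m 0 0 = A"
  by (rule eq_matI) (auto simp: append_rows_def)

lemma append_rows_mult_vec:
  fixes A B :: "'a::ring mat"
  assumes "dim_col A = dim_vec v" "dim_col B = dim_vec v"
  shows "(A @\<^sub>r B) *\<^sub>v v = (A *\<^sub>v v) @\<^sub>v (B *\<^sub>v v)"
  using assms by (intro mat_mult_append[of _ "dim_row A" "dim_vec v" _ "dim_row B"]) (auto intro: carrier_vecI)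

lemma scalar_prod_append_dim:
  assumes "dim_vec a = dim_vec c" "dim_vec b = dim_vec d"
  shows "(a @\<^sub>v b) \<bullet> (c @\<^sub>v d) = a \<bullet> c + b \<bullet> d"
  using assms by (intro scalar_prod_append[of _ "dim_vec a" _ "dim_vec b"]) (auto intro: carrier_vecI)

lemma append_mult_right:
  fixes A B C :: "'a::ring mat"
  shows "dim_col A = dim_row C \<Longrightarrow> dim_col B = dim_row C \<Longrightarrow> (A @\<^sub>r B) * C = (A * C) @\<^sub>r (B * C)"
  by (rule eq_matI) (auto simp: append_rows_def scalar_prod_def intro!: sum.cong)

lemma append_mult_left:
  fixes A B C :: "'a::ring mat"
  shows "dim_row A = dim_row B \<Longrightarrow> dim_col C = dim_row A \<Longrightarrow> C * append_cols A B = append_cols (C * A) (C * B)"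
  by (rule eq_matI) (auto simp: append_cols_def scalar_prod_def intro!: sum.cong)

lemma append_mult_inner:
  fixes A B C D :: "'a::ring mat"
  assumes "dim_row A = dim_row B" "dim_col C = dim_col D" "dim_col A = dim_row C" "dim_col B = dim_row D"
  shows "append_cols A B * (C @\<^sub>r D) = A * C + B * D"
proof (rule eq_matI)
  fix i j assume ij: "i < dim_row (A * C + B * D)" "j < dim_col (A * C + B * D)"
  let ?g = "\<lambda>l. (if l < dim_col A then A $$ (i, l) else B $$ (i, l - dim_col A)) *
      (if l < dim_row C then C $$ (l, j) else D $$ (l - dim_row C, j))"
  have "(append_cols A B * (C @\<^sub>r D)) $$ (i, j) = (\<Sum>l\<in>{0..<dim_row C + dim_row D}. ?g l)"
    using ij assms by (auto simp: append_cols_def append_rows_def scalar_prod_def intro!: sum.cong)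
  also have "\<dots> = (\<Sum>l\<in>{0..<dim_row C}. ?g l) + (\<Sum>l\<in>{dim_row C..<dim_row C + dim_row D}. ?g l)"
    by (rule sum.atLeastLessThan_concat[symmetric]) auto
  also have "(\<Sum>l\<in>{dim_row C..<dim_row C + dim_row D}. ?g l) = (\<Sum>l\<in>{0..<dim_row D}. ?g (l + dim_row C))"
    using sum.shift_bounds_nat_ivl[of ?g 0 "dim_row C" "dim_row D"] by (simp add: add.commute)
  finally show "(append_cols A B * (C @\<^sub>r D)) $$ (i, j) = (A * C + B * D) $$ (i, j)"
    using ij assms by (auto simp: scalar_prod_def)
qed (use assms in auto)

lemma append_cols_inject:
  assumes "dim_row A = dim_row C" "dim_col A = dim_col C" "dim_row B = dim_row A" "dim_row D = dim_row C"
     "dim_col B = dim_col D"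
  shows "append_cols A B = append_cols C D \<longleftrightarrow> A = C \<and> B = D"
proof
  assume e: "append_cols A B = append_cols C D"
  have "append_cols A B $$ (i, j) = append_cols C D $$ (i, j)" for i j using e by simp
  note a = this[unfolded append_cols_def]
  have "A $$ (i, j) = C $$ (i, j)" if "i < dim_row A" "j < dim_col A" for i j
    using a[of i j] that assms by simp
  moreover have "B $$ (i, j) = D $$ (i, j)" if "i < dim_row B" "j < dim_col B" for i j
    using a[of i "j + dim_col A"] that assms by simp
  ultimately show "A = C \<and> B = D" using assms by (auto intro!: eq_matI)
qed simp

lemma append_rows_inject:
  assumes "dim_row A = dim_row C" "dim_col A = dim_col C" "dim_col B = dim_col A" "dim_col D = dim_col C"
     "dim_row B = dim_row D"
  shows "A @\<^sub>r B = C @\<^sub>r D \<longleftrightarrow> A = C \<and> B = D"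
proof
  assume e: "A @\<^sub>r B = C @\<^sub>r D"
  have "(A @\<^sub>r B) $$ (i, j) = (C @\<^sub>r D) $$ (i, j)" for i j using e by simp
  note a = this[unfolded append_rows_def]
  have "A $$ (i, j) = C $$ (i, j)" if "i < dim_row A" "j < dim_col A" for i j
    using a[of i j] that assms by simp
  moreover have "B $$ (i, j) = D $$ (i, j)" if "i < dim_row B" "j < dim_col B" for i j
    using a[of "i + dim_row A" j] that assms by simp
  ultimately show "A = C \<and> B = D" using assms by (auto intro!: eq_matI)
qed simp

lemma transpose_append_rows: "dim_col A = dim_col B \<Longrightarrow> (A @\<^sub>r B)\<^sup>T = append_cols A\<^sup>T B\<^sup>T"
  by (rule eq_matI) (auto simp: append_rows_def append_cols_def)

lemma transpose_append_cols: "dim_row A = dim_row B \<Longrightarrow> (append_cols A B)\<^sup>T = A\<^sup>T @\<^sub>r B\<^sup>T"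
  by (rule eq_matI) (auto simp: append_rows_def append_cols_def)

lemma minv_left_right:
  assumes "invertible_mat A" "A \<in> carrier_mat n n"
  shows "minv A \<in> carrier_mat n n" "A * minv A = 1\<^sub>m n" "minv A * A = 1\<^sub>m n"
proof -
  obtain B where B: "A * B = 1\<^sub>m n" "B * A = 1\<^sub>m (dim_row B)"
    using assms unfolding invertible_mat_def inverts_mat_def by auto
  have d: "dim_row B = n" "dim_col B = n"
    using arg_cong[OF B(1), of dim_col] arg_cong[OF B(2), of dim_col] assms by auto
  have "A \<in> Units (ring_mat TYPE('a) n n)"
    using assms B d unfolding Units_def ring_mat_def by (auto intro!: bexI[of _ B])
  then obtain C where "mat_inverse A = Some C"
    using mat_inverse(1)[OF assms(2), of n] by (cases "mat_inverse A") auto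
  then show "minv A \<in> carrier_mat n n" "A * minv A = 1\<^sub>m n" "minv A * A = 1\<^sub>m n"
    using mat_inverse(2)[OF assms(2)] by (auto simp: minv_def)
qed

lemma invertible_matI:
  fixes A :: "'a::field mat"
  assumes "A \<in> carrier_mat n n" "B \<in> carrier_mat n n" "A * B = 1\<^sub>m n \<or> B * A = 1\<^sub>m n"
  shows "invertible_mat A"
  using assms mat_mult_left_right_inverse[OF assms(1,2)] mat_mult_left_right_inverse[OF assms(2,1)]
  unfolding invertible_mat_def inverts_mat_def by (auto intro!: exI[of _ B])

lemma minv_eqI:
  fixes A :: "'a::field mat"
  assumes "A \<in> carrier_mat n n" "B \<in> carrier_mat n n" "A * B = 1\<^sub>m n"
  shows "minv A = B"
proof -
  note i = minv_left_right[OF invertible_matI[OF assms(1,2)] assms(1)]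
  have "minv A = minv A * (A * B)" using assms i by simp
  also have "\<dots> = B" using assms i by (subst mult_assoc_dim[symmetric]) auto
  finally show ?thesis .
qed

lemma invertible_mat_det:
  fixes A :: "'a::field mat"
  assumes "A \<in> carrier_mat n n" "det A \<noteq> 0"
  shows "invertible_mat A"
proof (rule invertible_matI[OF assms(1)])
  show "(1 / det A) \<cdot>\<^sub>m adj_mat A \<in> carrier_mat n n" using adj_mat(1)[OF assms(1)] by simp
  have "A * ((1 / det A) \<cdot>\<^sub>m adj_mat A) = (1 / det A) \<cdot>\<^sub>m (det A \<cdot>\<^sub>m 1\<^sub>m n)"
    using mult_smult_distrib[OF assms(1) adj_mat(1)[OF assms(1)]] adj_mat(2)[OF assms(1)] by simp
  also have "\<dots> = 1\<^sub>m n" using assms(2) by (intro eq_matI) auto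
  finally show "A * ((1 / det A) \<cdot>\<^sub>m adj_mat A) = 1\<^sub>m n \<or> (1 / det A) \<cdot>\<^sub>m adj_mat A * A = 1\<^sub>m n" ..
qed

lemma invertible_mat_no_kernel:
  fixes A :: "'a::field mat"
  assumes "A \<in> carrier_mat n n" "\<And>v. v \<in> carrier_vec n \<Longrightarrow> A *\<^sub>v v = 0\<^sub>v n \<Longrightarrow> v = 0\<^sub>v n"
  shows "invertible_mat A"
proof (rule invertible_mat_det[OF assms(1)])
  show "det A \<noteq> 0"
  proof
    assume "det A = 0"
    then obtain v where "v \<in> carrier_vec n" "v \<noteq> 0\<^sub>v n" "A *\<^sub>v v = 0\<^sub>v n"
      unfolding det_0_iff_vec_prod_zero_field[OF assms(1)] by blast
    with assms(2)[of v] show False by simp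
  qed
qed

lemma mult_minv_vec:
  assumes "invertible_mat A" "A \<in> carrier_mat n n" "v \<in> carrier_vec n"
  shows "A *\<^sub>v (minv A *\<^sub>v v) = v"
  using mult_vec_assoc_dim[of A "minv A" v, symmetric] minv_left_right[OF assms(1,2)] assms(2,3) by simp

lemma schur_stable_no_eigenvector:
  assumes "schur_stable A" "A \<in> carrier_mat n n" "v \<in> carrier_vec n"
    "map_mat complex_of_real A *\<^sub>v v = \<mu> \<cdot>\<^sub>v v" "1 \<le> cmod \<mu>"
  shows "v = 0\<^sub>v n"
proof (rule ccontr)
  assume "v \<noteq> 0\<^sub>v n"
  then have "eigenvalue (map_mat complex_of_real A) \<mu>"
    unfolding eigenvalue_def eigenvector_def using assms(2-4) by (intro exI[of _ v]) auto
  then show False using assms(1,5) unfolding schur_stable_def by (auto simp: not_le)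
qed

abbreviation cmat :: "real mat \<Rightarrow> complex mat" where "cmat \<equiv> map_mat complex_of_real"
abbreviation rvec :: "complex vec \<Rightarrow> real vec" where "rvec \<equiv> map_vec Re"
abbreviation ivec :: "complex vec \<Rightarrow> real vec" where "ivec \<equiv> map_vec Im"

lemma cmat_arith:
  "dim_row A = dim_row B \<Longrightarrow> dim_col A = dim_col B \<Longrightarrow> cmat (A + B) = cmat A + cmat B"
  "dim_row A = dim_row B \<Longrightarrow> dim_col A = dim_col B \<Longrightarrow> cmat (A - B) = cmat A - cmat B"
  "cmat (- A) = - cmat A"
  "dim_col A = dim_row B \<Longrightarrow> cmat (A * B) = cmat A * cmat B"
  "cmat (A\<^sup>T) = (cmat A)\<^sup>T"
  "cmat (1\<^sub>m n) = 1\<^sub>m n"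
  "cmat (0\<^sub>m n m) = 0\<^sub>m n m"
  by (intro eq_matI; simp add: scalar_prod_def)+

text \<open>
  Modes of real systems are complex vectors. Real matrices act on their real and imaginary
  parts separately, which transfers real inequalities to them.
\<close>

lemma re_im_mat_vec:
  assumes "dim_col A = dim_vec v"
  shows "rvec (cmat A *\<^sub>v v) = A *\<^sub>v rvec v" "ivec (cmat A *\<^sub>v v) = A *\<^sub>v ivec v"
  using assms by (intro eq_vecI; simp add: scalar_prod_def)+

lemma re_im_arith:
  "dim_vec v = dim_vec w \<Longrightarrow> rvec (v + w) = rvec v + rvec w"
  "dim_vec v = dim_vec w \<Longrightarrow> ivec (v + w) = ivec v + ivec w"
  "dim_vec v = dim_vec w \<Longrightarrow> rvec (v - w) = rvec v - rvec w"
  "dim_vec v = dim_vec w \<Longrightarrow> ivec (v - w) = ivec v - ivec w"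
  "rvec (- v) = - rvec v" "ivec (- v) = - ivec v"
  "rvec (c \<cdot>\<^sub>v v) = Re c \<cdot>\<^sub>v rvec v - Im c \<cdot>\<^sub>v ivec v"
  "ivec (c \<cdot>\<^sub>v v) = Im c \<cdot>\<^sub>v rvec v + Re c \<cdot>\<^sub>v ivec v"
  by (intro eq_vecI; simp add: algebra_simps)+

lemma re_im_zero: "rvec v = 0\<^sub>v n \<Longrightarrow> ivec v = 0\<^sub>v n \<Longrightarrow> v = 0\<^sub>v n"
  by (auto simp: vec_eq_iff complex_eq_iff)

section \<open>Eigenvalue stability and the Hautus test\<close>

text \<open>
  For \<open>r\<close> between the spectral radius of \<open>M\<close> and \<open>1\<close>, the matrix \<open>M / r\<close> still has spectral radius
  below \<open>1\<close>, so its powers are bounded and \<open>M\<^sup>N\<close> is \<open>r\<^sup>N\<close> times a bounded sequence.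
\<close>

lemma stable_pow_tendsto_0:
  fixes M :: "complex mat"
  assumes M: "M \<in> carrier_mat n n" and st: "\<And>\<mu>. eigenvalue M \<mu> \<Longrightarrow> cmod \<mu> < 1"
    and ij: "i < n" "j < n"
  shows "(\<lambda>N. (M ^\<^sub>m N) $$ (i, j)) \<longlonglongrightarrow> 0"
proof -
  have n: "n > 0" using ij by auto
  define r where "r = (1 + spectral_radius M) / 2"
  obtain \<mu> where \<mu>: "eigenvalue M \<mu>" "spectral_radius M = cmod \<mu>"
    using spectral_radius_mem_max(1)[OF M n] unfolding spectrum_def by auto
  have sr: "0 \<le> spectral_radius M" "spectral_radius M < 1" using \<mu> st by auto
  then have r: "0 < r" "r < 1" "spectral_radius M < r" unfolding r_def by auto
  define M' where "M' = complex_of_real (1 / r) \<cdot>\<^sub>m M"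
  have M': "M' \<in> carrier_mat n n" using M unfolding M'_def by auto
  have "spectral_radius M' < 1"
  proof -
    obtain \<nu> where \<nu>: "eigenvalue M' \<nu>" "spectral_radius M' = cmod \<nu>"
      using spectral_radius_mem_max(1)[OF M' n] unfolding spectrum_def by auto
    then obtain v where v: "v \<in> carrier_vec n" "v \<noteq> 0\<^sub>v n" "M' *\<^sub>v v = \<nu> \<cdot>\<^sub>v v"
      using M' unfolding eigenvalue_def eigenvector_def by auto
    have "M *\<^sub>v v = complex_of_real r \<cdot>\<^sub>v (M' *\<^sub>v v)"
      using M v(1) r unfolding M'_def by (auto simp: mat_vec_smult_dim intro!: eq_vecI)
    also have "\<dots> = (complex_of_real r * \<nu>) \<cdot>\<^sub>v v" unfolding v(3) by (rule smult_smult_assoc)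
    finally have "eigenvalue M (complex_of_real r * \<nu>)"
      using v M unfolding eigenvalue_def eigenvector_def by auto
    then have "cmod (complex_of_real r * \<nu>) \<le> spectral_radius M"
      using spectral_radius_mem_max(2)[OF M n] unfolding spectrum_def by auto
    then have "r * cmod \<nu> \<le> spectral_radius M" using r by (simp add: norm_mult)
    then have "r * cmod \<nu> < r * 1" using r by linarith
    then have "cmod \<nu> < 1" using mult_less_cancel_left_pos[OF r(1)] by blast
    then show ?thesis using \<nu>(2) by simp
  qed
  from spectral_radius_jnf_norm_bound_less_1_upper_triangular[OF M' this]
  obtain c where c: "\<And>k. norm_bound (M' ^\<^sub>m k) c" by auto
  have pow: "M' ^\<^sub>m k = complex_of_real (1 / r) ^ k \<cdot>\<^sub>m (M ^\<^sub>m k)" for k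
  proof (induction k)
    case 0
    then show ?case using M M' by (intro eq_matI) auto
  next
    case (Suc k)
    have "M' ^\<^sub>m Suc k = (complex_of_real (1 / r) ^ k \<cdot>\<^sub>m (M ^\<^sub>m k)) * (complex_of_real (1 / r) \<cdot>\<^sub>m M)"
      using Suc unfolding M'_def by simp
    also have "\<dots> = complex_of_real (1 / r) ^ Suc k \<cdot>\<^sub>m (M ^\<^sub>m Suc k)"
      using M by (intro eq_matI) (auto simp: pow_mat_dim_square scalar_prod_def sum_distrib_left mult_ac)
    finally show ?case .
  qed
  have "norm ((M ^\<^sub>m k) $$ (i, j)) \<le> r ^ k * c" for k
  proof -
    have "norm ((M' ^\<^sub>m k) $$ (i, j)) \<le> c"
      using c[of k] ij M' unfolding norm_bound_def by (simp add: pow_mat_dim_square[OF M'])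
    then have "(1 / r) ^ k * norm ((M ^\<^sub>m k) $$ (i, j)) \<le> c"
      unfolding pow using ij M r by (simp add: pow_mat_dim_square[OF M] norm_mult norm_power norm_divide)
    then show ?thesis using r by (simp add: field_simps)
  qed
  then have "\<forall>\<^sub>F k in sequentially. norm ((M ^\<^sub>m k) $$ (i, j)) \<le> norm (r ^ k) * c"
    using r by (intro always_eventually) simp
  moreover have "(\<lambda>k. r ^ k) \<longlonglongrightarrow> 0" using r by (intro LIMSEQ_realpow_zero) auto
  ultimately show ?thesis by (rule tendsto_0_le[rotated])
qed

text \<open>
  Induction on the number of unstable eigenvalues. Triangularize \<open>A = P T Q\<close> with an unstable
  eigenvalue in the last place. The last row of \<open>Q\<close> is then a left eigenvector \<open>w\<close>, and the Hautus
  condition provides an input \<open>j\<close> that acts on it. The rank one feedback through this input and \<open>w\<close>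
  changes only the last column of \<open>T\<close>, where it replaces the eigenvalue by \<open>0\<close>. Left eigenvectors
  annihilated by \<open>B\<close> are the same before and after feedback, so the condition persists.
\<close>

lemma hautus_stabilizing_feedback:
  fixes A B :: "complex mat"
  assumes A: "A \<in> carrier_mat n n" and B: "B \<in> carrier_mat n m"
    and hautus: "\<And>\<mu> w. w \<in> carrier_vec n \<Longrightarrow> 1 \<le> cmod \<mu> \<Longrightarrow> A\<^sup>T *\<^sub>v w = \<mu> \<cdot>\<^sub>v w \<Longrightarrow>
      B\<^sup>T *\<^sub>v w = 0\<^sub>v m \<Longrightarrow> w = 0\<^sub>v n"
  shows "\<exists>F \<in> carrier_mat m n. \<forall>\<mu>. eigenvalue (A + B * F) \<mu> \<longrightarrow> cmod \<mu> < 1"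
proof -
  obtain es where "char_poly A = (\<Prod>a\<leftarrow>es. [:- a, 1:])" using char_poly_factorized[OF A] by auto
  then show ?thesis using A hautus
  proof (induction "length (filter (\<lambda>a. 1 \<le> cmod a) es)" arbitrary: A es)
    case 0
    have "cmod \<mu> < 1" if "eigenvalue A \<mu>" for \<mu>
    proof -
      have "\<mu> \<in> set es"
        using that 0(2) unfolding eigenvalue_root_char_poly[OF 0(3)]
        by (auto simp: poly_prod_list prod_list_zero_iff)
      then show ?thesis using 0(1) by (auto simp: filter_empty_conv not_le)
    qed
    moreover have "A + B * 0\<^sub>m m n = A" using 0(3) B by simp
    ultimately show ?case by (intro bexI[of _ "0\<^sub>m m n"]) auto
  next
    case (Suc x)
    note cp = Suc(3) and A = Suc(4) and hautus = Suc(5)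
    obtain ev where ev: "ev \<in> set es" "1 \<le> cmod ev"
      using Suc(2) by (metis filter_empty_conv list.size(3) nat.distinct(1))
    define fs where "fs = remove1 ev es"
    have mset: "mset (fs @ [ev]) = mset es" using ev by (simp add: fs_def)
    have cp': "char_poly A = (\<Prod>a\<leftarrow>fs @ [ev]. [:- a, 1:])"
      unfolding cp prod_mset_prod_list[symmetric] mset_map mset ..
    obtain T P Q where sch: "schur_decomposition A (fs @ [ev]) = (T, P, Q)"
      by (cases "schur_decomposition A (fs @ [ev])") auto
    note s = schur_decomposition[OF A cp' sch]
    have car: "T \<in> carrier_mat n n" "P \<in> carrier_mat n n" "Q \<in> carrier_mat n n"
      and PQ: "P * Q = 1\<^sub>m n" "Q * P = 1\<^sub>m n" and AT: "A = P * T * Q"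
      and ut: "upper_triangular T" and dg: "diag_mat T = fs @ [ev]"
      using s A unfolding similar_mat_wit_def Let_def by auto
    have len: "length fs = n - 1" "n > 0"
      using arg_cong[OF dg, of length] car unfolding diag_mat_def by auto
    define l where "l = n - 1"
    have l: "l < n" using len by (simp add: l_def)
    have diag: "T $$ (i, i) = (fs @ [ev]) ! i" if "i < n" for i
      using arg_cong[OF dg, of "\<lambda>x. x ! i"] that car unfolding diag_mat_def by simp
    have Tll: "T $$ (l, l) = ev" using diag[OF l] len by (simp add: l_def nth_append)
    have TQ: "T * Q = Q * A"
    proof -
      have "Q * A = Q * P * (T * Q)" unfolding AT using car by (simp add: mult_assoc_dim)
      then show ?thesis using PQ car by simp
    qed
    define w where "w = row Q l"
    have w: "w \<in> carrier_vec n" using car l by (auto simp: w_def)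
    have Aw: "A\<^sup>T *\<^sub>v w = ev \<cdot>\<^sub>v w"
    proof (rule eq_vecI)
      fix c assume "c < dim_vec (ev \<cdot>\<^sub>v w)"
      then have c: "c < n" using w by simp
      have "(A\<^sup>T *\<^sub>v w) $ c = (Q * A) $$ (l, c)"
        using c l car A by (simp add: w_def scalar_prod_def mult.commute)
      also have "\<dots> = (\<Sum>d = 0..<n. T $$ (l, d) * Q $$ (d, c))"
        unfolding TQ[symmetric] using c l car by (simp add: scalar_prod_def)
      also have "\<dots> = (\<Sum>d = 0..<n. if d = l then ev * Q $$ (l, c) else 0)"
        using ut l car Tll by (intro sum.cong) (auto simp: upper_triangular_def l_def)
      also have "\<dots> = (ev \<cdot>\<^sub>v w) $ c" using c l car by (simp add: w_def)
      finally show "(A\<^sup>T *\<^sub>v w) $ c = (ev \<cdot>\<^sub>v w) $ c" .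
    qed (use w A in auto)
    have w0: "w \<noteq> 0\<^sub>v n"
    proof
      assume "w = 0\<^sub>v n"
      then have "(Q * P) $$ (l, l) = 0" using car l by (simp add: w_def)
      then show False using PQ l by simp
    qed
    have "B\<^sup>T *\<^sub>v w \<noteq> 0\<^sub>v m" using hautus[OF w ev(2) Aw] w0 by blast
    then obtain j where j: "j < m" "(B\<^sup>T *\<^sub>v w) $ j \<noteq> 0"
      using B by (auto simp: vec_eq_iff)
    define \<beta> where "\<beta> = (B\<^sup>T *\<^sub>v w) $ j"
    have \<beta>: "(Q * B) $$ (l, j) = \<beta>" "\<beta> \<noteq> 0"
      using j l car B by (auto simp: \<beta>_def w_def scalar_prod_def mult.commute)
    \<comment> \<open>the feedback \<open>- (ev / \<beta>) e\<^sub>j w\<^sup>T\<close>\<close>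
    define F0 where "F0 = mat m n (\<lambda>(i, c). if i = j then - (ev / \<beta>) * Q $$ (l, c) else 0)"
    have F0: "F0 \<in> carrier_mat m n" by (simp add: F0_def)
    define A' where "A' = A + B * F0"
    have A': "A' \<in> carrier_mat n n" using A B F0 by (simp add: A'_def)
    define T' where "T' = Q * A' * P"
    have T': "T' \<in> carrier_mat n n" using car A' by (simp add: T'_def)
    have F0P: "F0 * P = mat m n (\<lambda>(i, c). if i = j \<and> c = l then - (ev / \<beta>) else 0)"
    proof (rule eq_matI, goal_cases)
      case (1 i c)
      have "(F0 * P) $$ (i, c) = (if i = j then - (ev / \<beta>) * (Q * P) $$ (l, c) else 0)"
        using 1 car l by (auto simp: F0_def scalar_prod_def sum_distrib_left mult_ac)
      then show ?case using 1 l by (auto simp: PQ)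
    qed (use F0 car in auto)
    have T'eq: "T' = T + Q * B * (F0 * P)"
    proof -
      have "Q * A * P = T" unfolding TQ[symmetric] using PQ car by (simp add: mult_assoc_dim)
      then show ?thesis unfolding T'_def A'_def using car A B F0
        by (simp add: mat_distrib_dim mult_assoc_dim)
    qed
    have T'idx: "T' $$ (i, c) = T $$ (i, c) + (if c = l then - (ev / \<beta>) * (Q * B) $$ (i, j) else 0)"
      if "i < n" "c < n" for i c
    proof -
      have "(Q * B * (F0 * P)) $$ (i, c) = (\<Sum>d = 0..<m. (Q * B) $$ (i, d) * (if d = j \<and> c = l then - (ev / \<beta>) else 0))"
        unfolding F0P using that car B by (simp add: scalar_prod_def)
      also have "\<dots> = (\<Sum>d = 0..<m. if d = j then (if c = l then - (ev / \<beta>) * (Q * B) $$ (i, j) else 0) else 0)"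
        by (intro sum.cong) auto
      also have "\<dots> = (if c = l then - (ev / \<beta>) * (Q * B) $$ (i, j) else 0)" using j by simp
      finally show ?thesis unfolding T'eq using that car B F0 by simp
    qed
    have "upper_triangular T'"
      using T' car ut by (intro upper_triangularI) (auto simp: T'idx l_def upper_triangular_def)
    moreover have "diag_mat T' = fs @ [0]"
    proof (rule nth_equalityI)
      fix i assume "i < length (diag_mat T')"
      then have i: "i < n" using T' by (simp add: diag_mat_def)
      then show "diag_mat T' ! i = (fs @ [0]) ! i"
        using T' diag[OF i] \<beta> len T'idx[OF i i] by (auto simp: diag_mat_def nth_append l_def)
    qed (use T' len in \<open>auto simp: diag_mat_def\<close>)
    ultimately have cpT: "char_poly T' = (\<Prod>a\<leftarrow>fs @ [0]. [:- a, 1:])"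
      using char_poly_upper_triangular[OF T'] by simp
    have "similar_mat T' A'"
      unfolding similar_mat_def
      by (intro exI[of _ Q] exI[of _ P] similar_mat_witI) (use T'_def car PQ A' T' in auto)
    then have cpA': "char_poly A' = (\<Prod>a\<leftarrow>fs @ [0]. [:- a, 1:])"
      using cpT char_poly_similar by metis
    have x: "x = length (filter (\<lambda>a. 1 \<le> cmod a) (fs @ [0]))"
    proof -
      have "length (filter (\<lambda>a. 1 \<le> cmod a) es) = size (filter_mset (\<lambda>a. 1 \<le> cmod a) (mset es))"
        by (metis mset_filter size_mset)
      also have "\<dots> = Suc (length (filter (\<lambda>a. 1 \<le> cmod a) fs))"
        unfolding mset[symmetric] using ev(2) by (simp flip: mset_filter)
      finally show ?thesis using Suc(2) by simp
    qed
    have "\<exists>F\<in>carrier_mat m n. \<forall>\<mu>. eigenvalue (A' + B * F) \<mu> \<longrightarrow> cmod \<mu> < 1"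
    proof (rule Suc(1)[OF x cpA' A'])
      fix \<mu> v assume v: "v \<in> carrier_vec n" "1 \<le> cmod \<mu>" "A'\<^sup>T *\<^sub>v v = \<mu> \<cdot>\<^sub>v v" "B\<^sup>T *\<^sub>v v = 0\<^sub>v m"
      have "A'\<^sup>T *\<^sub>v v = A\<^sup>T *\<^sub>v v + F0\<^sup>T *\<^sub>v (B\<^sup>T *\<^sub>v v)"
        using A B F0 v(1) by (simp add: A'_def transpose_arith_dim transpose_mult_dim mat_vec_expand)
      then have "A\<^sup>T *\<^sub>v v = \<mu> \<cdot>\<^sub>v v" using v A F0 by (simp add: mat_vec_expand)
      then show "v = 0\<^sub>v n" using hautus v by blast
    qed
    then obtain F where F: "F \<in> carrier_mat m n" "\<And>\<mu>. eigenvalue (A' + B * F) \<mu> \<Longrightarrow> cmod \<mu> < 1" by auto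
    have "A' + B * F = A + B * (F0 + F)"
      unfolding A'_def using A B F0 F(1) by (simp add: mat_distrib_dim assoc_add_mat[of _ n n])
    then show ?case using F F0 by (intro bexI[of _ "F0 + F"]) auto
  qed
qed

section \<open>Real solutions of a Stein inequality from steering sequences\<close>

lemma real_scalar_prod_self:
  fixes v :: "real vec"
  shows "0 \<le> v \<bullet> v" "v \<in> carrier_vec n \<Longrightarrow> v \<noteq> 0\<^sub>v n \<Longrightarrow> 0 < v \<bullet> v"
proof -
  show ge: "0 \<le> v \<bullet> v" by (auto simp: scalar_prod_def intro!: sum_nonneg)
  assume v: "v \<in> carrier_vec n" "v \<noteq> 0\<^sub>v n"
  have "v \<bullet> v \<noteq> 0"
  proof
    assume "v \<bullet> v = 0"
    then have "\<forall>i\<in>{0..<n}. v $ i * v $ i = 0"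
      using v(1) unfolding scalar_prod_def by (subst (asm) sum_nonneg_eq_0_iff) auto
    then show False using v by (auto simp: vec_eq_iff)
  qed
  then show "0 < v \<bullet> v" using ge by simp
qed

text \<open>
  Crude, but it turns entrywise convergence of \<open>K\<close> to \<open>0\<close> into smallness of the quadratic form.
\<close>

lemma quadratic_form_bound:
  fixes K :: "real mat" and s :: "real vec"
  assumes K: "K \<in> carrier_mat n n" and s: "s \<in> carrier_vec n"
  shows "s \<bullet> (K *\<^sub>v s) \<le> (\<Sum>i<n. \<Sum>j<n. \<bar>K $$ (i, j)\<bar>) * (s \<bullet> s)"
proof -
  have comp: "(s $ i)\<^sup>2 \<le> s \<bullet> s" if "i < n" for i
    using that s member_le_sum[of i "{0..<n}" "\<lambda>i. s $ i * s $ i"]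
    by (auto simp: scalar_prod_def power2_eq_square)
  have "s $ i * (K $$ (i, j) * s $ j) \<le> \<bar>K $$ (i, j)\<bar> * (s \<bullet> s)" if "i < n" "j < n" for i j
  proof -
    have "2 * \<bar>s $ i * s $ j\<bar> \<le> (s $ i)\<^sup>2 + (s $ j)\<^sup>2"
      using sum_squares_bound[of "\<bar>s $ i\<bar>" "\<bar>s $ j\<bar>"] by (simp add: abs_mult)
    then have "\<bar>s $ i * s $ j\<bar> \<le> s \<bullet> s" using comp[OF that(1)] comp[OF that(2)] by linarith
    then have "\<bar>K $$ (i, j)\<bar> * \<bar>s $ i * s $ j\<bar> \<le> \<bar>K $$ (i, j)\<bar> * (s \<bullet> s)"
      by (intro mult_left_mono) auto
    moreover have "s $ i * (K $$ (i, j) * s $ j) \<le> \<bar>K $$ (i, j)\<bar> * \<bar>s $ i * s $ j\<bar>"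
      by (metis abs_ge_self abs_mult mult.commute mult.left_commute)
    ultimately show ?thesis by linarith
  qed
  then have "(\<Sum>i<n. \<Sum>j<n. s $ i * (K $$ (i, j) * s $ j)) \<le> (\<Sum>i<n. \<Sum>j<n. \<bar>K $$ (i, j)\<bar> * (s \<bullet> s))"
    by (intro sum_mono) auto
  also have "\<dots> = (\<Sum>i<n. \<Sum>j<n. \<bar>K $$ (i, j)\<bar>) * (s \<bullet> s)" by (simp add: sum_distrib_right)
  also have "(\<Sum>i<n. \<Sum>j<n. s $ i * (K $$ (i, j) * s $ j)) = s \<bullet> (K *\<^sub>v s)"
    using K s by (auto simp: scalar_prod_def sum_distrib_left atLeast0LessThan intro!: sum.cong)
  finally show ?thesis .
qed

text \<open>
  The quadratic form is that of \<open>[Z, A Z + B L, G; \<star>, Z, 0; \<star>, \<star>, I]\<close>. With \<open>A\<^sub>F = A + B L Z\<^sup>-\<^sup>1\<close>,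
  Schur complements turn its positivity into \<open>Z \<succ> 0\<close> and the Stein inequality
  \<open>Z - A\<^sub>F Z A\<^sub>F\<^sup>T - G G\<^sup>T \<succ> 0\<close>.
\<close>

definition steering_solution ::
  "nat \<Rightarrow> nat \<Rightarrow> real mat \<Rightarrow> real mat \<Rightarrow> real mat \<Rightarrow> real mat \<Rightarrow> real mat \<Rightarrow> bool"
where
  "steering_solution n p A B G Z L \<longleftrightarrow> Z\<^sup>T = Z \<and>
    (\<forall>s \<in> carrier_vec n. \<forall>t \<in> carrier_vec n. \<forall>v \<in> carrier_vec p.
       \<not> (s = 0\<^sub>v n \<and> t = 0\<^sub>v n \<and> v = 0\<^sub>v p) \<longrightarrow>
       0 < s \<bullet> (Z *\<^sub>v s) + 2 * (s \<bullet> (A *\<^sub>v (Z *\<^sub>v t) + B *\<^sub>v (L *\<^sub>v t))) + t \<bullet> (Z *\<^sub>v t)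
           + 2 * (s \<bullet> (G *\<^sub>v v)) + v \<bullet> v)"

text \<open>
  The solution is \<open>Z = \<Sum>\<^sub>i T\<^sub>i R T\<^sub>i\<^sup>T\<close>, \<open>L = \<Sum>\<^sub>i H\<^sub>i R T\<^sub>i\<^sup>T\<close> over \<open>i < N\<close>. As \<open>A T\<^sub>i + B H\<^sub>i = T\<^sub>i\<^sub>+\<^sub>1\<close>, the
  part of the form without \<open>v\<close> telescopes: with \<open>r(q) = q \<bullet> R q\<close> it is
  \<open>\<Sum>\<^sub>i r(T\<^sub>i\<^sub>+\<^sub>1\<^sup>T s + T\<^sub>i\<^sup>T t) + r(s) - r(T\<^sub>N\<^sup>T s)\<close>. For large \<open>N\<close> the negative term is at most \<open>|s|\<^sup>2\<close>. The
  choice \<open>R = G G\<^sup>T + 2 I\<close> makes \<open>r(s)\<close> complete the square of \<open>G\<^sup>T s + v\<close> and leaves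
  \<open>|s|\<^sup>2\<close> beyond the negative term; when \<open>s = 0\<close>, the term with \<open>i = 0\<close> contributes \<open>r(t)\<close>.
\<close>

lemma steering_lmi:
  fixes A B G :: "real mat" and T H :: "nat \<Rightarrow> real mat"
  assumes A: "A \<in> carrier_mat n n" and B: "B \<in> carrier_mat n m" and G: "G \<in> carrier_mat n p"
    and T: "\<And>i. T i \<in> carrier_mat n n" and H: "\<And>i. H i \<in> carrier_mat m n"
    and T0: "T 0 = 1\<^sub>m n" and TSuc: "\<And>i. T (Suc i) = A * T i + B * H i"
    and lim: "\<And>i j. i < n \<Longrightarrow> j < n \<Longrightarrow> (\<lambda>N. T N $$ (i, j)) \<longlonglongrightarrow> 0"
  shows "\<exists>Z \<in> carrier_mat n n. \<exists>L \<in> carrier_mat m n. steering_solution n p A B G Z L"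
proof -
  have Td [simp]: "dim_row (T i) = n" "dim_col (T i) = n" and Hd [simp]: "dim_row (H i) = m" "dim_col (H i) = n" for i
    using T[of i] H[of i] by auto
  define R where "R = G * G\<^sup>T + 2 \<cdot>\<^sub>m 1\<^sub>m n"
  have R: "R \<in> carrier_mat n n" and Rsym: "R\<^sup>T = R"
    using G by (auto simp: R_def transpose_arith_dim transpose_mult_dim intro!: eq_matI)
  define r where "r = (\<lambda>u. u \<bullet> (R *\<^sub>v u))"
  have r_eq: "r u = (G\<^sup>T *\<^sub>v u) \<bullet> (G\<^sup>T *\<^sub>v u) + 2 * (u \<bullet> u)" if u: "u \<in> carrier_vec n" for u
  proof -
    have "u \<bullet> (G *\<^sub>v (G\<^sup>T *\<^sub>v u)) = (G\<^sup>T *\<^sub>v u) \<bullet> (G\<^sup>T *\<^sub>v u)"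
      using transpose_scalar_dim[of G u "G\<^sup>T *\<^sub>v u"] G u by simp
    then show ?thesis unfolding r_def R_def using G u
      by (simp add: mat_vec_expand scalar_prod_distrib_dim scalar_prod_smult_dim)
  qed
  have r_ge: "0 \<le> r u" if "u \<in> carrier_vec n" for u
    unfolding r_eq[OF that] using real_scalar_prod_self(1) by (simp add: add_nonneg_nonneg)
  have r_add: "r (c + b) = r c + 2 * (c \<bullet> (R *\<^sub>v b)) + r b" if "c \<in> carrier_vec n" "b \<in> carrier_vec n" for b c
    using that R transpose_scalar_dim[of R c b] unfolding r_def
    by (simp add: mat_vec_expand scalar_prod_distrib_dim Rsym)

  define Z where "Z = rec_nat (0\<^sub>m n n) (\<lambda>i Z. Z + T i * (R * (T i)\<^sup>T))"
  define L where "L = rec_nat (0\<^sub>m m n) (\<lambda>i L. L + H i * (R * (T i)\<^sup>T))"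
  have Z: "Z N \<in> carrier_mat n n" "(Z N)\<^sup>T = Z N" and L: "L N \<in> carrier_mat m n" for N
  proof (induction N)
    case (Suc N)
    { case 1 then show ?case using Suc R by (intro carrier_matI) (simp_all add: Z_def) }
    { case 2 then show ?case using Suc T[of N] R
        by (simp add: Z_def transpose_arith_dim transpose_mult_dim Rsym mult_assoc_dim) }
    { case 3 then show ?case using Suc R by (intro carrier_matI) (simp_all add: L_def) }
  qed (auto simp: Z_def L_def)

  define form where "form = (\<lambda>N s t. s \<bullet> (Z N *\<^sub>v s) +
      2 * (s \<bullet> (A *\<^sub>v (Z N *\<^sub>v t) + B *\<^sub>v (L N *\<^sub>v t))) + t \<bullet> (Z N *\<^sub>v t))"
  have step: "form (Suc N) s t = form N s t + r ((T (Suc N))\<^sup>T *\<^sub>v s + (T N)\<^sup>T *\<^sub>v t)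
      + r ((T N)\<^sup>T *\<^sub>v s) - r ((T (Suc N))\<^sup>T *\<^sub>v s)"
    if s: "s \<in> carrier_vec n" and t: "t \<in> carrier_vec n" for N s t
  proof -
    let ?a = "(T N)\<^sup>T *\<^sub>v s" and ?b = "(T N)\<^sup>T *\<^sub>v t" and ?c = "(T (Suc N))\<^sup>T *\<^sub>v s"
    have car: "?a \<in> carrier_vec n" "?b \<in> carrier_vec n" "?c \<in> carrier_vec n"
      by (auto intro: carrier_vecI)
    have "Z (Suc N) *\<^sub>v u = Z N *\<^sub>v u + T N *\<^sub>v (R *\<^sub>v ((T N)\<^sup>T *\<^sub>v u))" if "u \<in> carrier_vec n" for u
      using that Z[of N] T[of N] R by (simp add: Z_def mat_vec_expand)
    note Zs = this[OF s] this[OF t]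
    have Lt: "L (Suc N) *\<^sub>v t = L N *\<^sub>v t + H N *\<^sub>v (R *\<^sub>v ?b)"
      using L[of N] T[of N] H[of N] R t by (simp add: L_def mat_vec_expand)
    have tr: "u \<bullet> (T i *\<^sub>v (R *\<^sub>v w)) = ((T i)\<^sup>T *\<^sub>v u) \<bullet> (R *\<^sub>v w)"
      if "u \<in> carrier_vec n" "w \<in> carrier_vec n" for u w i
    proof -
      have "u \<bullet> (T i *\<^sub>v (R *\<^sub>v w)) = (R *\<^sub>v w) \<bullet> ((T i)\<^sup>T *\<^sub>v u)"
        using transpose_scalar_dim[of "T i" u "R *\<^sub>v w"] that T[of i] R by simp
      also have "\<dots> = ((T i)\<^sup>T *\<^sub>v u) \<bullet> (R *\<^sub>v w)"
        using that T[of i] R by (intro comm_scalar_prod[of _ n] carrier_vecI) auto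
      finally show ?thesis .
    qed
    have "A *\<^sub>v (Z (Suc N) *\<^sub>v t) + B *\<^sub>v (L (Suc N) *\<^sub>v t) =
        (A *\<^sub>v (Z N *\<^sub>v t) + B *\<^sub>v (L N *\<^sub>v t)) + T (Suc N) *\<^sub>v (R *\<^sub>v ?b)"
      unfolding Zs Lt TSuc using A B Z[of N] L[of N] T[of N] H[of N] R t
      by (intro eq_vecI) (simp_all add: mat_vec_expand del: index_mult_mat_vec)
    then have "s \<bullet> (A *\<^sub>v (Z (Suc N) *\<^sub>v t) + B *\<^sub>v (L (Suc N) *\<^sub>v t)) =
        s \<bullet> (A *\<^sub>v (Z N *\<^sub>v t) + B *\<^sub>v (L N *\<^sub>v t)) + ?c \<bullet> (R *\<^sub>v ?b)"
      using A B Z[of N] L[of N] R s t tr[OF s car(2), of "Suc N"]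
      by (simp add: scalar_prod_distrib_dim)
    moreover have "s \<bullet> (Z (Suc N) *\<^sub>v s) = s \<bullet> (Z N *\<^sub>v s) + r ?a"
      "t \<bullet> (Z (Suc N) *\<^sub>v t) = t \<bullet> (Z N *\<^sub>v t) + r ?b"
      unfolding Zs r_def using Z[of N] T[of N] R s t tr[OF s car(1), of N] tr[OF t car(2), of N]
      by (simp_all add: scalar_prod_distrib_dim)
    ultimately show ?thesis unfolding form_def r_add[OF car(3,2)] by simp
  qed
  have form_ge: "form (Suc N) s t \<ge> r s - r ((T (Suc N))\<^sup>T *\<^sub>v s) + r ((T 1)\<^sup>T *\<^sub>v s + t)"
    if s: "s \<in> carrier_vec n" and t: "t \<in> carrier_vec n" for N s t
  proof (induction N)
    case 0
    have "form 0 s t = 0" using A B s t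
      by (simp add: form_def Z_def L_def mat_vec_expand scalar_prod_zero_dim)
    then show ?case using step[OF s t, of 0] T0 s t by simp
  next
    case (Suc N)
    have "0 \<le> r ((T (Suc (Suc N)))\<^sup>T *\<^sub>v s + (T (Suc N))\<^sup>T *\<^sub>v t)"
      using s t by (intro r_ge carrier_vecI) simp
    then show ?case using Suc step[OF s t, of "Suc N"] by linarith
  qed

  define K where "K = (\<lambda>N. T N * (R * (T N)\<^sup>T))"
  have K: "K N \<in> carrier_mat n n" for N using R by (intro carrier_matI) (simp_all add: K_def)
  have Kidx: "K N $$ (i, j) = (\<Sum>a<n. T N $$ (i, a) * (\<Sum>b<n. R $$ (a, b) * T N $$ (j, b)))"
    if "i < n" "j < n" for N i j
    using that T[of N] R by (auto simp: K_def scalar_prod_def atLeast0LessThan intro!: sum.cong)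
  have "(\<lambda>N. \<Sum>i<n. \<Sum>j<n. \<bar>K N $$ (i, j)\<bar>) \<longlonglongrightarrow> (\<Sum>i<n. \<Sum>j<n. \<bar>\<Sum>a<n. 0 * (\<Sum>b<n. R $$ (a, b) * 0)\<bar>)"
    by (intro tendsto_sum) (simp only: Kidx lessThan_iff, intro tendsto_intros lim, auto)
  then have "(\<lambda>N. \<Sum>i<n. \<Sum>j<n. \<bar>K N $$ (i, j)\<bar>) \<longlonglongrightarrow> 0" by simp
  then have "\<forall>\<^sub>F N in sequentially. (\<Sum>i<n. \<Sum>j<n. \<bar>K N $$ (i, j)\<bar>) < 1"
    by (rule order_tendstoD) simp
  then obtain N0 where N0: "\<And>N. N0 \<le> N \<Longrightarrow> (\<Sum>i<n. \<Sum>j<n. \<bar>K N $$ (i, j)\<bar>) < 1"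
    unfolding eventually_sequentially by auto
  have small: "r ((T (Suc N0))\<^sup>T *\<^sub>v s) \<le> s \<bullet> s" if s: "s \<in> carrier_vec n" for s
  proof -
    have "r ((T (Suc N0))\<^sup>T *\<^sub>v s) = s \<bullet> (K (Suc N0) *\<^sub>v s)"
    proof -
      let ?u = "(T (Suc N0))\<^sup>T *\<^sub>v s"
      have "s \<bullet> (K (Suc N0) *\<^sub>v s) = (R *\<^sub>v ?u) \<bullet> ?u"
        using transpose_scalar_dim[of "T (Suc N0)" s "R *\<^sub>v ?u"] s T[of "Suc N0"] R
        by (simp add: K_def mat_vec_expand)
      also have "\<dots> = ?u \<bullet> (R *\<^sub>v ?u)"
        using s T[of "Suc N0"] R by (intro comm_scalar_prod[of _ n] carrier_vecI) auto
      finally show ?thesis by (simp add: r_def)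
    qed
    also have "\<dots> \<le> (\<Sum>i<n. \<Sum>j<n. \<bar>K (Suc N0) $$ (i, j)\<bar>) * (s \<bullet> s)"
      by (rule quadratic_form_bound[OF K s])
    also have "\<dots> \<le> 1 * (s \<bullet> s)"
      using N0[of "Suc N0"] real_scalar_prod_self(1)[of s] by (intro mult_right_mono) auto
    finally show ?thesis by simp
  qed
  show ?thesis unfolding steering_solution_def
  proof (rule bexI[of _ "Z (Suc N0)", OF _ Z(1)], rule bexI[of _ "L (Suc N0)", OF _ L], intro conjI ballI impI Z(2))
    fix s t v :: "real vec" assume s: "s \<in> carrier_vec n" and t: "t \<in> carrier_vec n" and v: "v \<in> carrier_vec p"
      and nz: "\<not> (s = 0\<^sub>v n \<and> t = 0\<^sub>v n \<and> v = 0\<^sub>v p)"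
    let ?g = "G\<^sup>T *\<^sub>v s" and ?u = "(T 1)\<^sup>T *\<^sub>v s + t"
    have car: "?g \<in> carrier_vec p" "?u \<in> carrier_vec n" using G s t by (auto intro: carrier_vecI)
    have gv: "s \<bullet> (G *\<^sub>v v) = ?g \<bullet> v"
      using transpose_scalar_dim[of G s v] comm_scalar_prod[OF v car(1)] G s v by simp
    have sq: "(?g + v) \<bullet> (?g + v) = ?g \<bullet> ?g + 2 * (?g \<bullet> v) + v \<bullet> v"
      using G s v comm_scalar_prod[OF v car(1)] by (simp add: scalar_prod_distrib_dim)
    have "form (Suc N0) s t + 2 * (s \<bullet> (G *\<^sub>v v)) + v \<bullet> v \<ge> (?g + v) \<bullet> (?g + v) + s \<bullet> s + r ?u"
      using form_ge[OF s t, of N0] small[OF s] unfolding sq gv r_eq[OF s] by linarith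
    moreover have "(?g + v) \<bullet> (?g + v) + s \<bullet> s + r ?u > 0"
    proof (cases "s = 0\<^sub>v n")
      case False
      then show ?thesis using real_scalar_prod_self(2)[OF s] real_scalar_prod_self(1)[of "?g + v"] r_ge[OF car(2)]
        by linarith
    next
      case True
      then have g: "?g + v = v" "?u = t" "s \<bullet> s = 0"
        using G v t T[of 1] by (simp_all add: mat_vec_zero_dim scalar_prod_zero_dim)
      have "t \<noteq> 0\<^sub>v n \<or> v \<noteq> 0\<^sub>v p" using True nz by blast
      then have "0 < t \<bullet> t \<or> 0 < v \<bullet> v"
        using real_scalar_prod_self(2)[OF t] real_scalar_prod_self(2)[OF v] by blast
      moreover have "r t \<ge> 2 * (t \<bullet> t)" unfolding r_eq[OF t] using real_scalar_prod_self(1) by simp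
      ultimately show ?thesis unfolding g using real_scalar_prod_self(1)[of t] real_scalar_prod_self(1)[of v]
        by linarith
    qed
    ultimately show "0 < s \<bullet> (Z (Suc N0) *\<^sub>v s) + 2 * (s \<bullet> (A *\<^sub>v (Z (Suc N0) *\<^sub>v t) + B *\<^sub>v (L (Suc N0) *\<^sub>v t)))
        + t \<bullet> (Z (Suc N0) *\<^sub>v t) + 2 * (s \<bullet> (G *\<^sub>v v)) + v \<bullet> v"
      unfolding form_def by linarith
  qed
qed

text \<open>
  The stabilizing feedback \<open>F\<close> is complex, but steering takes just two sequences: since \<open>A\<close> and
  \<open>B\<close> are real, the real parts of \<open>(A + B F)\<^sup>i\<close> obey the recursion of \<open>steering_lmi\<close> with the
  real parts of \<open>F (A + B F)\<^sup>i\<close> as controls.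
\<close>

lemma hautus_lmi:
  fixes A B G :: "real mat"
  assumes A: "A \<in> carrier_mat n n" and B: "B \<in> carrier_mat n m" and G: "G \<in> carrier_mat n p"
    and hautus: "\<And>\<mu> w. w \<in> carrier_vec n \<Longrightarrow> 1 \<le> cmod \<mu> \<Longrightarrow> (cmat A)\<^sup>T *\<^sub>v w = \<mu> \<cdot>\<^sub>v w \<Longrightarrow>
      (cmat B)\<^sup>T *\<^sub>v w = 0\<^sub>v m \<Longrightarrow> w = 0\<^sub>v n"
  shows "\<exists>Z \<in> carrier_mat n n. \<exists>L \<in> carrier_mat m n. steering_solution n p A B G Z L"
proof -
  obtain F where F: "F \<in> carrier_mat m n"
    and stable: "\<And>\<mu>. eigenvalue (cmat A + cmat B * F) \<mu> \<Longrightarrow> cmod \<mu> < 1"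
    using hautus_stabilizing_feedback[of "cmat A" n "cmat B" m] A B hautus by auto
  define M where "M = cmat A + cmat B * F"
  have M: "M \<in> carrier_mat n n" using A B F by (simp add: M_def)
  have Mpow [simp]: "dim_row (M ^\<^sub>m i) = n" "dim_col (M ^\<^sub>m i) = n" for i
    using pow_carrier_mat[OF M, of i] by auto
  have Md [simp]: "dim_row M = n" "dim_col M = n" using M by auto
  have re_mult: "map_mat Re (cmat P * Q) = P * map_mat Re Q" if "dim_col P = dim_row Q" for P Q
    using that by (intro eq_matI) (simp_all add: scalar_prod_def)
  define T where "T = (\<lambda>i. map_mat Re (M ^\<^sub>m i))"
  define H where "H = (\<lambda>i. map_mat Re (F * M ^\<^sub>m i))"
  show ?thesis
  proof (rule steering_lmi[OF A B G, of T H])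
    show "T i \<in> carrier_mat n n" "H i \<in> carrier_mat m n" for i
      using F by (auto simp: T_def H_def intro!: carrier_matI)
    show "T 0 = 1\<^sub>m n" using M by (intro eq_matI) (auto simp: T_def)
    show "T (Suc i) = A * T i + B * H i" for i
    proof -
      have "M ^\<^sub>m Suc i = M * M ^\<^sub>m i"
        by (induction i) (simp_all add: mult_assoc_dim)
      also have "\<dots> = cmat A * M ^\<^sub>m i + cmat B * (F * M ^\<^sub>m i)"
        unfolding M_def using A B F Mpow[of i, unfolded M_def] by (simp add: mat_distrib_dim mult_assoc_dim)
      finally have "T (Suc i) = map_mat Re (cmat A * M ^\<^sub>m i) + map_mat Re (cmat B * (F * M ^\<^sub>m i))"
        unfolding T_def using A B F by (intro eq_matI) (auto simp del: pow_mat.simps)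
      then show ?thesis unfolding T_def H_def using A B F by (simp add: re_mult del: pow_mat.simps)
    qed
    show "(\<lambda>N. T N $$ (i, j)) \<longlonglongrightarrow> 0" if "i < n" "j < n" for i j
      using tendsto_Re[OF stable_pow_tendsto_0[OF M stable[folded M_def] that]] that by (simp add: T_def)
  qed
qed

section \<open>The linear matrix inequality as a dissipation inequality\<close>

lemma lmi_varsD:
  assumes "lmi_vars k p m X Z Q F LX LY RX RY"
  shows "X \<in> carrier_mat k k" "Z \<in> carrier_mat k k" "Q \<in> carrier_mat k k" "F \<in> carrier_mat k p"
    "LX \<in> carrier_mat p k" "LY \<in> carrier_mat m k" "RX \<in> carrier_mat p p" "RY \<in> carrier_mat m p"
  using assms by (auto simp: lmi_vars_def)

text \<open>
  The terms are grouped by their meaning. For \<open>w\<^sub>3, w\<^sub>4, w\<^sub>5\<close> the vector \<open>X w\<^sub>3 + Z w\<^sub>4\<close> is a state of the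
  left factors, the vector paired with \<open>v\<^sub>1\<close> is its successor, \<open>Q (w\<^sub>3 + w\<^sub>4) + F w\<^sub>5\<close> is
  the successor of the state of \<open>(\<^bold>X, \<^bold>Y)\<close>, and the vector paired with \<open>v\<^sub>6\<close> is the error \<open>M\<^sub>l \<^bold>X w - N\<^sub>l \<^bold>Y w - w\<close>.
  The blocks below the diagonal give the same terms with the two vectors exchanged.
\<close>

lemma lmi_mat_bilinear:
  fixes v1 v2 v3 v4 v5 v6 w1 w2 w3 w4 w5 w6 :: "real vec"
  assumes dims: "A \<in> carrier_mat k k" "BM \<in> carrier_mat k p" "BN \<in> carrier_mat k m"
      "C \<in> carrier_mat p k" "DM \<in> carrier_mat p p" "DN \<in> carrier_mat p m"
    and vars: "lmi_vars k p m X Z Q F LX LY RX RY"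
    and v: "v1 \<in> carrier_vec k" "v2 \<in> carrier_vec k" "v3 \<in> carrier_vec k" "v4 \<in> carrier_vec k"
      "v5 \<in> carrier_vec p" "v6 \<in> carrier_vec p"
    and w: "w1 \<in> carrier_vec k" "w2 \<in> carrier_vec k" "w3 \<in> carrier_vec k" "w4 \<in> carrier_vec k"
      "w5 \<in> carrier_vec p" "w6 \<in> carrier_vec p"
  shows "lmi_mat k p e A BM BN C DM DN X Z Q F LX LY RX RY \<in>
           carrier_mat (k + (k + (k + (k + (p + p))))) (k + (k + (k + (k + (p + p)))))" (is ?car)
    and "(v1 @\<^sub>v v2 @\<^sub>v v3 @\<^sub>v v4 @\<^sub>v v5 @\<^sub>v v6) \<bullet>
      (lmi_mat k p e A BM BN C DM DN X Z Q F LX LY RX RY *\<^sub>v (w1 @\<^sub>v w2 @\<^sub>v w3 @\<^sub>v w4 @\<^sub>v w5 @\<^sub>v w6)) =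
      v1 \<bullet> (X *\<^sub>v w1 + Z *\<^sub>v w2) + v2 \<bullet> (Z *\<^sub>v w1 + Z *\<^sub>v w2) +
      v3 \<bullet> (X *\<^sub>v w3 + Z *\<^sub>v w4) + v4 \<bullet> (Z *\<^sub>v w3 + Z *\<^sub>v w4) + v5 \<bullet> w5 + e\<^sup>2 * (v6 \<bullet> w6) +
      v1 \<bullet> (A *\<^sub>v (X *\<^sub>v w3 + Z *\<^sub>v w4) + BM *\<^sub>v (LX *\<^sub>v (w3 + w4) + RX *\<^sub>v w5) - BN *\<^sub>v (LY *\<^sub>v (w3 + w4) + RY *\<^sub>v w5)) +
      w1 \<bullet> (A *\<^sub>v (X *\<^sub>v v3 + Z *\<^sub>v v4) + BM *\<^sub>v (LX *\<^sub>v (v3 + v4) + RX *\<^sub>v v5) - BN *\<^sub>v (LY *\<^sub>v (v3 + v4) + RY *\<^sub>v v5)) +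
      v2 \<bullet> (Q *\<^sub>v (w3 + w4) + F *\<^sub>v w5) + w2 \<bullet> (Q *\<^sub>v (v3 + v4) + F *\<^sub>v v5) +
      v6 \<bullet> (C *\<^sub>v (X *\<^sub>v w3 + Z *\<^sub>v w4) + DM *\<^sub>v (LX *\<^sub>v (w3 + w4) + RX *\<^sub>v w5) - DN *\<^sub>v (LY *\<^sub>v (w3 + w4) + RY *\<^sub>v w5) - w5) +
      w6 \<bullet> (C *\<^sub>v (X *\<^sub>v v3 + Z *\<^sub>v v4) + DM *\<^sub>v (LX *\<^sub>v (v3 + v4) + RX *\<^sub>v v5) - DN *\<^sub>v (LY *\<^sub>v (v3 + v4) + RY *\<^sub>v v5) - v5)"
      (is ?eq)
proof -
  note vars' = lmi_varsD[OF vars]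
  have sym: "X\<^sup>T = X" "Z\<^sup>T = Z" using vars by (auto simp: lmi_vars_def symmetric_mat_def)
  note d = dims[THEN carrier_matD(1)] dims[THEN carrier_matD(2)] vars'[THEN carrier_matD(1)]
    vars'[THEN carrier_matD(2)] v[THEN carrier_vecD] w[THEN carrier_vecD]
  show ?car
    unfolding lmi_mat_def Let_def block_mat_def using d sym by (intro carrier_matI) simp_all
  have tr: "x \<bullet> (P\<^sup>T *\<^sub>v y) = y \<bullet> (P *\<^sub>v x)" if "dim_row P = dim_vec y" "dim_col P = dim_vec x"
    for P :: "real mat" and x y using transpose_scalar_dim[OF that] .
  define g4 where "g4 = C * X + DM * LX - DN * LY"
  define g5 where "g5 = C * Z + DM * LX - DN * LY"
  define g6 where "g6 = DM * RX - DN * RY - 1\<^sub>m p"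
  have g: "X\<^sup>T * C\<^sup>T + LX\<^sup>T * DM\<^sup>T - LY\<^sup>T * DN\<^sup>T = g4\<^sup>T"
      "Z\<^sup>T * C\<^sup>T + LX\<^sup>T * DM\<^sup>T - LY\<^sup>T * DN\<^sup>T = g5\<^sup>T"
      "RX\<^sup>T * DM\<^sup>T - RY\<^sup>T * DN\<^sup>T - 1\<^sub>m p = g6\<^sup>T"
    unfolding g4_def g5_def g6_def using d by (simp_all add: transpose_arith_dim transpose_mult_dim)
  have gd: "dim_row g4 = p" "dim_col g4 = k" "dim_row g5 = p" "dim_col g5 = k" "dim_row g6 = p" "dim_col g6 = p"
    using d by (simp_all add: g4_def g5_def g6_def)
  have one: "1\<^sub>m q *\<^sub>v x = x" if "dim_vec x = q" for x :: "real vec" and q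
    using that by (intro one_mult_mat_vec carrier_vecI)
  show ?eq
    unfolding lmi_mat_def Let_def
    unfolding g
    unfolding block_mat_def sym(2)
    using d gd
    by (simp add: append_rows_mult_vec append_cols_mult_vec scalar_prod_append_dim mat_vec_expand
        scalar_prod_distrib_dim scalar_prod_smult_dim scalar_prod_zero_dim tr one)
      (simp add: g4_def g5_def g6_def mat_vec_expand scalar_prod_distrib_dim one)
qed

lemma append_vec_eq_0_iff:
  fixes v w :: "'a::zero vec"
  assumes "dim_vec v = n" "dim_vec w = m"
  shows "v @\<^sub>v w = 0\<^sub>v (n + m) \<longleftrightarrow> v = 0\<^sub>v n \<and> w = 0\<^sub>v m"
proof -
  have zero: "0\<^sub>v (n + m) = (0\<^sub>v n :: 'a vec) @\<^sub>v 0\<^sub>v m" by (intro eq_vecI) auto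
  show ?thesis unfolding zero
    by (rule append_vec_eq) (use assms in \<open>auto intro: carrier_vecI\<close>)
qed

text \<open>
  The form of \<open>P = [X Z; Z Z]\<close> at \<open>b = (b\<^sub>1, b\<^sub>2)\<close>. It is the value of the form of \<open>P\<^sup>-\<^sup>1\<close> at the
  state \<open>P b\<close>; parametrizing states by \<open>b\<close> dispenses with inverting \<open>P\<close>.
\<close>

definition storage :: "real mat \<Rightarrow> real mat \<Rightarrow> real vec \<Rightarrow> real vec \<Rightarrow> real" where
  "storage X Z b1 b2 = b1 \<bullet> (X *\<^sub>v b1 + Z *\<^sub>v b2) + b2 \<bullet> (Z *\<^sub>v b1 + Z *\<^sub>v b2)"

text \<open>
  The matrix inequality at \<open>(- a\<^sub>1, - a\<^sub>2, b\<^sub>1, b\<^sub>2, w, - z)\<close>. Since \<open>P a\<close> is the successor of the state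
  \<open>P b\<close>, the mixed terms are \<open>-2\<close> times the storage at \<open>a\<close> and \<open>-2 |z|\<^sup>2\<close>, which reverses the signs of
  these two squares.
\<close>

lemma lmi_dissipation:
  fixes a1 a2 b1 b2 w :: "real vec"
  assumes dims: "A \<in> carrier_mat k k" "BM \<in> carrier_mat k p" "BN \<in> carrier_mat k m"
      "C \<in> carrier_mat p k" "DM \<in> carrier_mat p p" "DN \<in> carrier_mat p m"
    and vars: "lmi_vars k p m X Z Q F LX LY RX RY"
    and pd: "pos_def (lmi_mat k p 1 A BM BN C DM DN X Z Q F LX LY RX RY)"
    and car: "a1 \<in> carrier_vec k" "a2 \<in> carrier_vec k" "b1 \<in> carrier_vec k" "b2 \<in> carrier_vec k" "w \<in> carrier_vec p"
    and u: "u = LX *\<^sub>v (b1 + b2) + RX *\<^sub>v w" and y: "y = LY *\<^sub>v (b1 + b2) + RY *\<^sub>v w"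
    and a1: "X *\<^sub>v a1 + Z *\<^sub>v a2 = A *\<^sub>v (X *\<^sub>v b1 + Z *\<^sub>v b2) + BM *\<^sub>v u - BN *\<^sub>v y"
    and a2: "Z *\<^sub>v a1 + Z *\<^sub>v a2 = Q *\<^sub>v (b1 + b2) + F *\<^sub>v w"
    and z: "z = C *\<^sub>v (X *\<^sub>v b1 + Z *\<^sub>v b2) + DM *\<^sub>v u - DN *\<^sub>v y - w"
    and nz: "\<not> (b1 = 0\<^sub>v k \<and> b2 = 0\<^sub>v k \<and> w = 0\<^sub>v p)"
  shows "storage X Z a1 a2 + z \<bullet> z < storage X Z b1 b2 + w \<bullet> w"
proof -
  note vars' = lmi_varsD[OF vars]
  have zc: "z \<in> carrier_vec p" unfolding z using car dims by (intro carrier_vecI) simp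
  let ?v = "(- a1) @\<^sub>v (- a2) @\<^sub>v b1 @\<^sub>v b2 @\<^sub>v w @\<^sub>v (- z)"
  let ?M = "lmi_mat k p 1 A BM BN C DM DN X Z Q F LX LY RX RY"
  have neg: "- a1 \<in> carrier_vec k" "- a2 \<in> carrier_vec k" "- z \<in> carrier_vec p" using car zc by auto
  note bil = lmi_mat_bilinear[OF dims vars neg(1,2) car(3-5) neg(3) neg(1,2) car(3-5) neg(3), of 1]
  have "?v \<noteq> 0\<^sub>v (k + (k + (k + (k + (p + p)))))"
    using nz car zc by (auto simp: append_vec_eq_0_iff)
  moreover have "?v \<in> carrier_vec (k + (k + (k + (k + (p + p)))))"
    using car zc by (intro carrier_vecI) simp
  moreover have "dim_row ?M = k + (k + (k + (k + (p + p))))" using bil(1) by auto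
  ultimately have pos: "0 < ?v \<bullet> (?M *\<^sub>v ?v)" using pd unfolding pos_def_def by auto
  have n1: "X *\<^sub>v (- a1) + Z *\<^sub>v (- a2) = - (X *\<^sub>v a1 + Z *\<^sub>v a2)" "Z *\<^sub>v (- a1) + Z *\<^sub>v (- a2) = - (Z *\<^sub>v a1 + Z *\<^sub>v a2)"
    using vars'(1,2) car by (auto simp: mat_vec_expand intro!: eq_vecI simp del: index_mult_mat_vec)
  have "?v \<bullet> (?M *\<^sub>v ?v) = storage X Z b1 b2 + w \<bullet> w - (storage X Z a1 a2 + z \<bullet> z)"
    unfolding bil(2) u[symmetric] y[symmetric] a1[symmetric] a2[symmetric] z[symmetric] n1 storage_def
    using vars'(1,2) car zc by (simp add: scalar_prod_distrib_dim)
  then show ?thesis using pos by simp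
qed

lemma lmi_storage_pos:
  fixes b1 b2 :: "real vec"
  assumes dims: "A \<in> carrier_mat k k" "BM \<in> carrier_mat k p" "BN \<in> carrier_mat k m"
      "C \<in> carrier_mat p k" "DM \<in> carrier_mat p p" "DN \<in> carrier_mat p m"
    and vars: "lmi_vars k p m X Z Q F LX LY RX RY"
    and pd: "pos_def (lmi_mat k p 1 A BM BN C DM DN X Z Q F LX LY RX RY)"
    and car: "b1 \<in> carrier_vec k" "b2 \<in> carrier_vec k"
    and nz: "\<not> (b1 = 0\<^sub>v k \<and> b2 = 0\<^sub>v k)"
  shows "0 < storage X Z b1 b2"
proof -
  note vars' = lmi_varsD[OF vars]
  let ?v = "b1 @\<^sub>v b2 @\<^sub>v 0\<^sub>v k @\<^sub>v 0\<^sub>v k @\<^sub>v 0\<^sub>v p @\<^sub>v 0\<^sub>v p"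
  let ?M = "lmi_mat k p 1 A BM BN C DM DN X Z Q F LX LY RX RY"
  have z: "0\<^sub>v k \<in> carrier_vec k" "0\<^sub>v p \<in> carrier_vec p" by auto
  note bil = lmi_mat_bilinear[OF dims vars car z(1) z(1) z(2) z(2) car z(1) z(1) z(2) z(2), of 1]
  have "?v \<noteq> 0\<^sub>v (k + (k + (k + (k + (p + p)))))"
    using nz car by (auto simp: append_vec_eq_0_iff)
  moreover have "?v \<in> carrier_vec (k + (k + (k + (k + (p + p)))))"
    using car by (intro carrier_vecI) simp
  moreover have "dim_row ?M = k + (k + (k + (k + (p + p))))" using bil(1) by auto
  ultimately have "0 < ?v \<bullet> (?M *\<^sub>v ?v)" using pd unfolding pos_def_def by auto
  also have "?v \<bullet> (?M *\<^sub>v ?v) = storage X Z b1 b2"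
    unfolding bil(2) storage_def using vars' dims car
    by (simp add: mat_vec_expand scalar_prod_zero_dim scalar_prod_distrib_dim)
  finally show ?thesis .
qed

text \<open>
  Multiplication by \<open>\<mu>\<close> mixes real and imaginary parts, but the sum of their storages is a Hermitian
  form.
\<close>

lemma storage_complex_scale:
  fixes b1 b2 :: "complex vec"
  assumes "X \<in> carrier_mat k k" "Z \<in> carrier_mat k k" "b1 \<in> carrier_vec k" "b2 \<in> carrier_vec k"
  shows "storage X Z (rvec (\<mu> \<cdot>\<^sub>v b1)) (rvec (\<mu> \<cdot>\<^sub>v b2)) + storage X Z (ivec (\<mu> \<cdot>\<^sub>v b1)) (ivec (\<mu> \<cdot>\<^sub>v b2))
    = (cmod \<mu>)\<^sup>2 * (storage X Z (rvec b1) (rvec b2) + storage X Z (ivec b1) (ivec b2))"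
  unfolding storage_def re_im_arith cmod_power2
  using assms
  by (simp add: mat_vec_expand scalar_prod_distrib_dim scalar_prod_smult_dim)
     (simp add: algebra_simps power2_eq_square)

text \<open>
  Along a mode the successor of the state is \<open>\<mu>\<close> times the state, so its storage is multiplied by
  \<open>|\<mu>|\<^sup>2 \<ge> 1\<close>, and \<open>|z| \<ge> |w|\<close> in both cases of \<open>zw\<close>: dissipation fails unless the mode vanishes. The case
  \<open>z = - w\<close> excludes zeros of \<open>M\<^sub>l \<^bold>X - N\<^sub>l \<^bold>Y\<close> outside the open disc, the case \<open>w = 0\<close> excludes unstable
  eigenvalues.
\<close>

lemma lmi_no_unstable_mode:
  fixes b1 b2 w :: "complex vec"
  assumes dims: "A \<in> carrier_mat k k" "BM \<in> carrier_mat k p" "BN \<in> carrier_mat k m"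
      "C \<in> carrier_mat p k" "DM \<in> carrier_mat p p" "DN \<in> carrier_mat p m"
    and vars: "lmi_vars k p m X Z Q F LX LY RX RY"
    and pd: "pos_def (lmi_mat k p 1 A BM BN C DM DN X Z Q F LX LY RX RY)"
    and car: "b1 \<in> carrier_vec k" "b2 \<in> carrier_vec k" "w \<in> carrier_vec p"
    and u: "u = cmat LX *\<^sub>v (b1 + b2) + cmat RX *\<^sub>v w" and y: "y = cmat LY *\<^sub>v (b1 + b2) + cmat RY *\<^sub>v w"
    and mode1: "\<mu> \<cdot>\<^sub>v (cmat X *\<^sub>v b1 + cmat Z *\<^sub>v b2) =
      cmat A *\<^sub>v (cmat X *\<^sub>v b1 + cmat Z *\<^sub>v b2) + cmat BM *\<^sub>v u - cmat BN *\<^sub>v y"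
    and mode2: "\<mu> \<cdot>\<^sub>v (cmat Z *\<^sub>v (b1 + b2)) = cmat Q *\<^sub>v (b1 + b2) + cmat F *\<^sub>v w"
    and z: "z = cmat C *\<^sub>v (cmat X *\<^sub>v b1 + cmat Z *\<^sub>v b2) + cmat DM *\<^sub>v u - cmat DN *\<^sub>v y - w"
    and zw: "z = - w \<or> w = 0\<^sub>v p"
    and \<mu>: "1 \<le> cmod \<mu>"
  shows "b1 = 0\<^sub>v k \<and> b2 = 0\<^sub>v k \<and> w = 0\<^sub>v p"
proof (rule ccontr)
  assume nz: "\<not> ?thesis"
  note vars' = lmi_varsD[OF vars]
  note d = dims[THEN carrier_matD(1)] dims[THEN carrier_matD(2)] vars'[THEN carrier_matD(1)]
    vars'[THEN carrier_matD(2)] car[THEN carrier_vecD]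
  have uy: "dim_vec u = p" "dim_vec y = m" unfolding u y using d by simp_all
  have zd: "dim_vec z = p" unfolding z using d by simp
  have m1: "cmat X *\<^sub>v (\<mu> \<cdot>\<^sub>v b1) + cmat Z *\<^sub>v (\<mu> \<cdot>\<^sub>v b2) =
      cmat A *\<^sub>v (cmat X *\<^sub>v b1 + cmat Z *\<^sub>v b2) + cmat BM *\<^sub>v u - cmat BN *\<^sub>v y"
    unfolding mode1[symmetric] using d
    by (intro eq_vecI) (simp_all add: mat_vec_smult_dim algebra_simps del: index_mult_mat_vec)
  have m2: "cmat Z *\<^sub>v (\<mu> \<cdot>\<^sub>v b1) + cmat Z *\<^sub>v (\<mu> \<cdot>\<^sub>v b2) = cmat Q *\<^sub>v (b1 + b2) + cmat F *\<^sub>v w"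
    unfolding mode2[symmetric] using d
    by (intro eq_vecI) (simp_all add: mat_vec_expand algebra_simps del: index_mult_mat_vec)
  let ?S = "\<lambda>\<phi>. storage X Z (\<phi> b1) (\<phi> b2)"
  \<comment> \<open>dissipation for the real and for the imaginary part; the inequality is strict for a part
    which is not zero, and at least one of them is not\<close>
  have part: "storage X Z (\<phi> (\<mu> \<cdot>\<^sub>v b1)) (\<phi> (\<mu> \<cdot>\<^sub>v b2)) + \<phi> z \<bullet> \<phi> z \<le> ?S \<phi> + \<phi> w \<bullet> \<phi> w"
      "\<not> (\<phi> b1 = 0\<^sub>v k \<and> \<phi> b2 = 0\<^sub>v k \<and> \<phi> w = 0\<^sub>v p) \<Longrightarrow>
       storage X Z (\<phi> (\<mu> \<cdot>\<^sub>v b1)) (\<phi> (\<mu> \<cdot>\<^sub>v b2)) + \<phi> z \<bullet> \<phi> z < ?S \<phi> + \<phi> w \<bullet> \<phi> w"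
      "0 \<le> ?S \<phi>"
    if \<phi>_mult: "\<And>P v. dim_col P = dim_vec v \<Longrightarrow> \<phi> (cmat P *\<^sub>v v) = P *\<^sub>v \<phi> v"
      and \<phi>_add: "\<And>v v'. dim_vec v = dim_vec v' \<Longrightarrow> \<phi> (v + v') = \<phi> v + \<phi> v'"
      and \<phi>_minus: "\<And>v v'. dim_vec v = dim_vec v' \<Longrightarrow> \<phi> (v - v') = \<phi> v - \<phi> v'"
      and \<phi>_dim: "\<And>v. dim_vec (\<phi> v) = dim_vec v" for \<phi> :: "complex vec \<Rightarrow> real vec"
  proof -
    have pc: "\<phi> (\<mu> \<cdot>\<^sub>v b1) \<in> carrier_vec k" "\<phi> (\<mu> \<cdot>\<^sub>v b2) \<in> carrier_vec k" "\<phi> b1 \<in> carrier_vec k" "\<phi> b2 \<in> carrier_vec k"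
      "\<phi> w \<in> carrier_vec p" using \<phi>_dim car by (auto intro!: carrier_vecI)
    have pu: "\<phi> u = LX *\<^sub>v (\<phi> b1 + \<phi> b2) + RX *\<^sub>v \<phi> w" and py: "\<phi> y = LY *\<^sub>v (\<phi> b1 + \<phi> b2) + RY *\<^sub>v \<phi> w"
      unfolding u y using d by (simp_all add: \<phi>_mult \<phi>_add)
    have p1: "X *\<^sub>v \<phi> (\<mu> \<cdot>\<^sub>v b1) + Z *\<^sub>v \<phi> (\<mu> \<cdot>\<^sub>v b2) = A *\<^sub>v (X *\<^sub>v \<phi> b1 + Z *\<^sub>v \<phi> b2) + BM *\<^sub>v \<phi> u - BN *\<^sub>v \<phi> y"
      using arg_cong[OF m1, of \<phi>] d uy by (simp add: \<phi>_mult \<phi>_add \<phi>_minus)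
    have p2: "Z *\<^sub>v \<phi> (\<mu> \<cdot>\<^sub>v b1) + Z *\<^sub>v \<phi> (\<mu> \<cdot>\<^sub>v b2) = Q *\<^sub>v (\<phi> b1 + \<phi> b2) + F *\<^sub>v \<phi> w"
      using arg_cong[OF m2, of \<phi>] d by (simp add: \<phi>_mult \<phi>_add)
    have pz: "\<phi> z = C *\<^sub>v (X *\<^sub>v \<phi> b1 + Z *\<^sub>v \<phi> b2) + DM *\<^sub>v \<phi> u - DN *\<^sub>v \<phi> y - \<phi> w"
      unfolding z using d uy by (simp add: \<phi>_mult \<phi>_add \<phi>_minus)
    show strict: "storage X Z (\<phi> (\<mu> \<cdot>\<^sub>v b1)) (\<phi> (\<mu> \<cdot>\<^sub>v b2)) + \<phi> z \<bullet> \<phi> z < ?S \<phi> + \<phi> w \<bullet> \<phi> w"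
      if "\<not> (\<phi> b1 = 0\<^sub>v k \<and> \<phi> b2 = 0\<^sub>v k \<and> \<phi> w = 0\<^sub>v p)"
      by (rule lmi_dissipation[OF dims vars pd pc pu py p1 p2 pz that])
    have zero: "storage X Z (\<phi> (\<mu> \<cdot>\<^sub>v b1)) (\<phi> (\<mu> \<cdot>\<^sub>v b2)) + \<phi> z \<bullet> \<phi> z = 0"
      if b0: "\<phi> b1 = 0\<^sub>v k" "\<phi> b2 = 0\<^sub>v k" "\<phi> w = 0\<^sub>v p"
    proof -
      have "\<phi> u = 0\<^sub>v p" "\<phi> y = 0\<^sub>v m" unfolding pu py b0 using d by (simp_all add: mat_vec_zero_dim)
      then have "X *\<^sub>v \<phi> (\<mu> \<cdot>\<^sub>v b1) + Z *\<^sub>v \<phi> (\<mu> \<cdot>\<^sub>v b2) = 0\<^sub>v k"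
         "Z *\<^sub>v \<phi> (\<mu> \<cdot>\<^sub>v b1) + Z *\<^sub>v \<phi> (\<mu> \<cdot>\<^sub>v b2) = 0\<^sub>v k" "\<phi> z = 0\<^sub>v p"
        unfolding p1 p2 pz b0 using d by (simp_all add: mat_vec_zero_dim)
      then show ?thesis unfolding storage_def using pc by (simp add: scalar_prod_zero_dim)
    qed
    show S0: "0 \<le> ?S \<phi>"
    proof (cases "\<phi> b1 = 0\<^sub>v k \<and> \<phi> b2 = 0\<^sub>v k")
      case True
      then show ?thesis using d by (simp add: storage_def mat_vec_zero_dim scalar_prod_zero_dim)
    next
      case False
      then show ?thesis using lmi_storage_pos[OF dims vars pd pc(3,4)] by simp
    qed
    show "storage X Z (\<phi> (\<mu> \<cdot>\<^sub>v b1)) (\<phi> (\<mu> \<cdot>\<^sub>v b2)) + \<phi> z \<bullet> \<phi> z \<le> ?S \<phi> + \<phi> w \<bullet> \<phi> w"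
      using strict zero S0 real_scalar_prod_self(1)[of "\<phi> w"]
      by (cases "\<phi> b1 = 0\<^sub>v k \<and> \<phi> b2 = 0\<^sub>v k \<and> \<phi> w = 0\<^sub>v p") auto
  qed
  have re: "storage X Z (rvec (\<mu> \<cdot>\<^sub>v b1)) (rvec (\<mu> \<cdot>\<^sub>v b2)) + rvec z \<bullet> rvec z \<le> ?S rvec + rvec w \<bullet> rvec w"
      "\<not> (rvec b1 = 0\<^sub>v k \<and> rvec b2 = 0\<^sub>v k \<and> rvec w = 0\<^sub>v p) \<Longrightarrow>
       storage X Z (rvec (\<mu> \<cdot>\<^sub>v b1)) (rvec (\<mu> \<cdot>\<^sub>v b2)) + rvec z \<bullet> rvec z < ?S rvec + rvec w \<bullet> rvec w"
      "0 \<le> ?S rvec"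
    by (rule part; simp add: re_im_mat_vec re_im_arith)+
  have im: "storage X Z (ivec (\<mu> \<cdot>\<^sub>v b1)) (ivec (\<mu> \<cdot>\<^sub>v b2)) + ivec z \<bullet> ivec z \<le> ?S ivec + ivec w \<bullet> ivec w"
      "\<not> (ivec b1 = 0\<^sub>v k \<and> ivec b2 = 0\<^sub>v k \<and> ivec w = 0\<^sub>v p) \<Longrightarrow>
       storage X Z (ivec (\<mu> \<cdot>\<^sub>v b1)) (ivec (\<mu> \<cdot>\<^sub>v b2)) + ivec z \<bullet> ivec z < ?S ivec + ivec w \<bullet> ivec w"
      "0 \<le> ?S ivec"
    by (rule part; simp add: re_im_mat_vec re_im_arith)+
  have zw': "rvec w \<bullet> rvec w + ivec w \<bullet> ivec w \<le> rvec z \<bullet> rvec z + ivec z \<bullet> ivec z"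
    using zw
  proof
    assume "z = - w"
    then show ?thesis by (simp add: re_im_arith scalar_prod_distrib_dim)
  next
    assume "w = 0\<^sub>v p"
    then have "rvec w = 0\<^sub>v p" "ivec w = 0\<^sub>v p" by auto
    then show ?thesis using real_scalar_prod_self(1)[of "rvec z"] real_scalar_prod_self(1)[of "ivec z"]
      by (simp add: scalar_prod_zero_dim)
  qed
  have "\<not> (rvec b1 = 0\<^sub>v k \<and> rvec b2 = 0\<^sub>v k \<and> rvec w = 0\<^sub>v p) \<or> \<not> (ivec b1 = 0\<^sub>v k \<and> ivec b2 = 0\<^sub>v k \<and> ivec w = 0\<^sub>v p)"
    using nz re_im_zero[of b1 k] re_im_zero[of b2 k] re_im_zero[of w p] by blast
  then have "(cmod \<mu>)\<^sup>2 * (?S rvec + ?S ivec) < ?S rvec + ?S ivec"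
    using re im zw' unfolding storage_complex_scale[OF vars'(1,2) car(1,2), symmetric] by argo
  moreover have "1 * (?S rvec + ?S ivec) \<le> (cmod \<mu>)\<^sup>2 * (?S rvec + ?S ivec)"
    using re(3) im(3) \<mu> by (intro mult_right_mono) (auto simp: one_le_power)
  ultimately show False by simp
qed

section \<open>Values of rational matrices at points of the plane and at infinity\<close>

abbreviation poly_frac :: "real poly \<Rightarrow> real poly \<Rightarrow> real poly fract" where "poly_frac \<equiv> Fraction_Field.Fract"
abbreviation cpoly :: "real poly \<Rightarrow> complex poly" where "cpoly \<equiv> map_poly complex_of_real"

text \<open>
  Rational functions are evaluated by limits along a filter, \<open>at \<mu>\<close> for a finite point and
  \<open>at_infinity\<close>; finite and infinite points are then treated alike. All that is required of the
  filter is that it is proper and eventually avoids the zeros of each nonzero polynomial.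
\<close>

definition generic_filter :: "complex filter \<Rightarrow> bool" where
  "generic_filter F \<longleftrightarrow> F \<noteq> bot \<and> (\<forall>q. q \<noteq> 0 \<longrightarrow> (\<forall>\<^sub>F z in F. poly (cpoly q) z \<noteq> 0))"

text \<open>
  Some representation as a fraction has the limit; for a generic filter all of them do, which makes
  the value unique and compatible with the field operations.
\<close>

definition has_value :: "complex filter \<Rightarrow> real poly fract \<Rightarrow> complex \<Rightarrow> bool" where
  "has_value F r v \<longleftrightarrow> (\<exists>a b. b \<noteq> 0 \<and> r = poly_frac a b \<and>
     ((\<lambda>z. poly (cpoly a) z / poly (cpoly b) z) \<longlongrightarrow> v) F)"

lemma cpoly_arith:
  "poly (cpoly (a + b)) z = poly (cpoly a) z + poly (cpoly b) z"
  "poly (cpoly (a * b)) z = poly (cpoly a) z * poly (cpoly b) z"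
  "poly (cpoly (- a)) z = - poly (cpoly a) z"
  "poly (cpoly (pCons c a)) z = of_real c + z * poly (cpoly a) z"
  "poly (cpoly 0) z = 0" "poly (cpoly 1) z = 1"
proof -
  show add: "poly (cpoly (a + b)) z = poly (cpoly a) z + poly (cpoly b) z" for a b
    by (simp add: of_real_hom.map_poly_hom_add)
  show pC: "poly (cpoly (pCons c a)) z = of_real c + z * poly (cpoly a) z" for c a
    by (simp add: of_real_hom.map_poly_pCons_hom)
  show "poly (cpoly 0) z = 0" "poly (cpoly 1) z = 1" by simp_all
  have "cpoly (- a) = - cpoly a" by (intro poly_eqI) (simp add: coeff_map_poly)
  then show "poly (cpoly (- a)) z = - poly (cpoly a) z" by simp
  show "poly (cpoly (a * b)) z = poly (cpoly a) z * poly (cpoly b) z"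
  proof (induction a)
    case (pCons c a)
    have "poly (cpoly (Polynomial.smult c b)) z = of_real c * poly (cpoly b) z"
      by (simp add: map_poly_smult[of complex_of_real c b])
    then show ?case using pCons by (simp add: add pC algebra_simps)
  qed simp
qed

lemma cpoly_eq_0_iff: "cpoly q = 0 \<longleftrightarrow> q = 0"
  by (simp add: map_poly_eq_0_iff)

lemma generic_filter_avoid:
  assumes "F \<noteq> bot" "\<And>s. \<forall>\<^sub>F z in F. z \<noteq> s"
  shows "generic_filter F"
  unfolding generic_filter_def
proof (intro conjI allI impI assms(1))
  fix q :: "real poly" assume "q \<noteq> 0"
  then have "finite {z. poly (cpoly q) z = 0}" by (intro poly_roots_finite) (simp add: cpoly_eq_0_iff)
  then have "\<forall>\<^sub>F z in F. \<forall>s\<in>{z. poly (cpoly q) z = 0}. z \<noteq> s"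
    using assms(2) by (intro eventually_ball_finite) auto
  then show "\<forall>\<^sub>F z in F. poly (cpoly q) z \<noteq> 0" by eventually_elim auto
qed

lemma generic_filter_at: "generic_filter (at (\<mu> :: complex))"
  by (rule generic_filter_avoid) (simp_all add: eventually_neq_at_within)

lemma generic_filter_at_infinity: "generic_filter (at_infinity :: complex filter)"
proof (rule generic_filter_avoid)
  show "\<forall>\<^sub>F z in at_infinity. z \<noteq> s" for s :: complex
    unfolding eventually_at_infinity by (rule exI[of _ "norm s + 1"]) auto
  show "(at_infinity :: complex filter) \<noteq> bot"
  proof
    assume "(at_infinity :: complex filter) = bot"
    then have "\<forall>\<^sub>F z :: complex in at_infinity. False" by simp
    then obtain b where "\<And>z :: complex. b \<le> norm z \<Longrightarrow> False" unfolding eventually_at_infinity by blast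
    from this[of "complex_of_real \<bar>b\<bar>"] show False using abs_ge_self[of b] by simp
  qed
qed

lemma has_valueI:
  assumes "b \<noteq> 0" "r = poly_frac a b" "((\<lambda>z. poly (cpoly a) z / poly (cpoly b) z) \<longlongrightarrow> v) F"
  shows "has_value F r v"
  using assms unfolding has_value_def by blast

lemma has_value_const: "has_value F (poly_frac [:c:] 1) (of_real c)"
  by (rule has_valueI[of 1 _ "[:c:]"]) (simp_all add: cpoly_arith)

lemma has_value_0: "has_value F 0 0" and has_value_1: "has_value F 1 1"
  using has_value_const[of F 0] has_value_const[of F 1]
  by (simp_all add: Zero_fract_def One_fract_def pCons_one)

lemma has_value_unique:
  assumes F: "generic_filter F" and v: "has_value F r v" and w: "has_value F r w"
  shows "v = w"
proof -
  obtain a b where ab: "b \<noteq> 0" "r = poly_frac a b"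
    "((\<lambda>z. poly (cpoly a) z / poly (cpoly b) z) \<longlongrightarrow> v) F" using v unfolding has_value_def by auto
  obtain c d where cd: "d \<noteq> 0" "r = poly_frac c d"
    "((\<lambda>z. poly (cpoly c) z / poly (cpoly d) z) \<longlongrightarrow> w) F" using w unfolding has_value_def by auto
  have eq: "a * d = c * b" using ab cd eq_fract(1)[of b d a c] by simp
  have "\<forall>\<^sub>F z in F. poly (cpoly b) z \<noteq> 0" "\<forall>\<^sub>F z in F. poly (cpoly d) z \<noteq> 0"
    using F ab cd unfolding generic_filter_def by auto
  then have "\<forall>\<^sub>F z in F. poly (cpoly a) z / poly (cpoly b) z = poly (cpoly c) z / poly (cpoly d) z"
  proof eventually_elim
    case (elim z)
    then show ?case using arg_cong[OF eq, of "\<lambda>q. poly (cpoly q) z"] by (simp add: cpoly_arith frac_eq_eq)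
  qed
  then have "((\<lambda>z. poly (cpoly c) z / poly (cpoly d) z) \<longlongrightarrow> v) F"
    using ab(3) by (simp add: tendsto_cong)
  then show ?thesis using cd(3) F tendsto_unique unfolding generic_filter_def by blast
qed

lemma has_value_add:
  assumes F: "generic_filter F" and v: "has_value F r v" and w: "has_value F s w"
  shows "has_value F (r + s) (v + w)"
proof -
  obtain a b where ab: "b \<noteq> 0" "r = poly_frac a b"
    "((\<lambda>z. poly (cpoly a) z / poly (cpoly b) z) \<longlongrightarrow> v) F" using v unfolding has_value_def by auto
  obtain c d where cd: "d \<noteq> 0" "s = poly_frac c d"
    "((\<lambda>z. poly (cpoly c) z / poly (cpoly d) z) \<longlongrightarrow> w) F" using w unfolding has_value_def by auto
  have "\<forall>\<^sub>F z in F. poly (cpoly b) z \<noteq> 0" "\<forall>\<^sub>F z in F. poly (cpoly d) z \<noteq> 0"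
    using F ab cd unfolding generic_filter_def by auto
  then have "\<forall>\<^sub>F z in F. poly (cpoly a) z / poly (cpoly b) z + poly (cpoly c) z / poly (cpoly d) z =
      poly (cpoly (a * d + c * b)) z / poly (cpoly (b * d)) z"
    by eventually_elim (simp add: cpoly_arith add_frac_eq)
  then have "((\<lambda>z. poly (cpoly (a * d + c * b)) z / poly (cpoly (b * d)) z) \<longlongrightarrow> v + w) F"
    using tendsto_add[OF ab(3) cd(3)] by (simp add: tendsto_cong)
  then show ?thesis using ab cd by (intro has_valueI[of "b * d" _ "a * d + c * b"]) simp_all
qed

lemma has_value_mult:
  assumes v: "has_value F r v" and w: "has_value F s w"
  shows "has_value F (r * s) (v * w)"
proof -
  obtain a b where ab: "b \<noteq> 0" "r = poly_frac a b"
    "((\<lambda>z. poly (cpoly a) z / poly (cpoly b) z) \<longlongrightarrow> v) F" using v unfolding has_value_def by auto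
  obtain c d where cd: "d \<noteq> 0" "s = poly_frac c d"
    "((\<lambda>z. poly (cpoly c) z / poly (cpoly d) z) \<longlongrightarrow> w) F" using w unfolding has_value_def by auto
  have "((\<lambda>z. poly (cpoly (a * c)) z / poly (cpoly (b * d)) z) \<longlongrightarrow> v * w) F"
    using tendsto_mult[OF ab(3) cd(3)] by (simp add: cpoly_arith)
  then show ?thesis using ab cd by (intro has_valueI[of "b * d" _ "a * c"]) simp_all
qed

lemma has_value_uminus: "has_value F r v \<Longrightarrow> has_value F (- r) (- v)"
proof -
  assume r: "has_value F r v"
  have "poly_frac [:- 1 :: real:] 1 = - 1"
    by (simp add: One_fract_def one_pCons)
  then show ?thesis using has_value_mult[OF has_value_const[of F "-1"] r] by simp
qed

lemma has_value_diff:
  "generic_filter F \<Longrightarrow> has_value F r v \<Longrightarrow> has_value F s w \<Longrightarrow> has_value F (r - s) (v - w)"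
  using has_value_add[of F r v "- s" "- w"] has_value_uminus[of F s w] by simp

lemma has_value_inverse:
  assumes F: "generic_filter F" and v: "has_value F r v" and v0: "v \<noteq> 0"
  shows "has_value F (inverse r) (inverse v)"
proof -
  obtain a b where ab: "b \<noteq> 0" "r = poly_frac a b"
    "((\<lambda>z. poly (cpoly a) z / poly (cpoly b) z) \<longlongrightarrow> v) F" using v unfolding has_value_def by auto
  have "a \<noteq> 0"
  proof
    assume "a = 0"
    then have "((\<lambda>z. 0) \<longlongrightarrow> v) F" using ab(3) by simp
    then show False using v0 F tendsto_unique[of F _ v 0] tendsto_const unfolding generic_filter_def by blast
  qed
  then show ?thesis using ab tendsto_inverse[OF ab(3) v0] by (intro has_valueI[of a _ b]) simp_all
qed

lemma has_value_sum:
  assumes "generic_filter F" "\<And>i. i \<in> I \<Longrightarrow> has_value F (f i) (g i)"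
  shows "has_value F (sum f I) (sum g I)"
  using assms(2) by (induction I rule: infinite_finite_induct)
    (auto simp: has_value_0 intro: has_value_add[OF assms(1)])

lemma has_value_prod:
  assumes "\<And>i. i \<in> I \<Longrightarrow> has_value F (f i) (g i)"
  shows "has_value F (prod f I) (prod g I)"
  using assms by (induction I rule: infinite_finite_induct)
    (auto simp: has_value_1 intro: has_value_mult)

definition mat_has_value :: "complex filter \<Rightarrow> tf_mat \<Rightarrow> complex mat \<Rightarrow> bool" where
  "mat_has_value F R V \<longleftrightarrow> dim_row R = dim_row V \<and> dim_col R = dim_col V \<and>
     (\<forall>i < dim_row V. \<forall>j < dim_col V. has_value F (R $$ (i, j)) (V $$ (i, j)))"

lemma mat_has_value_unique:
  assumes "generic_filter F" "mat_has_value F R V" "mat_has_value F R W"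
  shows "V = W"
proof (rule eq_matI)
  fix i j assume "i < dim_row W" "j < dim_col W"
  then have "has_value F (R $$ (i, j)) (V $$ (i, j))" "has_value F (R $$ (i, j)) (W $$ (i, j))"
    using assms(2,3) unfolding mat_has_value_def by auto
  then show "V $$ (i, j) = W $$ (i, j)" by (rule has_value_unique[OF assms(1)])
qed (use assms(2,3) in \<open>auto simp: mat_has_value_def\<close>)

lemma mat_has_value_const: "mat_has_value F (const_tf A) (cmat A)"
  unfolding mat_has_value_def using has_value_const by auto

lemma mat_has_value_one: "mat_has_value F (1\<^sub>m n) (1\<^sub>m n)"
  unfolding mat_has_value_def using has_value_1 has_value_0 by auto

lemma mat_has_value_add:
  assumes "generic_filter F" "mat_has_value F R V" "mat_has_value F S W"
    "dim_row V = dim_row W" "dim_col V = dim_col W"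
  shows "mat_has_value F (R + S) (V + W)" "mat_has_value F (R - S) (V - W)"
  using assms has_value_add[OF assms(1)] has_value_diff[OF assms(1)] unfolding mat_has_value_def by auto

lemma mat_has_value_smult:
  assumes "has_value F r v" "mat_has_value F R V"
  shows "mat_has_value F (r \<cdot>\<^sub>m R) (v \<cdot>\<^sub>m V)"
  using assms has_value_mult[OF assms(1)] unfolding mat_has_value_def by auto

lemma mat_has_value_mult:
  assumes F: "generic_filter F" and "mat_has_value F R V" "mat_has_value F S W" "dim_col V = dim_row W"
  shows "mat_has_value F (R * S) (V * W)"
  using assms(2-4) unfolding mat_has_value_def
  by (auto simp: scalar_prod_def intro!: has_value_sum[OF F] has_value_mult)

lemma has_value_det:
  assumes F: "generic_filter F" and R: "mat_has_value F R V"
  shows "has_value F (det R) (det V)"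
proof (cases "dim_row V = dim_col V")
  case True
  have sg: "has_value F (signof \<pi>) (signof \<pi>)" for \<pi> :: "nat \<Rightarrow> nat"
    using has_value_1 has_value_uminus[OF has_value_1] by (simp add: sign_def)
  show ?thesis unfolding Determinant.det_def using R True unfolding mat_has_value_def
    by (auto intro!: has_value_sum[OF F] has_value_mult has_value_prod sg dest: permutes_in_image)
next
  case False
  then show ?thesis using R has_value_0 unfolding Determinant.det_def mat_has_value_def by auto
qed

text \<open>
  A nonzero determinant at one point forces a nonzero determinant over the field of fractions, and
  the inverse is the adjugate over the determinant.
\<close>

lemma mat_has_value_minv:
  assumes F: "generic_filter F" and R: "mat_has_value F R V"
    and V: "V \<in> carrier_mat n n" and d: "det V \<noteq> 0"
  shows "invertible_mat R" "mat_has_value F (minv R) (minv V)"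
proof -
  have Rc: "R \<in> carrier_mat n n" using R V unfolding mat_has_value_def by auto
  note dv = has_value_det[OF F R]
  have d': "det R \<noteq> 0" using has_value_unique[OF F dv] has_value_0 d by metis
  then show inv: "invertible_mat R" using Rc by (intro invertible_mat_det)
  have minv_adj: "minv M = inverse (det M) \<cdot>\<^sub>m adj_mat M" if M: "M \<in> carrier_mat n n" "det M \<noteq> 0"
    for M :: "'b::field mat"
  proof (rule minv_eqI[OF M(1)])
    show "inverse (det M) \<cdot>\<^sub>m adj_mat M \<in> carrier_mat n n" using adj_mat(1)[OF M(1)] by simp
    have "M * (inverse (det M) \<cdot>\<^sub>m adj_mat M) = inverse (det M) \<cdot>\<^sub>m (det M \<cdot>\<^sub>m 1\<^sub>m n)"
      using mult_smult_distrib[OF M(1) adj_mat(1)[OF M(1)]] adj_mat(2)[OF M(1)] by simp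
    also have "\<dots> = 1\<^sub>m n" using M(2) by (intro eq_matI) auto
    finally show "M * (inverse (det M) \<cdot>\<^sub>m adj_mat M) = 1\<^sub>m n" .
  qed
  have "mat_has_value F (adj_mat R) (adj_mat V)"
  proof -
    have "has_value F (cofactor R j i) (cofactor V j i)" if "i < n" "j < n" for i j
    proof -
      have "mat_has_value F (mat_delete R j i) (mat_delete V j i)"
        using R V that unfolding mat_has_value_def mat_delete_def by auto
      then have "has_value F (det (mat_delete R j i)) (det (mat_delete V j i))" by (rule has_value_det[OF F])
      moreover have "has_value F ((- 1) ^ (j + i)) ((- 1) ^ (j + i))"
        using has_value_1 has_value_uminus[OF has_value_1] by (cases "even (j + i)") auto
      ultimately show ?thesis unfolding cofactor_def by (intro has_value_mult)
    qed
    then show ?thesis using R V unfolding mat_has_value_def adj_mat_def by auto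
  qed
  then show "mat_has_value F (minv R) (minv V)"
    unfolding minv_adj[OF Rc d'] minv_adj[OF V d]
    by (intro mat_has_value_smult has_value_inverse F dv d)
qed

abbreviation tf_z :: "real poly fract" where "tf_z \<equiv> poly_frac [:0, 1:] 1"

abbreviation resolvent :: "real mat \<Rightarrow> tf_mat" where
  "resolvent A \<equiv> tf_z \<cdot>\<^sub>m 1\<^sub>m (dim_row A) - const_tf A"

lemma has_value_tf_z: "has_value (at \<mu>) tf_z \<mu>"
  by (rule has_valueI[of 1 _ "[:0, 1:]"]) (simp_all add: cpoly_arith)

lemma has_value_tf_z_infinity: "has_value at_infinity (inverse tf_z) 0"
  by (rule has_valueI[of "[:0, 1:]" _ 1]) (simp_all add: cpoly_arith tendsto_inverse_0 flip: inverse_eq_divide)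

lemma mat_has_value_resolvent:
  assumes A: "A \<in> carrier_mat n n"
  shows "mat_has_value (at \<mu>) (resolvent A) (\<mu> \<cdot>\<^sub>m 1\<^sub>m n - cmat A)"
  using A by (intro mat_has_value_add mat_has_value_smult mat_has_value_const has_value_tf_z generic_filter_at)
    (auto intro: mat_has_value_one)

lemma resolvent_value:
  assumes A: "A \<in> carrier_mat n n" and \<mu>: "\<not> eigenvalue (cmat A) \<mu>"
  shows "invertible_mat (\<mu> \<cdot>\<^sub>m 1\<^sub>m n - cmat A)" "invertible_mat (resolvent A)"
    "mat_has_value (at \<mu>) (minv (resolvent A)) (minv (\<mu> \<cdot>\<^sub>m 1\<^sub>m n - cmat A))"
proof -
  let ?V = "\<mu> \<cdot>\<^sub>m 1\<^sub>m n - cmat A"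
  have V: "?V \<in> carrier_mat n n" using A by auto
  note val = mat_has_value_resolvent[OF A, of \<mu>]
  have det: "det ?V \<noteq> 0"
  proof
    assume "det ?V = 0"
    then obtain v where v: "v \<in> carrier_vec n" "v \<noteq> 0\<^sub>v n" "?V *\<^sub>v v = 0\<^sub>v n"
      unfolding det_0_iff_vec_prod_zero_field[OF V] by blast
    have "?V *\<^sub>v v = \<mu> \<cdot>\<^sub>v v - cmat A *\<^sub>v v" using A v(1) by (simp add: mat_vec_expand)
    then have *: "\<mu> \<cdot>\<^sub>v v - cmat A *\<^sub>v v = 0\<^sub>v n" using v(3) by simp
    have "cmat A *\<^sub>v v = \<mu> \<cdot>\<^sub>v v"
    proof (rule eq_vecI)
      fix i assume "i < dim_vec (\<mu> \<cdot>\<^sub>v v)"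
      then show "(cmat A *\<^sub>v v) $ i = (\<mu> \<cdot>\<^sub>v v) $ i"
        using arg_cong[OF *, of "\<lambda>x. x $ i"] A v(1) by (simp del: index_mult_mat_vec)
    qed (use A v(1) in auto)
    then have "eigenvalue (cmat A) \<mu>"
      unfolding eigenvalue_def eigenvector_def using A v by (intro exI[of _ v]) auto
    then show False using \<mu> by simp
  qed
  show "invertible_mat ?V" using invertible_mat_det[OF V det] .
  show "invertible_mat (resolvent A)" "mat_has_value (at \<mu>) (minv (resolvent A)) (minv ?V)"
    using mat_has_value_minv[OF generic_filter_at val V det] by auto
qed

text \<open>
  The matrix \<open>z I - A\<close> has no value at infinity. Split off the factor \<open>z\<close>: the value of
  \<open>I - A / z\<close> is \<open>I\<close>, and that of \<open>1 / z\<close> is \<open>0\<close>.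
\<close>

lemma resolvent_value_infinity:
  assumes A: "A \<in> carrier_mat n n"
  shows "invertible_mat (resolvent A)" "mat_has_value at_infinity (minv (resolvent A)) (0\<^sub>m n n)"
proof -
  note gen = generic_filter_at_infinity
  define E where "E = 1\<^sub>m n - inverse tf_z \<cdot>\<^sub>m const_tf A"
  have E: "E \<in> carrier_mat n n" using A by (auto simp: E_def)
  have "mat_has_value at_infinity E (1\<^sub>m n - 0 \<cdot>\<^sub>m cmat A)"
    unfolding E_def using A by (intro mat_has_value_add mat_has_value_smult mat_has_value_const
        mat_has_value_one has_value_tf_z_infinity gen) auto
  moreover have "1\<^sub>m n - 0 \<cdot>\<^sub>m cmat A = 1\<^sub>m n" using A by (intro eq_matI) auto
  ultimately have val: "mat_has_value at_infinity E (1\<^sub>m n)" by simp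
  have one: "minv (1\<^sub>m n) = (1\<^sub>m n :: complex mat)" by (rule minv_eqI[of _ n]) auto
  note inv = mat_has_value_minv[OF gen val one_carrier_mat, unfolded one det_one, OF one_neq_zero]
  have z0: "tf_z \<noteq> 0" by (simp add: Zero_fract_def eq_fract)
  have RE: "resolvent A = tf_z \<cdot>\<^sub>m E"
  proof -
    have "t \<cdot>\<^sub>m 1\<^sub>m n - const_tf A = t \<cdot>\<^sub>m (1\<^sub>m n - inverse t \<cdot>\<^sub>m const_tf A)" if "t \<noteq> 0" for t
      using A that by (intro eq_matI) (auto simp: algebra_simps)
    from this[OF z0] show ?thesis using A unfolding E_def by simp
  qed
  note i = minv_left_right[OF inv(1) E]
  have R: "resolvent A \<in> carrier_mat n n" using A by auto
  have prod: "resolvent A * (inverse tf_z \<cdot>\<^sub>m minv E) = 1\<^sub>m n"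
  proof -
    have "resolvent A * (inverse tf_z \<cdot>\<^sub>m minv E) = tf_z \<cdot>\<^sub>m (inverse tf_z \<cdot>\<^sub>m (E * minv E))"
      unfolding RE mult_smult_assoc_mat[OF E smult_carrier_mat[OF i(1)]] mult_smult_distrib[OF E i(1)] ..
    also have "\<dots> = 1\<^sub>m n"
    proof -
      have "t \<cdot>\<^sub>m (inverse t \<cdot>\<^sub>m 1\<^sub>m n) = 1\<^sub>m n" if "t \<noteq> 0" for t :: "real poly fract"
        using that by (intro eq_matI) auto
      from this[OF z0] show ?thesis unfolding i(2) .
    qed
    finally show ?thesis .
  qed
  show "invertible_mat (resolvent A)"
    by (rule invertible_matI[OF R _ disjI1[OF prod]]) (use i in auto)
  have "minv (resolvent A) = inverse tf_z \<cdot>\<^sub>m minv E"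
    by (rule minv_eqI[OF R _ prod]) (use i in auto)
  moreover have "mat_has_value at_infinity (inverse tf_z \<cdot>\<^sub>m minv E) (0 \<cdot>\<^sub>m 1\<^sub>m n)"
    by (intro mat_has_value_smult has_value_tf_z_infinity inv(2))
  moreover have "0 \<cdot>\<^sub>m 1\<^sub>m n = (0\<^sub>m n n :: complex mat)" by (intro eq_matI) auto
  ultimately show "mat_has_value at_infinity (minv (resolvent A)) (0\<^sub>m n n)" by simp
qed

lemma transfer_mat_carrier:
  assumes "A \<in> carrier_mat n n" "B \<in> carrier_mat n m" "C \<in> carrier_mat p n" "D \<in> carrier_mat p m"
  shows "transfer_mat A B C D \<in> carrier_mat p m"
  using assms unfolding transfer_mat_def by auto

lemma transfer_mat_value:
  assumes car: "A \<in> carrier_mat n n" "B \<in> carrier_mat n m" "C \<in> carrier_mat p n" "D \<in> carrier_mat p m"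
    and \<mu>: "\<not> eigenvalue (cmat A) \<mu>"
  shows "mat_has_value (at \<mu>) (transfer_mat A B C D)
     (cmat C * minv (\<mu> \<cdot>\<^sub>m 1\<^sub>m n - cmat A) * cmat B + cmat D)"
proof -
  have V: "minv (\<mu> \<cdot>\<^sub>m 1\<^sub>m n - cmat A) \<in> carrier_mat n n"
    using car(1) by (intro minv_left_right(1)[OF resolvent_value(1)[OF car(1) \<mu>]]) auto
  show ?thesis unfolding transfer_mat_def using V car
    by (intro mat_has_value_add mat_has_value_mult mat_has_value_const generic_filter_at resolvent_value(3)[OF car(1) \<mu>]) auto
qed

lemma transfer_mat_value_infinity:
  assumes car: "A \<in> carrier_mat n n" "B \<in> carrier_mat n m" "C \<in> carrier_mat p n" "D \<in> carrier_mat p m"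
  shows "mat_has_value at_infinity (transfer_mat A B C D) (cmat D)"
proof -
  have "mat_has_value at_infinity (transfer_mat A B C D) (cmat C * 0\<^sub>m n n * cmat B + cmat D)"
    unfolding transfer_mat_def using car
    by (intro mat_has_value_add mat_has_value_mult mat_has_value_const generic_filter_at_infinity
        resolvent_value_infinity(2)[OF car(1)]) auto
  moreover have "cmat C * 0\<^sub>m n n * cmat B + cmat D = cmat D" using car by simp
  ultimately show ?thesis by simp
qed

lemma proper_stable_value:
  assumes r: "proper_stable r" and \<mu>: "1 \<le> cmod \<mu>"
  shows "\<exists>v. has_value (at \<mu>) r v"
proof -
  obtain a b where ab: "b \<noteq> 0" "r = poly_frac a b" and
    st: "\<And>z. poly (cpoly b) z = 0 \<Longrightarrow> cmod z < 1" using r unfolding proper_stable_def by auto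
  have "poly (cpoly b) \<mu> \<noteq> 0" using st \<mu> by fastforce
  then have "((\<lambda>z. poly (cpoly a) z / poly (cpoly b) z) \<longlongrightarrow> poly (cpoly a) \<mu> / poly (cpoly b) \<mu>) (at \<mu>)"
    by (intro tendsto_intros)
  then show ?thesis using has_valueI[OF ab] by blast
qed

text \<open>
  Subtracting the quotient of the coefficients of degree \<open>degree b\<close> leaves a strictly proper
  fraction.
\<close>

lemma proper_stable_value_infinity:
  assumes r: "proper_stable r"
  shows "\<exists>v. has_value at_infinity r v"
proof -
  obtain a b where ab: "b \<noteq> 0" "r = poly_frac a b" and deg: "degree a \<le> degree b"
    using r unfolding proper_stable_def by auto
  have lc: "lead_coeff (cpoly b) \<noteq> 0" using ab(1) cpoly_eq_0_iff by auto
  have dab: "degree (cpoly a) = degree a" "degree (cpoly b) = degree b" by (simp_all add: degree_map_poly)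
  define c where "c = coeff a (degree b) / lead_coeff b"
  define q where "q = a - Polynomial.smult c b"
  have q: "q = 0 \<or> degree q < degree b"
  proof (rule ccontr)
    assume n: "\<not> ?thesis"
    have "degree q \<le> degree b" unfolding q_def using deg by (intro degree_diff_le degree_smult_le[THEN order_trans]) auto
    then have "degree q = degree b" using n by simp
    moreover have "coeff q (degree b) = 0" using ab(1) by (simp add: q_def c_def)
    ultimately show False using n by (metis leading_coeff_0_iff)
  qed
  have "((\<lambda>z. poly (cpoly q) z / poly (cpoly b) z) \<longlongrightarrow> 0) at_infinity"
    using q
  proof
    assume "degree q < degree b"
    then show ?thesis by (intro poly_divide_tendsto_0_at_infinity) (simp add: degree_map_poly)
  qed (simp add: cpoly_arith)
  then have "has_value at_infinity (poly_frac q b) 0" by (rule has_valueI[OF ab(1) refl])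
  from has_value_add[OF generic_filter_at_infinity this has_value_const[of at_infinity c]]
  have "has_value at_infinity (poly_frac q b + poly_frac [:c:] 1) (of_real c)" by simp
  moreover have "poly_frac q b + poly_frac [:c:] 1 = r"
    using ab by (simp add: q_def)
  ultimately show ?thesis by blast
qed

lemma RH_inf_value:
  assumes T: "T \<in> RH_inf nr nc" and F: "F = at_infinity \<or> (\<exists>\<mu>. 1 \<le> cmod \<mu> \<and> F = at \<mu>)"
  shows "\<exists>V \<in> carrier_mat nr nc. mat_has_value F T V"
proof -
  have "\<exists>v. has_value F (T $$ (i, j)) v" if "i < nr" "j < nc" for i j
    using F T that proper_stable_value proper_stable_value_infinity unfolding RH_inf_def by blast
  then obtain f where "\<And>i j. i < nr \<Longrightarrow> j < nc \<Longrightarrow> has_value F (T $$ (i, j)) (f i j)" by metis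
  then show ?thesis using T unfolding RH_inf_def mat_has_value_def
    by (intro bexI[of _ "mat nr nc (\<lambda>(i, j). f i j)"]) auto
qed

section \<open>Coprime factors and the controller quotient\<close>

lemma const_tf_add:
  "dim_row A = dim_row B \<Longrightarrow> dim_col A = dim_col B \<Longrightarrow> const_tf (A + B) = const_tf A + const_tf B"
  "dim_row A = dim_row B \<Longrightarrow> dim_col A = dim_col B \<Longrightarrow> const_tf (A - B) = const_tf A - const_tf B"
  by (intro eq_matI; simp)+

lemma const_tf_mult: "dim_col A = dim_row B \<Longrightarrow> const_tf (A * B) = const_tf A * const_tf B"
proof (rule eq_matI)
  have sum: "poly_frac [:sum f I:] 1 = (\<Sum>l\<in>I. poly_frac [:f l:] 1)" for f :: "nat \<Rightarrow> real" and I
  proof (induction I rule: infinite_finite_induct)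
    case (insert x I)
    have "poly_frac [:f x + sum f I:] 1 = poly_frac [:f x:] 1 + poly_frac [:sum f I:] 1"
      by simp
    then show ?case using insert by simp
  qed (simp_all add: Zero_fract_def)
  fix i j assume "dim_col A = dim_row B" "i < dim_row (const_tf A * const_tf B)" "j < dim_col (const_tf A * const_tf B)"
  then show "const_tf (A * B) $$ (i, j) = (const_tf A * const_tf B) $$ (i, j)"
    by (simp add: scalar_prod_def sum mult.commute)
qed simp_all

lemma const_tf_one: "const_tf (1\<^sub>m n) = 1\<^sub>m n" and const_tf_zero: "const_tf (0\<^sub>m n m) = 0\<^sub>m n m"
  by (intro eq_matI; simp add: One_fract_def Zero_fract_def one_pCons)+

text \<open>
  Evaluating \<open>M G = N\<close> at \<open>\<mu>\<close> is impossible when \<open>\<mu>\<close> is a pole of \<open>G\<close>. Instead consider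
  \<open>H = M C\<^sub>p (z I - A\<^sub>p)\<^sup>-\<^sup>1\<close>, for which \<open>H (z I - A\<^sub>p) = M C\<^sub>p\<close> and \<open>H B\<^sub>p = N\<close>. For a stabilizing \<open>K\<close> they imply
  \<open>H = (M C\<^sub>p - N K) (z I - A\<^sub>p - B\<^sub>p K)\<^sup>-\<^sup>1\<close>, and the right-hand side has a value at \<open>\<mu>\<close>. The
  two equations hold for that value as well, whence \<open>M C\<^sub>p x = H (\<mu> I - A\<^sub>p) x = H B\<^sub>p u = N u\<close>.
\<close>

lemma coprime_factor_annihilates_modes:
  assumes dims: "Ap \<in> carrier_mat n n" "Bp \<in> carrier_mat n m" "Cp \<in> carrier_mat p n"
    and stab: "stabilizable Ap Bp"
    and M: "M \<in> carrier_mat p p" and N: "N \<in> carrier_mat p m"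
    and MG: "M * transfer_mat Ap Bp Cp (0\<^sub>m p m) = N"
    and Mv: "mat_has_value (at \<mu>) M Mv" and Nv: "mat_has_value (at \<mu>) N Nv"
    and \<mu>: "1 \<le> cmod \<mu>"
    and x: "x \<in> carrier_vec n" and u: "u \<in> carrier_vec m"
    and mode: "\<mu> \<cdot>\<^sub>v x = cmat Ap *\<^sub>v x + cmat Bp *\<^sub>v u"
  shows "Mv *\<^sub>v (cmat Cp *\<^sub>v x) = Nv *\<^sub>v u"
proof -
  obtain K where K: "K \<in> carrier_mat m n" and st: "schur_stable (Ap + Bp * K)"
    using stab dims unfolding stabilizable_def by auto
  define AK where "AK = Ap + Bp * K"
  have AK: "AK \<in> carrier_mat n n" using dims K by (auto simp: AK_def)
  have ne: "\<not> eigenvalue (cmat AK) \<mu>" using st \<mu> unfolding schur_stable_def AK_def by auto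
  let ?E = "resolvent Ap" and ?EK = "resolvent AK" and ?S = "minv (resolvent AK)"
  have Ec: "?E \<in> carrier_mat n n" "?EK \<in> carrier_mat n n" using dims AK by auto
  note iE = minv_left_right[OF resolvent_value_infinity(1)[OF dims(1)] Ec(1)]
  note iS = minv_left_right[OF resolvent_value_infinity(1)[OF AK] Ec(2)]
  define H where "H = M * const_tf Cp * minv ?E"
  have H: "H \<in> carrier_mat p n" using M dims iE(1) by (auto simp: H_def)
  have EK: "?EK = ?E - const_tf Bp * const_tf K"
    unfolding AK_def using dims K
    by (intro eq_matI) (auto simp: const_tf_add const_tf_mult)
  note d = dims[THEN carrier_matD(1)] dims[THEN carrier_matD(2)] M[THEN carrier_matD(1)] M[THEN carrier_matD(2)]
    K[THEN carrier_matD(1)] K[THEN carrier_matD(2)] H[THEN carrier_matD(1)] H[THEN carrier_matD(2)]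
    iE(1)[THEN carrier_matD(1)] iE(1)[THEN carrier_matD(2)] iS(1)[THEN carrier_matD(1)] iS(1)[THEN carrier_matD(2)]
    Ec(1)[THEN carrier_matD(1)] Ec(1)[THEN carrier_matD(2)] Ec(2)[THEN carrier_matD(1)] Ec(2)[THEN carrier_matD(2)]
    N[THEN carrier_matD(1)] N[THEN carrier_matD(2)]
  have HB: "H * const_tf Bp = N"
  proof -
    have "N = M * (const_tf Cp * minv ?E * const_tf Bp)"
      unfolding MG[symmetric] transfer_mat_def const_tf_zero using dims iE(1) by simp
    then show ?thesis unfolding H_def using d dims by (simp add: mult_assoc_dim del: index_minus_mat)
  qed
  have HE: "H * ?E = M * const_tf Cp"
    unfolding H_def mult_assoc_dim[of "M * const_tf Cp" "minv ?E" ?E] using iE(3) M dims d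
    by (subst mult_assoc_dim) auto
  have HS: "H = (M * const_tf Cp - N * const_tf K) * ?S"
  proof -
    have "H * ?EK = M * const_tf Cp - N * const_tf K"
    proof -
      have "H * ?EK = H * ?E - H * (const_tf Bp * const_tf K)"
        unfolding EK using d by (intro mult_minus_distrib_mat[of _ p n _ n]) auto
      also have "H * (const_tf Bp * const_tf K) = N * const_tf K"
        using mult_assoc_dim[of H "const_tf Bp" "const_tf K"] d HB by simp
      finally show ?thesis using HE by simp
    qed
    then have "(M * const_tf Cp - N * const_tf K) * ?S = H * (?EK * ?S)"
      using mult_assoc_dim[of H ?EK ?S] d by simp
    then show ?thesis using iS(2) H by simp
  qed
  define Hv where "Hv = (Mv * cmat Cp - Nv * cmat K) * minv (\<mu> \<cdot>\<^sub>m 1\<^sub>m n - cmat AK)"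
  have vd: "dim_row Mv = p" "dim_col Mv = p" "dim_row Nv = p" "dim_col Nv = m"
    using Mv Nv M N unfolding mat_has_value_def by auto
  have rd: "minv (\<mu> \<cdot>\<^sub>m 1\<^sub>m n - cmat AK) \<in> carrier_mat n n"
    using AK by (intro minv_left_right(1)[OF resolvent_value(1)[OF AK ne]]) auto
  note gen = generic_filter_at
  have val: "mat_has_value (at \<mu>) H Hv"
    unfolding Hv_def using vd d rd
    by (subst HS, intro mat_has_value_mult mat_has_value_add Mv Nv gen mat_has_value_const resolvent_value(3)[OF AK ne]) auto
  have Hd: "dim_row Hv = p" "dim_col Hv = n" using vd rd unfolding Hv_def by auto
  have eq1: "Hv * (\<mu> \<cdot>\<^sub>m 1\<^sub>m n - cmat Ap) = Mv * cmat Cp"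
  proof (rule mat_has_value_unique[OF gen])
    show "mat_has_value (at \<mu>) (H * ?E) (Hv * (\<mu> \<cdot>\<^sub>m 1\<^sub>m n - cmat Ap))"
      using Hd d by (intro mat_has_value_mult gen val mat_has_value_resolvent dims) auto
    show "mat_has_value (at \<mu>) (H * ?E) (Mv * cmat Cp)"
      unfolding HE using vd d by (intro mat_has_value_mult gen Mv mat_has_value_const) auto
  qed
  have eq2: "Hv * cmat Bp = Nv"
  proof (rule mat_has_value_unique[OF gen _ Nv])
    show "mat_has_value (at \<mu>) N (Hv * cmat Bp)"
      unfolding HB[symmetric] using Hd d by (intro mat_has_value_mult gen val mat_has_value_const) auto
  qed
  have res: "(\<mu> \<cdot>\<^sub>m 1\<^sub>m n - cmat Ap) *\<^sub>v x = cmat Bp *\<^sub>v u"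
  proof -
    have "(\<mu> \<cdot>\<^sub>m 1\<^sub>m n - cmat Ap) *\<^sub>v x = \<mu> \<cdot>\<^sub>v x - cmat Ap *\<^sub>v x"
      using dims x by (simp add: mat_vec_expand)
    also have "\<dots> = cmat Bp *\<^sub>v u"
      unfolding mode using dims x u by (intro eq_vecI) (simp_all del: index_mult_mat_vec)
    finally show ?thesis .
  qed
  have "Mv *\<^sub>v (cmat Cp *\<^sub>v x) = (Hv * (\<mu> \<cdot>\<^sub>m 1\<^sub>m n - cmat Ap)) *\<^sub>v x"
    unfolding eq1 using vd d x by (simp add: mult_vec_assoc_dim)
  also have "\<dots> = Hv *\<^sub>v (cmat Bp *\<^sub>v u)"
    using mult_vec_assoc_dim[of Hv "\<mu> \<cdot>\<^sub>m 1\<^sub>m n - cmat Ap" x] Hd d x res by simp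
  also have "\<dots> = Nv *\<^sub>v u"
    unfolding eq2[symmetric] using Hd d u by (simp add: mult_vec_assoc_dim)
  finally show ?thesis .
qed

text \<open>
  Let \<open>\<Phi>\<close> and \<open>\<Gamma>\<close> be the inverses of \<open>z I - A\<close> and \<open>z I - A + B D\<^sub>X\<^sup>-\<^sup>1 C\<^sub>X\<close>. The resolvent identity gives
  \<open>\<Gamma> B D\<^sub>X\<^sup>-\<^sup>1 \<^bold>X = \<Phi> B\<close>. Multiplying it from the left shows both that \<open>\<^bold>X\<close> has a left inverse and that the
  controller times \<open>\<^bold>X\<close> is \<open>\<^bold>Y\<close>.
\<close>

lemma transfer_mat_quotient:
  assumes car: "A \<in> carrier_mat k k" "B \<in> carrier_mat k p" "CX \<in> carrier_mat p k" "DX \<in> carrier_mat p p"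
      "CY \<in> carrier_mat m k" "DY \<in> carrier_mat m p"
    and D: "invertible_mat DX"
  shows "invertible_mat (transfer_mat A B CX DX)"
    "transfer_mat (A - B * minv DX * CX) (- (B * minv DX)) (- CY + DY * minv DX * CX) (DY * minv DX) =
      transfer_mat A B CY DY * minv (transfer_mat A B CX DX)"
proof -
  note iD = minv_left_right[OF D car(4)]
  define AK where "AK = A - B * minv DX * CX"
  have AK: "AK \<in> carrier_mat k k" using car iD by (auto simp: AK_def)
  let ?\<Phi> = "minv (resolvent A)" and ?\<Gamma> = "minv (resolvent AK)"
  have Rc: "resolvent A \<in> carrier_mat k k" "resolvent AK \<in> carrier_mat k k" using car AK by auto
  note i\<Phi> = minv_left_right[OF resolvent_value_infinity(1)[OF car(1)] Rc(1)]
  note i\<Gamma> = minv_left_right[OF resolvent_value_infinity(1)[OF AK] Rc(2)]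
  define b cx dx cy dy di where "b = const_tf B" and "cx = const_tf CX" and "dx = const_tf DX"
    and "cy = const_tf CY" and "dy = const_tf DY" and "di = const_tf (minv DX)"
  have c: "b \<in> carrier_mat k p" "cx \<in> carrier_mat p k" "dx \<in> carrier_mat p p" "cy \<in> carrier_mat m k"
    "dy \<in> carrier_mat m p" "di \<in> carrier_mat p p"
    using car iD(1) unfolding b_def cx_def dx_def cy_def dy_def di_def by auto
  note d = c[THEN carrier_matD(1)] c[THEN carrier_matD(2)] i\<Phi>(1)[THEN carrier_matD(1)] i\<Phi>(1)[THEN carrier_matD(2)]
    i\<Gamma>(1)[THEN carrier_matD(1)] i\<Gamma>(1)[THEN carrier_matD(2)]
  have did: "di * dx = 1\<^sub>m p"
    using iD car unfolding di_def dx_def by (simp add: const_tf_one flip: const_tf_mult)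
  define X where "X = transfer_mat A B CX DX"
  have X: "X = cx * ?\<Phi> * b + dx" unfolding X_def transfer_mat_def cx_def b_def dx_def ..
  have Xc: "X \<in> carrier_mat p p" unfolding X_def by (rule transfer_mat_carrier[OF car(1-4)])
  have R: "resolvent AK = resolvent A + b * di * cx"
    unfolding AK_def b_def di_def cx_def using car iD(1)
    by (intro eq_matI) (auto simp: const_tf_add const_tf_mult)
  have res: "?\<Gamma> * (b * (di * (cx * ?\<Phi>))) = ?\<Phi> - ?\<Gamma>"
  proof -
    have "b * di * cx = resolvent AK - resolvent A"
    proof -
      have "Q = (P + Q) - P" if "P \<in> carrier_mat k k" "Q \<in> carrier_mat k k" for P Q :: tf_mat
        using that by (intro eq_matI) auto
      from this[OF Rc(1) mult_carrier_mat[OF mult_carrier_mat[OF c(1,6)] c(2)]] show ?thesis unfolding R .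
    qed
    then have "?\<Gamma> * (b * di * cx) * ?\<Phi> = ?\<Gamma> * (resolvent AK - resolvent A) * ?\<Phi>" by simp
    also have "\<dots> = ?\<Gamma> * resolvent AK * ?\<Phi> - ?\<Gamma> * (resolvent A * ?\<Phi>)"
      using Rc i\<Phi>(1) i\<Gamma>(1)
      by (simp add: mult_minus_distrib_mat[OF i\<Gamma>(1) Rc(2) Rc(1)] minus_mult_distrib_mat[of _ k k] mult_assoc_dim[of ?\<Gamma> "resolvent A"])
    also have "\<dots> = ?\<Phi> - ?\<Gamma>" unfolding i\<Phi>(2) i\<Gamma>(3) using i\<Phi>(1) i\<Gamma>(1) by simp
    finally show ?thesis using d by (simp add: mult_assoc_dim)
  qed
  have key: "?\<Gamma> * (b * (di * X)) = ?\<Phi> * b"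
  proof -
    have "?\<Gamma> * (b * (di * X)) = ?\<Gamma> * (b * (di * (cx * ?\<Phi>))) * b + ?\<Gamma> * (b * (di * dx))"
      unfolding X using d by (simp add: mat_distrib_dim mult_assoc_dim)
    also have "\<dots> = ?\<Phi> * b - ?\<Gamma> * b + ?\<Gamma> * b"
      unfolding res did using d c by (simp add: mat_distrib_dim)
    also have "\<dots> = ?\<Phi> * b" using d by (intro eq_matI) auto
    finally show ?thesis .
  qed
  have quot: "(e1 * ?\<Gamma> * (b * di) + e2) * X = e1 * ?\<Phi> * b + e2 * X"
    if "dim_col e1 = k" "dim_row e2 = dim_row e1" "dim_col e2 = p" for e1 e2
  proof -
    have "e1 * ?\<Gamma> * (b * di) * X = e1 * (?\<Gamma> * (b * (di * X)))"
      using that d Xc by (simp add: mult_assoc_dim)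
    also have "\<dots> = e1 * ?\<Phi> * b" unfolding key using that d by (simp add: mult_assoc_dim)
    finally show ?thesis using that d Xc by (simp add: mat_distrib_dim)
  qed
  have diX: "di * X = di * cx * ?\<Phi> * b + 1\<^sub>m p"
    unfolding X did[symmetric] using d by (simp add: mat_distrib_dim mult_assoc_dim)
  have left_inv: "((- (di * cx)) * ?\<Gamma> * (b * di) + di) * X = 1\<^sub>m p"
  proof -
    have "((- (di * cx)) * ?\<Gamma> * (b * di) + di) * X = - (di * cx) * ?\<Phi> * b + (di * cx * ?\<Phi> * b + 1\<^sub>m p)"
      using quot[of "- (di * cx)" di] d unfolding diX by simp
    also have "\<dots> = 1\<^sub>m p" using d by (intro eq_matI) (auto simp: mat_distrib_dim)
    finally show ?thesis .
  qed
  show inv: "invertible_mat (transfer_mat A B CX DX)"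
    unfolding X_def[symmetric]
    by (rule invertible_matI[OF Xc _ disjI2[OF left_inv]]) (intro carrier_matI, use d in auto)
  note iX = minv_left_right[OF inv[folded X_def] Xc]
  have TK: "transfer_mat AK (- (B * minv DX)) (- CY + DY * minv DX * CX) (DY * minv DX) =
      (cy - dy * di * cx) * ?\<Gamma> * (b * di) + dy * di"
  proof -
    have neg: "const_tf (- P) = - const_tf P" for P by (intro eq_matI) auto
    have "const_tf (- CY + DY * minv DX * CX) = - (cy - dy * di * cx)"
      unfolding cy_def dy_def di_def cx_def using car iD(1)
      by (subst const_tf_add) (auto simp: const_tf_mult neg intro!: eq_matI)
    moreover have "const_tf (- (B * minv DX)) = - (b * di)"
      unfolding neg b_def di_def using car iD(1) by (simp add: const_tf_mult)
    moreover have "const_tf (DY * minv DX) = dy * di"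
      unfolding dy_def di_def using car iD(1) by (simp add: const_tf_mult)
    ultimately show ?thesis unfolding transfer_mat_def using d by (simp add: mat_distrib_dim(5,6))
  qed
  define TY where "TY = transfer_mat A B CY DY"
  have TY: "TY = cy * ?\<Phi> * b + dy" unfolding TY_def transfer_mat_def cy_def b_def dy_def ..
  have "((cy - dy * di * cx) * ?\<Gamma> * (b * di) + dy * di) * X = TY"
  proof -
    have "((cy - dy * di * cx) * ?\<Gamma> * (b * di) + dy * di) * X =
        (cy - dy * di * cx) * ?\<Phi> * b + dy * di * X"
      using d by (intro quot) auto
    also have "dy * di * X = dy * di * cx * ?\<Phi> * b + dy"
      using d Xc c diX by (simp add: mult_assoc_dim mat_distrib_dim)
    also have "(cy - dy * di * cx) * ?\<Phi> * b + (dy * di * cx * ?\<Phi> * b + dy) = TY"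
      unfolding TY using d by (intro eq_matI) (auto simp: mat_distrib_dim simp del: index_mult_mat(1))
    finally show ?thesis .
  qed
  then have "TY * minv X = ((cy - dy * di * cx) * ?\<Gamma> * (b * di) + dy * di) * (X * minv X)"
    using d Xc iX(1) by (subst mult_assoc_dim[symmetric]) auto
  also have "\<dots> = (cy - dy * di * cx) * ?\<Gamma> * (b * di) + dy * di"
    unfolding iX(2) using d by (intro right_mult_one_mat) (intro carrier_matI, auto)
  finally show "transfer_mat (A - B * minv DX * CX) (- (B * minv DX)) (- CY + DY * minv DX * CX) (DY * minv DX) =
      transfer_mat A B CY DY * minv (transfer_mat A B CX DX)"
    unfolding AK_def[symmetric] X_def[symmetric] TY_def[symmetric] TK by simp
qed

section \<open>Internal stability from the linear matrix inequality\<close>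

lemma cmat_append_cols:
  "dim_row A = dim_row B \<Longrightarrow> cmat (append_cols A B) = append_cols (cmat A) (cmat B)"
  by (intro eq_matI) (auto simp: append_cols_def append_rows_def)

lemma cmat_append_rows:
  "dim_col A = dim_col B \<Longrightarrow> cmat (A @\<^sub>r B) = cmat A @\<^sub>r cmat B"
  by (intro eq_matI) (auto simp: append_cols_def append_rows_def)

lemmas cmat_append = cmat_append_cols cmat_append_rows

lemma append_vec_inject:
  assumes "dim_vec a = dim_vec c" "a @\<^sub>v b = c @\<^sub>v d"
  shows "a = c \<and> b = d"
  using append_vec_eq[of a "dim_vec a" c b d] assms(2) carrier_vecI[of c] assms(1) carrier_vec_dim_vec[of a]
  by metis

text \<open>
  The hypothesis says that the closed-loop matrix \<open>W\<close> has no eigenvalue of modulus at least \<open>1\<close>, and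
  trajectories are powers of \<open>W\<close> applied to the initial state.
\<close>

lemma internally_stabilizes_if_no_unstable_mode:
  assumes plant: "Ap \<in> carrier_mat n n" "Bp \<in> carrier_mat n m" "Cp \<in> carrier_mat p n"
    and contr: "AK \<in> carrier_mat q q" "BK \<in> carrier_mat q p" "CK \<in> carrier_mat m q" "DK \<in> carrier_mat m p"
    and modes: "\<And>\<mu> x \<xi> u y. 1 \<le> cmod \<mu> \<Longrightarrow> x \<in> carrier_vec n \<Longrightarrow> \<xi> \<in> carrier_vec q \<Longrightarrow>
      y = cmat Cp *\<^sub>v x \<Longrightarrow> u = cmat CK *\<^sub>v \<xi> + cmat DK *\<^sub>v y \<Longrightarrow>
      \<mu> \<cdot>\<^sub>v x = cmat Ap *\<^sub>v x + cmat Bp *\<^sub>v u \<Longrightarrow> \<mu> \<cdot>\<^sub>v \<xi> = cmat AK *\<^sub>v \<xi> + cmat BK *\<^sub>v y \<Longrightarrow>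
      x = 0\<^sub>v n \<and> \<xi> = 0\<^sub>v q"
  shows "internally_stabilizes AK BK CK DK Ap Bp Cp"
proof -
  note d = plant[THEN carrier_matD(1)] plant[THEN carrier_matD(2)] contr[THEN carrier_matD(1)] contr[THEN carrier_matD(2)]
  define W where "W = append_cols (Ap + Bp * (DK * Cp)) (Bp * CK) @\<^sub>r append_cols (BK * Cp) AK"
  have W: "W \<in> carrier_mat (n + q) (n + q)" using d by (intro carrier_matI) (simp_all add: W_def)
  have stable: "cmod \<mu> < 1" if ev: "eigenvalue (cmat W) \<mu>" for \<mu>
  proof (rule ccontr)
    assume "\<not> ?thesis"
    then have \<mu>: "1 \<le> cmod \<mu>" by simp
    obtain v where v: "v \<in> carrier_vec (n + q)" "v \<noteq> 0\<^sub>v (n + q)" "cmat W *\<^sub>v v = \<mu> \<cdot>\<^sub>v v"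
      using ev W unfolding eigenvalue_def eigenvector_def by auto
    define x \<xi> where "x = vec_first v n" and "\<xi> = vec_last v q"
    have vx: "v = x @\<^sub>v \<xi>" and xd: "x \<in> carrier_vec n" "\<xi> \<in> carrier_vec q"
      using v(1) by (simp_all add: x_def \<xi>_def)
    define y u where "y = cmat Cp *\<^sub>v x" and "u = cmat CK *\<^sub>v \<xi> + cmat DK *\<^sub>v y"
    have "cmat W *\<^sub>v v = (cmat Ap *\<^sub>v x + cmat Bp *\<^sub>v u) @\<^sub>v (cmat AK *\<^sub>v \<xi> + cmat BK *\<^sub>v y)"
    proof -
      have "cmat W *\<^sub>v v = ((cmat Ap + cmat Bp * (cmat DK * cmat Cp)) *\<^sub>v x + (cmat Bp * cmat CK) *\<^sub>v \<xi>)
          @\<^sub>v ((cmat BK * cmat Cp) *\<^sub>v x + cmat AK *\<^sub>v \<xi>)"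
        unfolding W_def vx using d xd
        by (simp add: cmat_append cmat_arith append_rows_mult_vec append_cols_mult_vec)
      moreover have "(cmat Ap + cmat Bp * (cmat DK * cmat Cp)) *\<^sub>v x + (cmat Bp * cmat CK) *\<^sub>v \<xi> = cmat Ap *\<^sub>v x + cmat Bp *\<^sub>v u"
        unfolding u_def y_def using d xd by (intro eq_vecI) (simp_all add: mat_vec_expand del: index_mult_mat_vec)
      moreover have "(cmat BK * cmat Cp) *\<^sub>v x + cmat AK *\<^sub>v \<xi> = cmat AK *\<^sub>v \<xi> + cmat BK *\<^sub>v y"
        unfolding y_def using d xd by (intro eq_vecI) (simp_all add: mat_vec_expand del: index_mult_mat_vec)
      ultimately show ?thesis by simp
    qed
    moreover have "\<mu> \<cdot>\<^sub>v v = (\<mu> \<cdot>\<^sub>v x) @\<^sub>v (\<mu> \<cdot>\<^sub>v \<xi>)" unfolding vx by (intro eq_vecI) auto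
    ultimately have "(\<mu> \<cdot>\<^sub>v x) @\<^sub>v (\<mu> \<cdot>\<^sub>v \<xi>) = (cmat Ap *\<^sub>v x + cmat Bp *\<^sub>v u) @\<^sub>v (cmat AK *\<^sub>v \<xi> + cmat BK *\<^sub>v y)"
      using v(3) by simp
    then have "\<mu> \<cdot>\<^sub>v x = cmat Ap *\<^sub>v x + cmat Bp *\<^sub>v u \<and> \<mu> \<cdot>\<^sub>v \<xi> = cmat AK *\<^sub>v \<xi> + cmat BK *\<^sub>v y"
      using d xd by (intro append_vec_inject) simp_all
    then have "x = 0\<^sub>v n \<and> \<xi> = 0\<^sub>v q" using modes[OF \<mu> xd y_def u_def] by blast
    then show False using v(2) vx append_vec_eq_0_iff[of x n \<xi> q] by simp
  qed
  show ?thesis unfolding internally_stabilizes_def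
  proof (intro allI impI)
    fix x \<xi> u y :: "nat \<Rightarrow> real vec"
    assume tr: "\<forall>t. x t \<in> carrier_vec (dim_row Ap) \<and> \<xi> t \<in> carrier_vec (dim_row AK) \<and>
             x (Suc t) = Ap *\<^sub>v x t + Bp *\<^sub>v u t \<and> y t = Cp *\<^sub>v x t \<and>
             \<xi> (Suc t) = AK *\<^sub>v \<xi> t + BK *\<^sub>v y t \<and> u t = CK *\<^sub>v \<xi> t + DK *\<^sub>v y t"
    have xd: "dim_vec (x t) = n" "dim_vec (\<xi> t) = q" for t using tr d carrier_vecD by metis+
    define s where "s = (\<lambda>t. x t @\<^sub>v \<xi> t)"
    have s: "s t \<in> carrier_vec (n + q)" for t using xd by (intro carrier_vecI) (simp add: s_def)
    have step: "s (Suc t) = W *\<^sub>v s t" for t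
    proof -
      have y: "y t = Cp *\<^sub>v x t" and u: "u t = CK *\<^sub>v \<xi> t + DK *\<^sub>v y t" using tr by blast+
      have "W *\<^sub>v s t = ((Ap + Bp * (DK * Cp)) *\<^sub>v x t + (Bp * CK) *\<^sub>v \<xi> t)
          @\<^sub>v ((BK * Cp) *\<^sub>v x t + AK *\<^sub>v \<xi> t)"
        unfolding W_def s_def using d xd[of t]
        by (simp add: append_rows_mult_vec append_cols_mult_vec)
      moreover have "(Ap + Bp * (DK * Cp)) *\<^sub>v x t + (Bp * CK) *\<^sub>v \<xi> t = Ap *\<^sub>v x t + Bp *\<^sub>v u t"
        unfolding u y using d xd[of t] by (intro eq_vecI) (simp_all add: mat_vec_expand del: index_mult_mat_vec)
      moreover have "(BK * Cp) *\<^sub>v x t + AK *\<^sub>v \<xi> t = AK *\<^sub>v \<xi> t + BK *\<^sub>v y t"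
        unfolding y using d xd[of t] by (intro eq_vecI) (simp_all add: mat_vec_expand del: index_mult_mat_vec)
      ultimately show ?thesis using tr unfolding s_def by simp
    qed
    have sol: "s t = (W ^\<^sub>m t) *\<^sub>v s 0" for t
    proof (induction t)
      case 0
      then show ?case using s[of 0] W by simp
    next
      case (Suc t)
      have "W ^\<^sub>m Suc t = W * W ^\<^sub>m t"
        using W pow_carrier_mat[OF W] by (induction t) (simp_all add: mult_assoc_dim)
      then have "(W ^\<^sub>m Suc t) *\<^sub>v s 0 = W *\<^sub>v ((W ^\<^sub>m t) *\<^sub>v s 0)"
        using W pow_carrier_mat[OF W, of t] s[of 0] by (simp add: mult_vec_assoc_dim)
      then show ?case using Suc step by simp
    qed
    have entry: "(\<lambda>t. (W ^\<^sub>m t) $$ (i, j)) \<longlonglongrightarrow> 0" if "i < n + q" "j < n + q" for i j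
    proof -
      have "cmat W \<in> carrier_mat (n + q) (n + q)" using W by simp
      from tendsto_Re[OF stable_pow_tendsto_0[OF this stable that]]
      have "(\<lambda>t. Re ((cmat W ^\<^sub>m t) $$ (i, j))) \<longlonglongrightarrow> 0" by simp
      moreover have "Re ((cmat W ^\<^sub>m t) $$ (i, j)) = (W ^\<^sub>m t) $$ (i, j)" for t
        using that W pow_carrier_mat[OF W, of t] unfolding of_real_hom.mat_hom_pow[OF W, symmetric] by simp
      ultimately show ?thesis by simp
    qed
    have lim: "(\<lambda>t. s t $ i) \<longlonglongrightarrow> 0" if i: "i < n + q" for i
    proof -
      have "s t $ i = (\<Sum>j = 0..<n + q. (W ^\<^sub>m t) $$ (i, j) * s 0 $ j)" for t
        unfolding sol[of t] using i W s[of 0] pow_carrier_mat[OF W, of t] by (auto simp: scalar_prod_def)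
      moreover have "(\<lambda>t. \<Sum>j = 0..<n + q. (W ^\<^sub>m t) $$ (i, j) * s 0 $ j) \<longlonglongrightarrow> (\<Sum>j = 0..<n + q. 0 * s 0 $ j)"
        by (intro tendsto_intros entry i) auto
      ultimately show ?thesis by simp
    qed
    show "(\<forall>i<dim_row Ap. (\<lambda>t. x t $ i) \<longlonglongrightarrow> 0) \<and> (\<forall>i<dim_row AK. (\<lambda>t. \<xi> t $ i) \<longlonglongrightarrow> 0)"
    proof (intro conjI allI impI)
      fix i assume "i < dim_row Ap"
      then show "(\<lambda>t. x t $ i) \<longlonglongrightarrow> 0" using lim[of i] d xd by (simp add: s_def)
    next
      fix i assume "i < dim_row AK"
      then show "(\<lambda>t. \<xi> t $ i) \<longlonglongrightarrow> 0" using lim[of "n + i"] d xd by (simp add: s_def)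
    qed
  qed
qed

text \<open>
  The storage at \<open>(v, - v)\<close> is the form of \<open>X - Z\<close>, at \<open>(0, v)\<close> that of \<open>Z\<close>. An eigenvector of \<open>A\<close> is a
  mode in which the state of \<open>(\<^bold>X, \<^bold>Y)\<close> is zero, that is \<open>b\<^sub>1 + b\<^sub>2 = 0\<close>.
\<close>

lemma lmi_stable:
  assumes dims: "A \<in> carrier_mat k k" "BM \<in> carrier_mat k p" "BN \<in> carrier_mat k m"
      "C \<in> carrier_mat p k" "DM \<in> carrier_mat p p" "DN \<in> carrier_mat p m"
    and vars: "lmi_vars k p m X Z Q F LX LY RX RY"
    and pd: "pos_def (lmi_mat k p 1 A BM BN C DM DN X Z Q F LX LY RX RY)"
  shows "invertible_mat (X - Z)" "invertible_mat Z" "schur_stable A"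
proof -
  note vars' = lmi_varsD[OF vars]
  note d = dims[THEN carrier_matD(1)] dims[THEN carrier_matD(2)] vars'[THEN carrier_matD(1)]
    vars'[THEN carrier_matD(2)]
  note pos = lmi_storage_pos[OF dims vars pd]
  show E: "invertible_mat (X - Z)"
  proof (rule invertible_mat_no_kernel[of _ k])
    fix v assume v: "v \<in> carrier_vec k" "(X - Z) *\<^sub>v v = 0\<^sub>v k"
    have a: "X *\<^sub>v v + Z *\<^sub>v (- v) = (X - Z) *\<^sub>v v" "Z *\<^sub>v v + Z *\<^sub>v (- v) = 0\<^sub>v k"
      using vars' v(1) by (auto simp: mat_vec_expand intro!: eq_vecI simp del: index_mult_mat_vec)
    have "storage X Z v (- v) = 0" unfolding storage_def a v(2) using v(1) by (simp add: scalar_prod_zero_dim)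
    then show "v = 0\<^sub>v k" using pos[of v "- v"] v(1) by auto
  qed (use vars' in auto)
  show "invertible_mat Z"
  proof (rule invertible_mat_no_kernel[of _ k])
    fix v assume v: "v \<in> carrier_vec k" "Z *\<^sub>v v = 0\<^sub>v k"
    have "storage X Z (0\<^sub>v k) v = 0" unfolding storage_def using vars' v by (simp add: mat_vec_zero_dim scalar_prod_zero_dim)
    then show "v = 0\<^sub>v k" using pos[of "0\<^sub>v k" v] v(1) by auto
  qed (use vars' in auto)
  have "cmod \<mu> < 1" if ev: "eigenvalue (cmat A) \<mu>" for \<mu>
  proof (rule ccontr)
    assume "\<not> ?thesis"
    then have \<mu>: "1 \<le> cmod \<mu>" by simp
    obtain v where v: "v \<in> carrier_vec k" "v \<noteq> 0\<^sub>v k" "cmat A *\<^sub>v v = \<mu> \<cdot>\<^sub>v v"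
      using ev dims unfolding eigenvalue_def eigenvector_def by auto
    have iE: "cmat (X - Z) * cmat (minv (X - Z)) = 1\<^sub>m k" "minv (X - Z) \<in> carrier_mat k k"
      using minv_left_right[OF E minus_carrier_mat[OF vars'(2)]] d by (simp_all add: cmat_arith(6) flip: cmat_arith(4))
    define b where "b = cmat (minv (X - Z)) *\<^sub>v v"
    have b: "b \<in> carrier_vec k" using iE(2) by (auto simp: b_def intro: carrier_vecI)
    have "cmat (X - Z) *\<^sub>v b = v"
      unfolding b_def using mult_vec_assoc_dim[of "cmat (X - Z)" "cmat (minv (X - Z))" v] iE d v(1) by simp
    then have Eb: "cmat X *\<^sub>v b + cmat Z *\<^sub>v (- b) = v"
      using d b by (auto simp: cmat_arith mat_vec_expand vec_eq_iff simp del: index_mult_mat_vec)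
    have bb: "b + - b = 0\<^sub>v k" using b by auto
    have z1: "cmat LX *\<^sub>v (b + - b) + cmat RX *\<^sub>v 0\<^sub>v p = 0\<^sub>v p" "cmat LY *\<^sub>v (b + - b) + cmat RY *\<^sub>v 0\<^sub>v p = 0\<^sub>v m"
      unfolding bb using d by (simp_all add: mat_vec_zero_dim)
    have "b = 0\<^sub>v k \<and> - b = 0\<^sub>v k \<and> 0\<^sub>v p = (0\<^sub>v p :: complex vec)"
    proof (rule lmi_no_unstable_mode[OF dims vars pd b _ _ z1[symmetric] _ _ refl _ \<mu>])
      show "\<mu> \<cdot>\<^sub>v (cmat X *\<^sub>v b + cmat Z *\<^sub>v (- b)) =
        cmat A *\<^sub>v (cmat X *\<^sub>v b + cmat Z *\<^sub>v (- b)) + cmat BM *\<^sub>v 0\<^sub>v p - cmat BN *\<^sub>v 0\<^sub>v m"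
        unfolding Eb v(3) using d v(1) by (intro eq_vecI) (simp_all add: mat_vec_zero_dim)
      show "\<mu> \<cdot>\<^sub>v (cmat Z *\<^sub>v (b + - b)) = cmat Q *\<^sub>v (b + - b) + cmat F *\<^sub>v 0\<^sub>v p"
        unfolding bb using d by (auto simp: mat_vec_zero_dim)
    qed (use b in auto)
    then have "v = 0\<^sub>v k" using d unfolding b_def[symmetric] Eb[symmetric] by (auto simp: mat_vec_zero_dim)
    then show False using v(2) by simp
  qed
  then show "schur_stable A" unfolding schur_stable_def using dims by auto
qed

text \<open>
  The plant is strictly proper: compare values at infinity in \<open>M\<^sub>l G = N\<^sub>l\<close>.
\<close>

lemma zero_feedthrough:
  assumes plant: "Ap \<in> carrier_mat n n" "Bp \<in> carrier_mat n m" "Cp \<in> carrier_mat p n"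
    and dims: "A \<in> carrier_mat k k" "BM \<in> carrier_mat k p" "BN \<in> carrier_mat k m"
      "C \<in> carrier_mat p k" "DM \<in> carrier_mat p p" "DN \<in> carrier_mat p m"
    and MG: "transfer_mat A BM C DM * transfer_mat Ap Bp Cp (0\<^sub>m p m) = transfer_mat A BN C DN"
  shows "DN = 0\<^sub>m p m"
proof -
  note gen = generic_filter_at_infinity
  have "mat_has_value at_infinity (transfer_mat A BN C DN) (cmat DM * cmat (0\<^sub>m p m))"
    unfolding MG[symmetric] using dims
    by (intro mat_has_value_mult gen transfer_mat_value_infinity[OF dims(1,2,4,5)]
        transfer_mat_value_infinity[OF plant zero_carrier_mat]) auto
  from mat_has_value_unique[OF gen transfer_mat_value_infinity[OF dims(1,3,4,6)] this]
  have "cmat DN = cmat DM * cmat (0\<^sub>m p m)" .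
  also have "\<dots> = cmat (0\<^sub>m p m)" using dims by (simp add: cmat_arith)
  finally show ?thesis by (rule of_real_hom.mat_hom_inj)
qed

text \<open>
  On the kernel of \<open>R\<^sub>X\<close> the error block \<open>f\<^sub>6\<^sup>T\<close> is \<open>- I\<close>, as \<open>D\<^sub>N = 0\<close>. So the form vanishes at
  \<open>(0, 0, 0, 0, v, v)\<close>.
\<close>

lemma lmi_invertible_feedthrough:
  assumes dims: "A \<in> carrier_mat k k" "BM \<in> carrier_mat k p" "BN \<in> carrier_mat k m"
      "C \<in> carrier_mat p k" "DM \<in> carrier_mat p p"
    and vars: "lmi_vars k p m X Z Q F LX LY RX RY"
    and pd: "pos_def (lmi_mat k p 1 A BM BN C DM (0\<^sub>m p m) X Z Q F LX LY RX RY)"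
  shows "invertible_mat RX"
proof (rule invertible_mat_no_kernel[of _ p])
  show RX: "RX \<in> carrier_mat p p" using vars by (auto simp: lmi_vars_def)
  have vars': "X \<in> carrier_mat k k" "Z \<in> carrier_mat k k" "Q \<in> carrier_mat k k" "F \<in> carrier_mat k p"
      "LX \<in> carrier_mat p k" "LY \<in> carrier_mat m k" "RY \<in> carrier_mat m p"
    using vars by (auto simp: lmi_vars_def)
  fix v assume v: "v \<in> carrier_vec p" "RX *\<^sub>v v = 0\<^sub>v p"
  let ?v = "0\<^sub>v k @\<^sub>v 0\<^sub>v k @\<^sub>v 0\<^sub>v k @\<^sub>v 0\<^sub>v k @\<^sub>v v @\<^sub>v v"
  let ?M = "lmi_mat k p 1 A BM BN C DM (0\<^sub>m p m) X Z Q F LX LY RX RY"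
  have z: "0\<^sub>v k \<in> carrier_vec k" by auto
  note bil = lmi_mat_bilinear[OF dims zero_carrier_mat vars z z z z v(1) v(1) z z z z v(1) v(1), of 1]
  have "?v \<bullet> (?M *\<^sub>v ?v) = 0"
    unfolding bil(2) v(2) using vars' RX dims v
    by (simp add: mat_vec_expand scalar_prod_zero_dim scalar_prod_distrib_dim)
  moreover have "?v \<in> carrier_vec (dim_row ?M)" using bil(1) v(1) by (intro carrier_vecI) auto
  ultimately have "?v = 0\<^sub>v (dim_row ?M)" using pd unfolding pos_def_def by fastforce
  then show "v = 0\<^sub>v p" using bil(1) v(1) by (auto simp: append_vec_eq_0_iff)
qed

lemma vec_balance:
  fixes a b c e x z :: "'a::comm_ring vec"
  assumes "dim_vec a = n" "dim_vec b = n" "dim_vec c = n"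
  shows "dim_vec e = n \<Longrightarrow> a + c = b + e \<Longrightarrow> x = a - b \<Longrightarrow> x + c - e = 0\<^sub>v n"
    "dim_vec x = n \<Longrightarrow> dim_vec z = n \<Longrightarrow> a - b = x - z \<Longrightarrow> c = z - b \<Longrightarrow> a + c = x"
proof -
  assume e: "dim_vec e = n" and 1: "a + c = b + e" and x: "x = a - b"
  show "x + c - e = 0\<^sub>v n"
  proof (rule eq_vecI)
    fix i assume "i < dim_vec (0\<^sub>v n :: 'a vec)"
    then show "(x + c - e) $ i = 0\<^sub>v n $ i"
      using arg_cong[OF 1, of "\<lambda>v. v $ i"] assms e by (simp add: x algebra_simps)
  qed (simp add: e)
next
  assume d: "dim_vec x = n" "dim_vec z = n" and 1: "a - b = x - z" and c: "c = z - b"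
  show "a + c = x"
  proof (rule eq_vecI)
    fix i assume "i < dim_vec x"
    then show "(a + c) $ i = x $ i"
      using arg_cong[OF 1, of "\<lambda>v. v $ i"] assms d by (simp add: c algebra_simps)
  qed (simp add: assms d)
qed

text \<open>
  Here \<open>V\<close> is the inverse transpose of the coordinate matrix \<open>U\<close>. A closed-loop mode is
  written as \<open>y = \<^bold>X w\<close>, \<open>u = \<^bold>Y w\<close> and extended by the state \<open>x\<^sub>M\<close> that the left factors have when
  driven by \<open>(y, u)\<close>. Their output is zero by \<open>coprime_factor_annihilates_modes\<close>, so that \<open>z = - w\<close> and
  \<open>lmi_no_unstable_mode\<close> applies to the stacked mode.
\<close>

lemma lmi_controller_stabilizes:
  assumes plant: "Ap \<in> carrier_mat n n" "Bp \<in> carrier_mat n m" "Cp \<in> carrier_mat p n"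
    and stab: "stabilizable Ap Bp" and det: "detectable Cp Ap"
    and dims: "A \<in> carrier_mat k k" "BM \<in> carrier_mat k p" "BN \<in> carrier_mat k m"
      "C \<in> carrier_mat p k" "DM \<in> carrier_mat p p" "DN \<in> carrier_mat p m"
    and MG: "transfer_mat A BM C DM * transfer_mat Ap Bp Cp (0\<^sub>m p m) = transfer_mat A BN C DN"
    and vars: "lmi_vars k p m X Z Q F LX LY RX RY"
    and pd: "pos_def (lmi_mat k p 1 A BM BN C DM DN X Z Q F LX LY RX RY)"
    and V: "V \<in> carrier_mat k k" "invertible_mat V"
    and hat: "Ah \<in> carrier_mat k k" "Bh \<in> carrier_mat k p"
    and Ah: "Z * V * Ah = Q * V" and Bh: "Z * V * Bh = F"
  shows "internally_stabilizes (Ah - Bh * minv RX * (LX * V)) (- (Bh * minv RX))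
     (- (LY * V) + RY * minv RX * (LX * V)) (RY * minv RX) Ap Bp Cp"
proof -
  note vars' = lmi_varsD[OF vars]
  have DN0: "DN = 0\<^sub>m p m" by (rule zero_feedthrough[OF plant dims MG])
  have RXi: "invertible_mat RX" by (rule lmi_invertible_feedthrough[OF dims(1-5) vars pd[unfolded DN0]])
  note iR = minv_left_right[OF RXi vars'(7)]
  note iV = minv_left_right[OF V(2,1)]
  note lmi = lmi_stable[OF dims vars pd]
  note iE = minv_left_right[OF lmi(1) minus_carrier_mat[OF vars'(2)]]
  obtain L where L: "L \<in> carrier_mat n p" and Ls: "schur_stable (Ap + L * Cp)"
    using det plant unfolding detectable_def by auto
  note d = plant[THEN carrier_matD(1)] plant[THEN carrier_matD(2)] dims[THEN carrier_matD(1)] dims[THEN carrier_matD(2)]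
    vars'[THEN carrier_matD(1)] vars'[THEN carrier_matD(2)] hat[THEN carrier_matD(1)] hat[THEN carrier_matD(2)]
    V(1)[THEN carrier_matD(1)] V(1)[THEN carrier_matD(2)] iR(1)[THEN carrier_matD(1)] iR(1)[THEN carrier_matD(2)]
    L[THEN carrier_matD(1)] L[THEN carrier_matD(2)] iE(1)[THEN carrier_matD(1)] iE(1)[THEN carrier_matD(2)]
    iV(1)[THEN carrier_matD(1)] iV(1)[THEN carrier_matD(2)]
  let ?AK = "Ah - Bh * minv RX * (LX * V)" and ?BK = "- (Bh * minv RX)"
  let ?CK = "- (LY * V) + RY * minv RX * (LX * V)" and ?DK = "RY * minv RX"
  show ?thesis
  proof (rule internally_stabilizes_if_no_unstable_mode[OF plant, of ?AK k ?BK ?CK ?DK])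
    show "?AK \<in> carrier_mat k k" "?BK \<in> carrier_mat k p" "?CK \<in> carrier_mat m k" "?DK \<in> carrier_mat m p"
      by (intro carrier_matI; simp add: d)+
    fix \<mu> x \<xi> u y
    assume \<mu>: "1 \<le> cmod \<mu>" and x: "x \<in> carrier_vec n" and \<xi>: "\<xi> \<in> carrier_vec k"
      and y: "y = cmat Cp *\<^sub>v x" and u: "u = cmat ?CK *\<^sub>v \<xi> + cmat ?DK *\<^sub>v y"
      and xmode: "\<mu> \<cdot>\<^sub>v x = cmat Ap *\<^sub>v x + cmat Bp *\<^sub>v u"
      and \<xi>mode: "\<mu> \<cdot>\<^sub>v \<xi> = cmat ?AK *\<^sub>v \<xi> + cmat ?BK *\<^sub>v y"
    have yd: "dim_vec y = p" using y plant by simp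
    have ud: "dim_vec u = m" by (simp add: u d)
    \<comment> \<open>the mode in terms of the coprime factors of the controller: y = X w and u = Y w\<close>
    \<comment> \<open>the given realization of the controller has the state of \<open>(\<^bold>X, \<^bold>Y)\<close> with the opposite sign; in
      terms of \<open>w\<close> the mode is \<open>y = \<^bold>X w\<close>, \<open>u = \<^bold>Y w\<close>\<close>
    define e where "e = - \<xi>"
    define w where "w = cmat (minv RX) *\<^sub>v (y - cmat LX *\<^sub>v (cmat V *\<^sub>v e))"
    define r where "r = cmat V *\<^sub>v e"
    have ed: "dim_vec e = k" "dim_vec w = p" "dim_vec r = k" using \<xi> by (simp_all add: d e_def w_def r_def)
    have iRc: "cmat RX * cmat (minv RX) = 1\<^sub>m p"
      using arg_cong[OF iR(2), of cmat] by (simp add: d cmat_arith(4,6))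
    have y_eq: "cmat LX *\<^sub>v r + cmat RX *\<^sub>v w = y"
    proof -
      have "cmat RX *\<^sub>v w = (cmat RX * cmat (minv RX)) *\<^sub>v (y - cmat LX *\<^sub>v r)"
        unfolding w_def r_def by (simp add: d yd ed mult_vec_assoc_dim)
      also have "\<dots> = y - cmat LX *\<^sub>v r" unfolding iRc by (intro one_mult_mat_vec carrier_vecI) (simp add: d yd ed)
      finally show ?thesis by (intro eq_vecI) (simp_all add: d yd ed del: index_mult_mat_vec)
    qed
    have u_eq: "cmat LY *\<^sub>v r + cmat RY *\<^sub>v w = u"
      unfolding u w_def r_def e_def using \<xi>
      by (intro eq_vecI) (simp_all add: d yd cmat_arith mat_vec_expand del: index_mult_mat_vec)
    have e_mode: "\<mu> \<cdot>\<^sub>v e = cmat Ah *\<^sub>v e + cmat Bh *\<^sub>v w"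
    proof -
      have "\<mu> \<cdot>\<^sub>v e = - (\<mu> \<cdot>\<^sub>v \<xi>)" unfolding e_def by (intro eq_vecI) auto
      then show ?thesis
        unfolding \<xi>mode w_def e_def using \<xi>
        by (intro eq_vecI) (simp_all add: d yd cmat_arith mat_vec_expand del: index_mult_mat_vec)
    qed
    have mode2: "\<mu> \<cdot>\<^sub>v (cmat Z *\<^sub>v r) = cmat Q *\<^sub>v r + cmat F *\<^sub>v w"
    proof -
      have "\<mu> \<cdot>\<^sub>v (cmat Z *\<^sub>v r) = cmat Z *\<^sub>v (cmat V *\<^sub>v (\<mu> \<cdot>\<^sub>v e))"
        unfolding r_def by (simp add: d ed mat_vec_smult_dim)
      also have "\<dots> = cmat (Z * V * Ah) *\<^sub>v e + cmat (Z * V * Bh) *\<^sub>v w"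
        unfolding e_mode by (simp add: d ed cmat_arith mat_vec_expand)
      also have "\<dots> = cmat Q *\<^sub>v r + cmat F *\<^sub>v w"
        unfolding Ah Bh r_def by (simp add: d ed cmat_arith mat_vec_expand)
      finally show ?thesis .
    qed
    \<comment> \<open>the state of the realization of the left factors, driven by this mode\<close>
    have ne: "\<not> eigenvalue (cmat A) \<mu>" using lmi(3) \<mu> unfolding schur_stable_def by auto
    have Rc: "\<mu> \<cdot>\<^sub>m 1\<^sub>m k - cmat A \<in> carrier_mat k k" using dims by auto
    note iRes = minv_left_right[OF resolvent_value(1)[OF dims(1) ne] Rc]
    define g where "g = cmat BM *\<^sub>v y - cmat BN *\<^sub>v u"
    define xM where "xM = minv (\<mu> \<cdot>\<^sub>m 1\<^sub>m k - cmat A) *\<^sub>v g"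
    have gd: "g \<in> carrier_vec k" and xMd: "dim_vec xM = k"
      using iRes(1) by (auto simp: d g_def xM_def intro: carrier_vecI)
    have xM: "\<mu> \<cdot>\<^sub>v xM = cmat A *\<^sub>v xM + cmat BM *\<^sub>v y - cmat BN *\<^sub>v u"
    proof -
      have "(\<mu> \<cdot>\<^sub>m 1\<^sub>m k - cmat A) *\<^sub>v xM = g"
        unfolding xM_def by (rule mult_minv_vec[OF resolvent_value(1)[OF dims(1) ne] Rc gd])
      moreover have "(\<mu> \<cdot>\<^sub>m 1\<^sub>m k - cmat A) *\<^sub>v xM = \<mu> \<cdot>\<^sub>v xM - cmat A *\<^sub>v xM"
        by (simp add: d xMd mat_vec_expand one_mult_mat_vec[OF carrier_vecI])
      ultimately have "\<mu> \<cdot>\<^sub>v xM - cmat A *\<^sub>v xM = cmat BM *\<^sub>v y - cmat BN *\<^sub>v u" by (simp add: g_def)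
      then show ?thesis by (auto simp: d xMd vec_eq_iff algebra_simps simp del: index_mult_mat_vec)
    qed
    have out: "cmat C *\<^sub>v xM + cmat DM *\<^sub>v y - cmat DN *\<^sub>v u = 0\<^sub>v p"
    proof -
      let ?R = "minv (\<mu> \<cdot>\<^sub>m 1\<^sub>m k - cmat A)"
      have "(cmat C * ?R * cmat BM + cmat DM) *\<^sub>v (cmat Cp *\<^sub>v x) = (cmat C * ?R * cmat BN + cmat DN) *\<^sub>v u"
        using ud by (intro coprime_factor_annihilates_modes[OF plant stab _ _ MG
              transfer_mat_value[OF dims(1,2,4,5) ne] transfer_mat_value[OF dims(1,3,4,6) ne] \<mu> x _ xmode]
             transfer_mat_carrier[OF dims(1,2,4,5)] transfer_mat_carrier[OF dims(1,3,4,6)] carrier_vecI) auto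
      then have "cmat C *\<^sub>v (?R *\<^sub>v (cmat BM *\<^sub>v y)) + cmat DM *\<^sub>v y = cmat C *\<^sub>v (?R *\<^sub>v (cmat BN *\<^sub>v u)) + cmat DN *\<^sub>v u"
        unfolding y[symmetric] using iRes(1) by (simp add: d yd ud mat_vec_expand)
      moreover have "cmat C *\<^sub>v xM = cmat C *\<^sub>v (?R *\<^sub>v (cmat BM *\<^sub>v y)) - cmat C *\<^sub>v (?R *\<^sub>v (cmat BN *\<^sub>v u))"
        unfolding xM_def g_def using iRes(1) by (simp add: d yd ud mat_vec_expand)
      ultimately show ?thesis by (intro vec_balance(1)[of _ p]) (simp_all add: d)
    qed
    \<comment> \<open>the solution of \<open>P b = (x\<^sub>M, Z r)\<close>\<close>
    define b1 where "b1 = cmat (minv (X - Z)) *\<^sub>v (xM - cmat Z *\<^sub>v r)"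
    define b2 where "b2 = r - b1"
    have bd: "b1 \<in> carrier_vec k" "b2 \<in> carrier_vec k" by (auto simp: d ed b1_def b2_def intro: carrier_vecI)
    have sum: "b1 + b2 = r" using bd(1) ed by (intro eq_vecI) (auto simp: b2_def)
    have state: "cmat X *\<^sub>v b1 + cmat Z *\<^sub>v b2 = xM"
    proof -
      have "cmat (X - Z) * cmat (minv (X - Z)) = 1\<^sub>m k"
        using arg_cong[OF iE(2), of cmat] by (simp add: d cmat_arith(4,6))
      then have "cmat (X - Z) *\<^sub>v b1 = xM - cmat Z *\<^sub>v r"
        unfolding b1_def using mult_vec_assoc_dim[of "cmat (X - Z)" "cmat (minv (X - Z))" "xM - cmat Z *\<^sub>v r"]
        by (simp add: d ed xMd one_mult_mat_vec[OF carrier_vecI])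
      then have "cmat X *\<^sub>v b1 - cmat Z *\<^sub>v b1 = xM - cmat Z *\<^sub>v r" using bd by (simp add: d cmat_arith mat_vec_expand)
      moreover have "cmat Z *\<^sub>v b2 = cmat Z *\<^sub>v r - cmat Z *\<^sub>v b1" unfolding b2_def using bd by (simp add: d ed mat_vec_expand)
      ultimately show ?thesis by (intro vec_balance(2)[of _ k]) (simp_all add: d xMd)
    qed
    have "b1 = 0\<^sub>v k \<and> b2 = 0\<^sub>v k \<and> w = 0\<^sub>v p"
    proof (rule lmi_no_unstable_mode[OF dims vars pd bd _ _ _ _ _ refl _ \<mu>, unfolded sum state, OF _ y_eq[symmetric] u_eq[symmetric]])
      show "w \<in> carrier_vec p" using ed by (intro carrier_vecI)
      show "\<mu> \<cdot>\<^sub>v xM = cmat A *\<^sub>v xM + cmat BM *\<^sub>v y - cmat BN *\<^sub>v u" by (rule xM)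
      show "\<mu> \<cdot>\<^sub>v (cmat Z *\<^sub>v r) = cmat Q *\<^sub>v r + cmat F *\<^sub>v w" by (rule mode2)
      show "cmat C *\<^sub>v xM + cmat DM *\<^sub>v y - cmat DN *\<^sub>v u - w = - w \<or> w = 0\<^sub>v p"
        unfolding out by (auto simp: ed)
    qed
    then have b0: "b1 = 0\<^sub>v k" "b2 = 0\<^sub>v k" and w0: "w = 0\<^sub>v p" by auto
    have r0: "r = 0\<^sub>v k" unfolding sum[symmetric] b0 by simp
    have e0: "e = 0\<^sub>v k"
    proof -
      have "cmat (minv V) * cmat V = 1\<^sub>m k" using arg_cong[OF iV(3), of cmat] by (simp add: d cmat_arith(4,6))
      then have "e = cmat (minv V) *\<^sub>v r"
        unfolding r_def using mult_vec_assoc_dim[of "cmat (minv V)" "cmat V" e]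
        by (simp add: d ed one_mult_mat_vec[OF carrier_vecI])
      then show ?thesis unfolding r0 by (simp add: d mat_vec_zero_dim)
    qed
    have \<xi>0: "\<xi> = 0\<^sub>v k" using e0 \<xi> unfolding e_def by (auto simp: vec_eq_iff)
    have yu0: "y = 0\<^sub>v p" "u = 0\<^sub>v m" unfolding y_eq[symmetric] u_eq[symmetric] r0 w0 by (simp_all add: d mat_vec_zero_dim)
    have "cmat (Ap + L * Cp) *\<^sub>v x = \<mu> \<cdot>\<^sub>v x"
    proof -
      have "cmat (Ap + L * Cp) *\<^sub>v x = cmat Ap *\<^sub>v x + cmat L *\<^sub>v y" unfolding y using x by (simp add: d cmat_arith mat_vec_expand)
      then show ?thesis unfolding xmode yu0 by (simp add: d mat_vec_zero_dim)
    qed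
    then have "x = 0\<^sub>v n" using L plant x by (intro schur_stable_no_eigenvector[OF Ls _ x _ \<mu>]) auto
    then show "x = 0\<^sub>v n \<and> \<xi> = 0\<^sub>v k" using \<xi>0 by simp
  qed
qed

section \<open>Solving the linear matrix inequality\<close>

lemma symmetric_swap:
  fixes M :: "real mat"
  assumes "M\<^sup>T = M" "dim_row M = dim_vec v" "dim_col M = dim_vec w"
  shows "v \<bullet> (M *\<^sub>v w) = w \<bullet> (M *\<^sub>v v)"
  using transpose_scalar_dim[of M v w] assms by simp

lemma symmetric_matI_bilinear:
  fixes M :: "real mat"
  assumes M: "M \<in> carrier_mat n n"
    and sym: "\<And>v w. v \<in> carrier_vec n \<Longrightarrow> w \<in> carrier_vec n \<Longrightarrow> v \<bullet> (M *\<^sub>v w) = w \<bullet> (M *\<^sub>v v)"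
  shows "symmetric_mat M"
proof -
  have entry: "M $$ (i, j) = unit_vec n i \<bullet> (M *\<^sub>v unit_vec n j)" if "i < n" "j < n" for i j
  proof -
    have "unit_vec n i \<bullet> (M *\<^sub>v unit_vec n j) = (M *\<^sub>v unit_vec n j) $ i"
      using that M by (intro scalar_prod_left_unit carrier_vecI) auto
    also have "\<dots> = row M i $ j"
      using that M scalar_prod_right_unit[of j n "row M i"] by simp
    finally show ?thesis using that M by simp
  qed
  show ?thesis unfolding symmetric_mat_def
  proof (rule eq_matI)
    fix i j assume "i < dim_row M" "j < dim_col M"
    then have ij: "i < n" "j < n" using M by auto
    show "M\<^sup>T $$ (i, j) = M $$ (i, j)"
      using ij M entry[OF ij] entry[OF ij(2,1)] sym[of "unit_vec n i" "unit_vec n j"] by simp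
  qed (use M in auto)
qed

lemma six_block_vec:
  fixes v :: "'a vec"
  assumes "v \<in> carrier_vec (k + (k + (k + (k + (p + p)))))"
  obtains v1 v2 v3 v4 v5 v6 where "v = v1 @\<^sub>v v2 @\<^sub>v v3 @\<^sub>v v4 @\<^sub>v v5 @\<^sub>v v6"
    "v1 \<in> carrier_vec k" "v2 \<in> carrier_vec k" "v3 \<in> carrier_vec k" "v4 \<in> carrier_vec k"
    "v5 \<in> carrier_vec p" "v6 \<in> carrier_vec p"
proof -
  have split: "\<exists>a b. u = a @\<^sub>v b \<and> a \<in> carrier_vec i \<and> b \<in> carrier_vec j"
    if "u \<in> carrier_vec (i + j)" for u :: "'a vec" and i j
    using vec_first_last_append[OF that] vec_first_carrier vec_last_carrier by metis
  from split[OF assms] obtain v1 r1 where 1: "v = v1 @\<^sub>v r1" "v1 \<in> carrier_vec k" "r1 \<in> carrier_vec (k + (k + (k + (p + p))))" by blast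
  from split[OF 1(3)] obtain v2 r2 where 2: "r1 = v2 @\<^sub>v r2" "v2 \<in> carrier_vec k" "r2 \<in> carrier_vec (k + (k + (p + p)))" by blast
  from split[OF 2(3)] obtain v3 r3 where 3: "r2 = v3 @\<^sub>v r3" "v3 \<in> carrier_vec k" "r3 \<in> carrier_vec (k + (p + p))" by blast
  from split[OF 3(3)] obtain v4 r4 where 4: "r3 = v4 @\<^sub>v r4" "v4 \<in> carrier_vec k" "r4 \<in> carrier_vec (p + p)" by blast
  from split[OF 4(3)] obtain v5 v6 where 5: "r4 = v5 @\<^sub>v v6" "v5 \<in> carrier_vec p" "v6 \<in> carrier_vec p" by blast
  show thesis by (rule that[OF _ 1(2) 2(2) 3(2) 4(2) 5(2,3)]) (simp add: 1(1) 2(1) 3(1) 4(1) 5(1))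
qed

lemma lmi_mat_symmetric:
  assumes dims: "A \<in> carrier_mat k k" "BM \<in> carrier_mat k p" "BN \<in> carrier_mat k m"
      "C \<in> carrier_mat p k" "DM \<in> carrier_mat p p" "DN \<in> carrier_mat p m"
    and vars: "lmi_vars k p m X Z Q F LX LY RX RY"
  shows "symmetric_mat (lmi_mat k p e A BM BN C DM DN X Z Q F LX LY RX RY)"
proof (rule symmetric_matI_bilinear)
  have vars': "X \<in> carrier_mat k k" "X\<^sup>T = X" "Z \<in> carrier_mat k k" "Z\<^sup>T = Z"
    using vars by (auto simp: lmi_vars_def symmetric_mat_def)
  have z: "0\<^sub>v k \<in> carrier_vec k" "0\<^sub>v p \<in> carrier_vec p" by auto
  let ?M = "lmi_mat k p e A BM BN C DM DN X Z Q F LX LY RX RY"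
  show "?M \<in> carrier_mat (k + (k + (k + (k + (p + p))))) (k + (k + (k + (k + (p + p)))))"
    by (rule lmi_mat_bilinear(1)[OF dims vars z(1) z(1) z(1) z(1) z(2) z(2) z(1) z(1) z(1) z(1) z(2) z(2)])
  fix v w :: "real vec"
  assume "v \<in> carrier_vec (k + (k + (k + (k + (p + p)))))" "w \<in> carrier_vec (k + (k + (k + (k + (p + p)))))"
  from six_block_vec[OF this(1)] six_block_vec[OF this(2)] obtain v1 v2 v3 v4 v5 v6 w1 w2 w3 w4 w5 w6
    where vw: "v = v1 @\<^sub>v v2 @\<^sub>v v3 @\<^sub>v v4 @\<^sub>v v5 @\<^sub>v v6" "w = w1 @\<^sub>v w2 @\<^sub>v w3 @\<^sub>v w4 @\<^sub>v w5 @\<^sub>v w6"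
    and v: "v1 \<in> carrier_vec k" "v2 \<in> carrier_vec k" "v3 \<in> carrier_vec k" "v4 \<in> carrier_vec k"
      "v5 \<in> carrier_vec p" "v6 \<in> carrier_vec p"
    and w: "w1 \<in> carrier_vec k" "w2 \<in> carrier_vec k" "w3 \<in> carrier_vec k" "w4 \<in> carrier_vec k"
      "w5 \<in> carrier_vec p" "w6 \<in> carrier_vec p" by metis
  have block: "a \<bullet> (X *\<^sub>v c + Z *\<^sub>v e) + b \<bullet> (Z *\<^sub>v c + Z *\<^sub>v e) = c \<bullet> (X *\<^sub>v a + Z *\<^sub>v b) + e \<bullet> (Z *\<^sub>v a + Z *\<^sub>v b)"
    if "a \<in> carrier_vec k" "b \<in> carrier_vec k" "c \<in> carrier_vec k" "e \<in> carrier_vec k" for a b c e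
    using that vars' symmetric_swap[OF vars'(2), of a c] symmetric_swap[OF vars'(4), of a e]
      symmetric_swap[OF vars'(4), of b c] symmetric_swap[OF vars'(4), of b e]
    by (simp add: scalar_prod_distrib_dim)
  show "v \<bullet> (?M *\<^sub>v w) = w \<bullet> (?M *\<^sub>v v)"
    unfolding vw lmi_mat_bilinear(2)[OF dims vars v w] lmi_mat_bilinear(2)[OF dims vars w v]
    using block[OF v(1,2) w(1,2)] block[OF v(3,4) w(3,4)] comm_scalar_prod[OF v(5) w(5)]
      arg_cong[OF comm_scalar_prod[OF v(6) w(6)], of "\<lambda>x. e\<^sup>2 * x"]
    by linarith
qed

text \<open>
  For such a \<open>w\<close> let \<open>h = D\<^sub>M\<^sup>-\<^sup>T B\<^sub>M\<^sup>T w\<close>. The eigenvector equation becomes \<open>w = - (\<mu> I - A)\<^sup>-\<^sup>T C\<^sup>T h\<close>, from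
  which \<open>M\<^sub>l(\<mu>)\<^sup>T h = 0\<close> and \<open>N\<^sub>l(\<mu>)\<^sup>T h = 0\<close>. The Bezout identity at \<open>\<mu>\<close> gives \<open>h = 0\<close>, hence \<open>w = 0\<close>.
\<close>

lemma bezout_hautus:
  assumes dims: "A \<in> carrier_mat k k" "BM \<in> carrier_mat k p" "BN \<in> carrier_mat k m"
      "C \<in> carrier_mat p k" "DM \<in> carrier_mat p p"
    and stable: "schur_stable A" and DM: "invertible_mat DM"
    and U: "U \<in> RH_inf p p" and V: "V \<in> RH_inf m p"
    and bezout: "transfer_mat A BM C DM * U - transfer_mat A BN C (0\<^sub>m p m) * V = 1\<^sub>m p"
    and w: "w \<in> carrier_vec k" and \<mu>: "1 \<le> cmod \<mu>"
    and left: "(cmat (A - BM * minv DM * C))\<^sup>T *\<^sub>v w = \<mu> \<cdot>\<^sub>v w" and BN0: "(cmat BN)\<^sup>T *\<^sub>v w = 0\<^sub>v m"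
  shows "w = 0\<^sub>v k"
proof -
  note iD = minv_left_right[OF DM dims(5)]
  have ne: "\<not> eigenvalue (cmat A) \<mu>" using stable \<mu> unfolding schur_stable_def by auto
  have Rc: "\<mu> \<cdot>\<^sub>m 1\<^sub>m k - cmat A \<in> carrier_mat k k" using dims by auto
  note iR = minv_left_right[OF resolvent_value(1)[OF dims(1) ne] Rc]
  let ?R = "minv (\<mu> \<cdot>\<^sub>m 1\<^sub>m k - cmat A)"
  let ?Mv = "cmat C * ?R * cmat BM + cmat DM" and ?Nv = "cmat C * ?R * cmat BN + cmat (0\<^sub>m p m)"
  note gen = generic_filter_at
  have "at \<mu> = at_infinity \<or> (\<exists>\<nu>. 1 \<le> cmod \<nu> \<and> at \<mu> = at \<nu>)" using \<mu> by blast
  then obtain Uv Vv where Uv: "Uv \<in> carrier_mat p p" "mat_has_value (at \<mu>) U Uv"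
    and Vv: "Vv \<in> carrier_mat m p" "mat_has_value (at \<mu>) V Vv"
    using RH_inf_value[OF U] RH_inf_value[OF V] by blast
  note d = dims[THEN carrier_matD(1)] dims[THEN carrier_matD(2)] iD(1)[THEN carrier_matD(1)] iD(1)[THEN carrier_matD(2)]
    iR(1)[THEN carrier_matD(1)] iR(1)[THEN carrier_matD(2)] Uv(1)[THEN carrier_matD(1)] Uv(1)[THEN carrier_matD(2)]
    Vv(1)[THEN carrier_matD(1)] Vv(1)[THEN carrier_matD(2)]
  have wd: "dim_vec w = k" using w by auto
  have one: "?Mv * Uv - ?Nv * Vv = 1\<^sub>m p"
  proof (rule mat_has_value_unique[OF gen _ mat_has_value_one])
    show "mat_has_value (at \<mu>) (1\<^sub>m p) (?Mv * Uv - ?Nv * Vv)"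
      unfolding bezout[symmetric]
      by (intro mat_has_value_add mat_has_value_mult gen Uv(2) Vv(2) transfer_mat_value[OF dims(1,2,4,5) ne]
          transfer_mat_value[OF dims(1,3,4) zero_carrier_mat ne]) (simp_all add: d)
  qed
  define h where "h = (cmat (minv DM))\<^sup>T *\<^sub>v ((cmat BM)\<^sup>T *\<^sub>v w)"
  have hd: "dim_vec h = p" by (simp add: h_def d)
  have w_eq: "w = - (?R\<^sup>T *\<^sub>v ((cmat C)\<^sup>T *\<^sub>v h))"
  proof -
    have "(cmat A)\<^sup>T *\<^sub>v w - (cmat C)\<^sup>T *\<^sub>v h = \<mu> \<cdot>\<^sub>v w"
      unfolding left[symmetric] h_def
      by (simp add: d wd cmat_arith transpose_arith_dim transpose_mult_dim mat_vec_expand)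
    moreover have smult: "(\<mu> \<cdot>\<^sub>m 1\<^sub>m k)\<^sup>T *\<^sub>v w = \<mu> \<cdot>\<^sub>v w"
    proof -
      have "(\<mu> \<cdot>\<^sub>m 1\<^sub>m k)\<^sup>T = \<mu> \<cdot>\<^sub>m 1\<^sub>m k" by (intro eq_matI) auto
      then show ?thesis using w by (simp add: wd mat_vec_smult_dim)
    qed
    ultimately have "(\<mu> \<cdot>\<^sub>m 1\<^sub>m k - cmat A)\<^sup>T *\<^sub>v w = - ((cmat C)\<^sup>T *\<^sub>v h)"
      by (auto simp: d wd hd smult transpose_arith_dim mat_vec_expand vec_eq_iff algebra_simps simp del: index_mult_mat_vec)
    then have "?R\<^sup>T *\<^sub>v ((\<mu> \<cdot>\<^sub>m 1\<^sub>m k - cmat A)\<^sup>T *\<^sub>v w) = - (?R\<^sup>T *\<^sub>v ((cmat C)\<^sup>T *\<^sub>v h))"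
      by (simp add: d hd mat_vec_expand)
    moreover have "?R\<^sup>T *\<^sub>v ((\<mu> \<cdot>\<^sub>m 1\<^sub>m k - cmat A)\<^sup>T *\<^sub>v w) = ((\<mu> \<cdot>\<^sub>m 1\<^sub>m k - cmat A) * ?R)\<^sup>T *\<^sub>v w"
      by (subst transpose_mult_dim) (simp_all add: d wd mult_vec_assoc_dim)
    ultimately show ?thesis unfolding iR(2) using w by simp
  qed
  have Mh: "?Mv\<^sup>T *\<^sub>v h = 0\<^sub>v p"
  proof -
    have "?Mv\<^sup>T *\<^sub>v h = (cmat BM)\<^sup>T *\<^sub>v (?R\<^sup>T *\<^sub>v ((cmat C)\<^sup>T *\<^sub>v h)) + (cmat DM)\<^sup>T *\<^sub>v h"
      by (simp add: d hd transpose_arith_dim transpose_mult_dim mat_vec_expand)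
    also have "?R\<^sup>T *\<^sub>v ((cmat C)\<^sup>T *\<^sub>v h) = - w" unfolding w_eq by simp
    also have "(cmat DM)\<^sup>T *\<^sub>v h = (cmat (minv DM * DM))\<^sup>T *\<^sub>v ((cmat BM)\<^sup>T *\<^sub>v w)"
      unfolding h_def by (simp add: d wd cmat_arith transpose_mult_dim mat_vec_expand)
    also have "\<dots> = (cmat BM)\<^sup>T *\<^sub>v w" unfolding iD(3) by (simp add: cmat_arith(6) one_mult_mat_vec[OF carrier_vecI] d)
    finally have "?Mv\<^sup>T *\<^sub>v h = (cmat BM)\<^sup>T *\<^sub>v (- w) + (cmat BM)\<^sup>T *\<^sub>v w" .
    also have "\<dots> = 0\<^sub>v p" by (intro eq_vecI) (simp_all add: d wd mat_vec_expand del: index_mult_mat_vec)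
    finally show ?thesis .
  qed
  have Nh: "?Nv\<^sup>T *\<^sub>v h = 0\<^sub>v m"
  proof -
    have "?Nv\<^sup>T *\<^sub>v h = (cmat BN)\<^sup>T *\<^sub>v (?R\<^sup>T *\<^sub>v ((cmat C)\<^sup>T *\<^sub>v h))"
      by (simp add: d hd cmat_arith(7) transpose_arith_dim transpose_mult_dim mat_vec_expand right_zero_vec[OF carrier_vecI])
    also have "?R\<^sup>T *\<^sub>v ((cmat C)\<^sup>T *\<^sub>v h) = - w" unfolding w_eq by simp
    also have "(cmat BN)\<^sup>T *\<^sub>v (- w) = 0\<^sub>v m" using BN0 by (simp add: d wd mat_vec_expand)
    finally show ?thesis .
  qed
  have "h = (?Mv * Uv - ?Nv * Vv)\<^sup>T *\<^sub>v h" unfolding one using hd by (simp add: one_mult_mat_vec[OF carrier_vecI])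
  also have "\<dots> = Uv\<^sup>T *\<^sub>v (?Mv\<^sup>T *\<^sub>v h) - Vv\<^sup>T *\<^sub>v (?Nv\<^sup>T *\<^sub>v h)"
    by (simp add: d hd transpose_arith_dim(2) transpose_mult_dim[of ?Mv] transpose_mult_dim[of ?Nv] mult_vec_assoc_dim mat_vec_distrib_dim(2))
  also have "\<dots> = 0\<^sub>v p" unfolding Mh Nh by (simp add: d mat_vec_zero_dim)
  finally have "h = 0\<^sub>v p" .
  then show ?thesis unfolding w_eq using mat_vec_zero_dim(1)[of "(cmat C)\<^sup>T" p] by (simp add: d mat_vec_zero_dim)
qed

text \<open>
  The solution comes from the pair \<open>(\<^bold>X, \<^bold>Y)\<close> with state \<open>\<xi>\<close> and outputs \<open>D\<^sub>M\<^sup>-\<^sup>1 (w - C \<xi>)\<close> and \<open>L Z\<^sup>-\<^sup>1 \<xi>\<close>, where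
  \<open>\<xi>\<close> reproduces the state \<open>x\<close> of the left factors. The error is \<open>C (x - \<xi>)\<close>, and \<open>x - \<xi>\<close> evolves
  autonomously with \<open>A\<close>. Therefore \<open>X = Z + E\<close>, with \<open>E\<close> for \<open>x - \<xi>\<close> and \<open>Z\<close> for \<open>\<xi>\<close>. In the variables
  \<open>v\<^sub>1 + v\<^sub>2\<close> and \<open>v\<^sub>3 + v\<^sub>4\<close> the form splits: one summand is that of a steering solution for
  \<open>(A - B\<^sub>M D\<^sub>M\<^sup>-\<^sup>1 C, - B\<^sub>N)\<close>. The other one, for \<open>P = E\<^sup>-\<^sup>1\<close>, \<open>\<sigma> = E v\<^sub>3\<close> and \<open>\<tau> = E v\<^sub>1\<close>, is that of a steering
  solution for \<open>A\<^sup>T\<close> and \<open>C\<^sup>T\<close> without input.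
\<close>

lemma lmi_feasible:
  assumes dims: "A \<in> carrier_mat k k" "BM \<in> carrier_mat k p" "BN \<in> carrier_mat k m"
      "C \<in> carrier_mat p k" "DM \<in> carrier_mat p p"
    and stable: "schur_stable A"
    and U: "U \<in> RH_inf p p" and V: "V \<in> RH_inf m p"
    and bezout: "transfer_mat A BM C DM * U - transfer_mat A BN C (0\<^sub>m p m) * V = 1\<^sub>m p"
  shows "\<exists>X Z Q F LX LY RX RY. lmi_vars k p m X Z Q F LX LY RX RY \<and>
    pos_def (lmi_mat k p 1 A BM BN C DM (0\<^sub>m p m) X Z Q F LX LY RX RY)"
proof -
  \<comment> \<open>at infinity the Bezout identity reads \<open>D\<^sub>M U = I\<close>\<close>
  have DM: "invertible_mat DM"
  proof -
    note gen = generic_filter_at_infinity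
    obtain Uv Vv where Uv: "Uv \<in> carrier_mat p p" "mat_has_value at_infinity U Uv"
      and Vv: "Vv \<in> carrier_mat m p" "mat_has_value at_infinity V Vv"
      using RH_inf_value[OF U] RH_inf_value[OF V] by blast
    have "cmat DM * Uv - cmat (0\<^sub>m p m) * Vv = 1\<^sub>m p"
    proof (rule mat_has_value_unique[OF gen _ mat_has_value_one])
      show "mat_has_value at_infinity (1\<^sub>m p) (cmat DM * Uv - cmat (0\<^sub>m p m) * Vv)"
        unfolding bezout[symmetric] using Uv(1) Vv(1) dims
        by (intro mat_has_value_add mat_has_value_mult gen Uv(2) Vv(2) transfer_mat_value_infinity[OF dims(1,2,4,5)]
            transfer_mat_value_infinity[OF dims(1,3,4) zero_carrier_mat]) simp_all
    qed
    moreover have "cmat DM * Uv - cmat (0\<^sub>m p m) * Vv = cmat DM * Uv"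
      using Uv(1) Vv(1) dims by (simp add: cmat_arith(7)) (auto intro!: eq_matI)
    ultimately have "cmat DM * Uv = 1\<^sub>m p" by simp
    then have "map_mat Re (cmat DM * Uv) = 1\<^sub>m p" by (auto intro!: eq_matI)
    moreover have "map_mat Re (cmat DM * Uv) = DM * map_mat Re Uv"
      using dims Uv(1) by (intro eq_matI) (auto simp: scalar_prod_def)
    ultimately show ?thesis using Uv(1) by (intro invertible_matI[OF dims(5), of "map_mat Re Uv"]) auto
  qed
  note iD = minv_left_right[OF DM dims(5)]
  define Ax where "Ax = A - BM * minv DM * C"
  define F where "F = BM * minv DM"
  have Ax: "Ax \<in> carrier_mat k k" and F: "F \<in> carrier_mat k p" and BN': "- BN \<in> carrier_mat k m"
    using dims iD(1) by (auto simp: Ax_def F_def)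
  have haut: "w = 0\<^sub>v k" if w: "w \<in> carrier_vec k" "1 \<le> cmod \<mu>" "(cmat Ax)\<^sup>T *\<^sub>v w = \<mu> \<cdot>\<^sub>v w"
    "(cmat (- BN))\<^sup>T *\<^sub>v w = 0\<^sub>v m" for \<mu> w
  proof (rule bezout_hautus[OF dims stable DM U V bezout w(1,2) w(3)[unfolded Ax_def]])
    have "(cmat (- BN))\<^sup>T = - (cmat BN)\<^sup>T" by (intro eq_matI) auto
    then have "- ((cmat BN)\<^sup>T *\<^sub>v w) = 0\<^sub>v m" using w(1,4) dims(3) by (simp add: mat_vec_expand)
    then show "(cmat BN)\<^sup>T *\<^sub>v w = 0\<^sub>v m" by (metis uminus_uminus_vec uminus_zero_vec)
  qed
  obtain Z L where Z: "Z \<in> carrier_mat k k" and L: "L \<in> carrier_mat m k"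
    and sol: "steering_solution k p Ax (- BN) F Z L"
    using hautus_lmi[OF Ax BN' F] haut by blast
  note Zsym = sol[unfolded steering_solution_def, THEN conjunct1]
    and form2 = sol[unfolded steering_solution_def, THEN conjunct2, rule_format]
  have obs: "w = 0\<^sub>v k" if "w \<in> carrier_vec k" "1 \<le> cmod \<mu>" "(cmat (A\<^sup>T))\<^sup>T *\<^sub>v w = \<mu> \<cdot>\<^sub>v w" for \<mu> w
    by (rule schur_stable_no_eigenvector[OF stable dims(1) that(1) that(3)[unfolded cmat_arith(5) transpose_transpose] that(2)])
  obtain P L0 where P0: "P \<in> carrier_mat k k" and L0: "L0 \<in> carrier_mat 0 k"
    and sol': "steering_solution k p A\<^sup>T (0\<^sub>m k 0) C\<^sup>T P L0"
    using hautus_lmi[of "A\<^sup>T" k "0\<^sub>m k 0" 0 "C\<^sup>T" p] dims obs by auto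
  have P: "P \<in> carrier_mat k k" "P\<^sup>T = P" using P0 sol' unfolding steering_solution_def by auto
  have no_input: "A\<^sup>T *\<^sub>v (P *\<^sub>v t) + 0\<^sub>m k 0 *\<^sub>v (L0 *\<^sub>v t) = A\<^sup>T *\<^sub>v (P *\<^sub>v t)" if "t \<in> carrier_vec k" for t
    using that L0 dims by (simp add: mat_vec_zero_dim right_zero_vec[OF carrier_vecI])
  have form1: "0 < s \<bullet> (P *\<^sub>v s) + 2 * (s \<bullet> (A\<^sup>T *\<^sub>v (P *\<^sub>v t))) + t \<bullet> (P *\<^sub>v t) + 2 * (s \<bullet> (C\<^sup>T *\<^sub>v v)) + v \<bullet> v"
    if "s \<in> carrier_vec k" "t \<in> carrier_vec k" "v \<in> carrier_vec p" "\<not> (s = 0\<^sub>v k \<and> t = 0\<^sub>v k \<and> v = 0\<^sub>v p)" for s t v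
    by (rule sol'[unfolded steering_solution_def, THEN conjunct2, rule_format, OF that, unfolded no_input[OF that(2)]])
  have Pi: "invertible_mat P"
  proof (rule invertible_mat_no_kernel[OF P(1)])
    fix v assume v: "v \<in> carrier_vec k" "P *\<^sub>v v = 0\<^sub>v k"
    show "v = 0\<^sub>v k"
    proof (rule ccontr)
      assume "v \<noteq> 0\<^sub>v k"
      from form1[OF v(1) zero_carrier_vec zero_carrier_vec] this show False
        using v P dims by (simp add: mat_vec_zero_dim scalar_prod_zero_dim)
    qed
  qed
  note iP = minv_left_right[OF Pi P(1)]
  define E where "E = minv P"
  have E: "E \<in> carrier_mat k k" using iP(1) by (simp add: E_def)
  have Esym: "E\<^sup>T = E"
  proof -
    have "P * E\<^sup>T = (E * P)\<^sup>T" using E P by (simp add: transpose_mult_dim)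
    then have "P * E\<^sup>T = 1\<^sub>m k" using iP(3) by (simp add: E_def)
    from minv_eqI[OF P(1) _ this] E show ?thesis by (simp add: E_def)
  qed
  define X where "X = Z + E"
  define Q where "Q = Ax * Z - BN * L"
  define LX where "LX = - (minv DM * C * Z)"
  note d = dims[THEN carrier_matD(1)] dims[THEN carrier_matD(2)] iD(1)[THEN carrier_matD(1)] iD(1)[THEN carrier_matD(2)]
    Z[THEN carrier_matD(1)] Z[THEN carrier_matD(2)] L[THEN carrier_matD(1)] L[THEN carrier_matD(2)]
    E[THEN carrier_matD(1)] E[THEN carrier_matD(2)] P(1)[THEN carrier_matD(1)] P(1)[THEN carrier_matD(2)]
    Ax[THEN carrier_matD(1)] Ax[THEN carrier_matD(2)] F[THEN carrier_matD(1)] F[THEN carrier_matD(2)]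
  have LXd: "dim_row LX = p" "dim_col LX = k" by (simp_all add: LX_def d)
  have vars: "lmi_vars k p m X Z Q F LX L (minv DM) (0\<^sub>m m p)"
    unfolding lmi_vars_def symmetric_mat_def
    by (auto intro!: carrier_matI simp: d LXd X_def Q_def transpose_arith_dim Zsym Esym)
  let ?M = "lmi_mat k p 1 A BM BN C DM (0\<^sub>m p m) X Z Q F LX L (minv DM) (0\<^sub>m m p)"
  have "pos_def ?M" unfolding pos_def_def
  proof (intro conjI ballI impI)
    show "symmetric_mat ?M" by (rule lmi_mat_symmetric[OF dims zero_carrier_mat vars])
    have z: "0\<^sub>v k \<in> carrier_vec k" "0\<^sub>v p \<in> carrier_vec p" by auto
    have Mc: "dim_row ?M = k + (k + (k + (k + (p + p))))"
      using lmi_mat_bilinear(1)[OF dims zero_carrier_mat vars z(1) z(1) z(1) z(1) z(2) z(2) z(1) z(1) z(1) z(1) z(2) z(2)] by auto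
    fix v :: "real vec" assume v: "v \<in> carrier_vec (dim_row ?M)" "v \<noteq> 0\<^sub>v (dim_row ?M)"
    obtain v1 v2 v3 v4 v5 v6 where vv: "v = v1 @\<^sub>v v2 @\<^sub>v v3 @\<^sub>v v4 @\<^sub>v v5 @\<^sub>v v6"
      and car: "v1 \<in> carrier_vec k" "v2 \<in> carrier_vec k" "v3 \<in> carrier_vec k" "v4 \<in> carrier_vec k"
        "v5 \<in> carrier_vec p" "v6 \<in> carrier_vec p"
      using six_block_vec v(1) unfolding Mc by metis
    note vd = car[THEN carrier_vecD]
    define s t where "s = v1 + v2" and "t = v3 + v4"
    define \<sigma> \<tau> where "\<sigma> = E *\<^sub>v v3" and "\<tau> = E *\<^sub>v v1"
    have std: "s \<in> carrier_vec k" "t \<in> carrier_vec k" "\<sigma> \<in> carrier_vec k" "\<tau> \<in> carrier_vec k"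
      by (auto simp: s_def t_def \<sigma>_def \<tau>_def d vd intro!: carrier_vecI)
    note sd = std[THEN carrier_vecD]
    have P\<sigma>: "P *\<^sub>v \<sigma> = v3" "P *\<^sub>v \<tau> = v1"
      unfolding \<sigma>_def \<tau>_def E_def by (rule mult_minv_vec[OF Pi P(1)], rule car)+
    have state: "X *\<^sub>v v3 + Z *\<^sub>v v4 = \<sigma> + Z *\<^sub>v t"
      by (intro eq_vecI) (simp_all add: X_def \<sigma>_def t_def d vd mat_vec_expand del: index_mult_mat_vec)
    have uin: "LX *\<^sub>v t + minv DM *\<^sub>v v5 = minv DM *\<^sub>v (v5 - C *\<^sub>v (Z *\<^sub>v t))"
      by (intro eq_vecI) (simp_all add: LX_def d vd sd mat_vec_expand del: index_mult_mat_vec)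
    have yin: "L *\<^sub>v t + 0\<^sub>m m p *\<^sub>v v5 = L *\<^sub>v t"
      by (simp add: mat_vec_zero_dim vd d right_zero_vec[OF carrier_vecI])
    have nexts: "A *\<^sub>v (\<sigma> + Z *\<^sub>v t) + BM *\<^sub>v (minv DM *\<^sub>v (v5 - C *\<^sub>v (Z *\<^sub>v t))) - BN *\<^sub>v (L *\<^sub>v t)
       = A *\<^sub>v \<sigma> + (Q *\<^sub>v t + F *\<^sub>v v5)"
      by (intro eq_vecI) (simp_all add: Q_def Ax_def F_def d vd sd mat_vec_expand del: index_mult_mat_vec)
    have DMi: "DM *\<^sub>v (minv DM *\<^sub>v (v5 - C *\<^sub>v (Z *\<^sub>v t))) = v5 - C *\<^sub>v (Z *\<^sub>v t)"
      by (rule mult_minv_vec[OF DM dims(5)]) (auto intro!: carrier_vecI simp: d vd)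
    have out: "C *\<^sub>v (\<sigma> + Z *\<^sub>v t) + DM *\<^sub>v (minv DM *\<^sub>v (v5 - C *\<^sub>v (Z *\<^sub>v t))) - 0\<^sub>m p m *\<^sub>v (L *\<^sub>v t) - v5 = C *\<^sub>v \<sigma>"
      unfolding DMi by (intro eq_vecI) (simp_all add: d vd sd mat_vec_expand del: index_mult_mat_vec)
    have Qt: "Q *\<^sub>v t = Ax *\<^sub>v (Z *\<^sub>v t) + (- BN) *\<^sub>v (L *\<^sub>v t)"
      by (intro eq_vecI) (simp_all add: Q_def d sd mat_vec_expand del: index_mult_mat_vec)
    have Xblock: "a \<bullet> (X *\<^sub>v a + Z *\<^sub>v b) + b \<bullet> (Z *\<^sub>v a + Z *\<^sub>v b) = a \<bullet> (E *\<^sub>v a) + (a + b) \<bullet> (Z *\<^sub>v (a + b))"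
      if "a \<in> carrier_vec k" "b \<in> carrier_vec k" for a b
      using that symmetric_swap[OF Zsym, of a b] by (simp add: X_def d mat_vec_expand scalar_prod_distrib_dim)
    have "v \<bullet> (?M *\<^sub>v v) =
        (v1 \<bullet> (E *\<^sub>v v1) + s \<bullet> (Z *\<^sub>v s)) + (v3 \<bullet> (E *\<^sub>v v3) + t \<bullet> (Z *\<^sub>v t)) + v5 \<bullet> v5 + v6 \<bullet> v6
        + 2 * (v1 \<bullet> (A *\<^sub>v \<sigma> + (Q *\<^sub>v t + F *\<^sub>v v5))) + 2 * (v2 \<bullet> (Q *\<^sub>v t + F *\<^sub>v v5)) + 2 * (v6 \<bullet> (C *\<^sub>v \<sigma>))"
      unfolding vv lmi_mat_bilinear(2)[OF dims zero_carrier_mat vars car car] t_def[symmetric] state uin yin nexts out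
      using Xblock[OF car(1,2), folded s_def] Xblock[OF car(3,4), folded t_def, unfolded state] by simp
    also have "\<dots> = (\<sigma> \<bullet> (P *\<^sub>v \<sigma>) + 2 * (\<sigma> \<bullet> (A\<^sup>T *\<^sub>v (P *\<^sub>v \<tau>))) + \<tau> \<bullet> (P *\<^sub>v \<tau>) + 2 * (\<sigma> \<bullet> (C\<^sup>T *\<^sub>v v6)) + v6 \<bullet> v6)
       + (s \<bullet> (Z *\<^sub>v s) + 2 * (s \<bullet> (Ax *\<^sub>v (Z *\<^sub>v t) + (- BN) *\<^sub>v (L *\<^sub>v t))) + t \<bullet> (Z *\<^sub>v t) + 2 * (s \<bullet> (F *\<^sub>v v5)) + v5 \<bullet> v5)"
      (is "_ = ?f1 + ?f2")
    proof -
      have "\<sigma> \<bullet> (A\<^sup>T *\<^sub>v v1) = v1 \<bullet> (A *\<^sub>v \<sigma>)" "\<sigma> \<bullet> (C\<^sup>T *\<^sub>v v6) = v6 \<bullet> (C *\<^sub>v \<sigma>)"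
        by (rule transpose_scalar_dim; simp add: d vd sd)+
      moreover have "\<sigma> \<bullet> v3 = v3 \<bullet> (E *\<^sub>v v3)" "\<tau> \<bullet> v1 = v1 \<bullet> (E *\<^sub>v v1)"
        using comm_scalar_prod[OF std(3) car(3)] comm_scalar_prod[OF std(4) car(1)] by (simp_all add: \<sigma>_def \<tau>_def)
      ultimately show ?thesis unfolding P\<sigma> Qt[symmetric] s_def
        by (simp add: d vd sd scalar_prod_distrib_dim Q_def F_def)
    qed
    also have "\<dots> > 0"
    proof -
      have nn: "0 \<le> ?f1" "0 \<le> ?f2"
      proof -
        show "0 \<le> ?f1"
          using form1[OF std(3,4) car(6)] P dims
          by (cases "\<sigma> = 0\<^sub>v k \<and> \<tau> = 0\<^sub>v k \<and> v6 = 0\<^sub>v p") (simp_all add: mat_vec_zero_dim scalar_prod_zero_dim less_imp_le)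
        show "0 \<le> ?f2"
          using form2[OF std(1,2) car(5)] Z L F Ax dims
          by (cases "s = 0\<^sub>v k \<and> t = 0\<^sub>v k \<and> v5 = 0\<^sub>v p") (simp_all add: mat_vec_zero_dim scalar_prod_zero_dim less_imp_le)
      qed
      have "\<not> (\<sigma> = 0\<^sub>v k \<and> \<tau> = 0\<^sub>v k \<and> v6 = 0\<^sub>v p) \<or> \<not> (s = 0\<^sub>v k \<and> t = 0\<^sub>v k \<and> v5 = 0\<^sub>v p)"
      proof (rule ccontr)
        assume "\<not> ?thesis"
        then have 0: "\<sigma> = 0\<^sub>v k" "\<tau> = 0\<^sub>v k" "v6 = 0\<^sub>v p" "s = 0\<^sub>v k" "t = 0\<^sub>v k" "v5 = 0\<^sub>v p" by auto
        have v13: "v3 = 0\<^sub>v k" "v1 = 0\<^sub>v k" using P\<sigma> unfolding 0 by (simp_all add: mat_vec_zero_dim d)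
        have "v2 = 0\<^sub>v k" "v4 = 0\<^sub>v k" using 0(4,5) car(2,4) unfolding s_def t_def v13 by simp_all
        then show False using v(2) unfolding Mc vv 0 v13 by (simp add: append_vec_eq_0_iff)
      qed
      then show ?thesis using form1[OF std(3,4) car(6)] form2[OF std(1,2) car(5)] nn by linarith
    qed
    finally show "0 < v \<bullet> (?M *\<^sub>v v)" .
  qed
  then show ?thesis using vars by blast
qed

section \<open>Equivalence and controller formula\<close>

lemma mat_zero_dim:
  fixes A B M :: "'a::ring mat"
  shows "dim_row M = m \<Longrightarrow> 0\<^sub>m n m * M = 0\<^sub>m n (dim_col M)"
    "dim_col M = m \<Longrightarrow> M * 0\<^sub>m m n = 0\<^sub>m (dim_row M) n"
    "dim_row A = n \<Longrightarrow> dim_col A = m \<Longrightarrow> A + 0\<^sub>m n m = A"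
    "dim_row A = n \<Longrightarrow> dim_col A = m \<Longrightarrow> 0\<^sub>m n m + A = A"
  by (intro eq_matI; simp add: scalar_prod_def)+

lemma append_cols_zero: "append_cols (0\<^sub>m n a) (0\<^sub>m n b) = 0\<^sub>m n (a + b)"
  by (intro eq_matI) (auto simp: append_cols_def)

lemma append_cols_add:
  fixes A B C D :: "'a::ring mat"
  assumes "dim_row A = dim_row C" "dim_col A = dim_col C" "dim_row B = dim_row A" "dim_row D = dim_row A" "dim_col B = dim_col D"
  shows "append_cols A B + append_cols C D = append_cols (A + C) (B + D)"
  by (intro eq_matI) (use assms in \<open>auto simp: append_cols_def\<close>)

lemma append_interchange:
  assumes "dim_row A = dim_row C" "dim_row B = dim_row D" "dim_col A = dim_col B" "dim_col C = dim_col D"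
  shows "append_cols (A @\<^sub>r B) (C @\<^sub>r D) = append_cols A C @\<^sub>r append_cols B D"
  by (intro eq_matI) (use assms in \<open>auto simp: append_cols_def append_rows_def\<close>)

lemma mat_one_dim:
  fixes M :: "'a::ring_1 mat"
  shows "dim_row M = n \<Longrightarrow> 1\<^sub>m n * M = M" "dim_col M = n \<Longrightarrow> M * 1\<^sub>m n = M"
  by (auto intro: left_mult_one_mat right_mult_one_mat carrier_matI)

lemma hat_blocks:
  fixes S Ui :: "real mat"
  assumes S: "S \<in> carrier_mat k k" and Ui: "Ui \<in> carrier_mat k k"
    and vars: "lmi_vars k p m X Z Q F LX LY RX RY"
    and hats: "Ah \<in> carrier_mat k k" "Bh \<in> carrier_mat k p" "CXh \<in> carrier_mat p k" "DXh \<in> carrier_mat p p"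
      "CYh \<in> carrier_mat m k" "DYh \<in> carrier_mat m p"
    and eq: "block_mat [[Ah, Bh], [CXh, DXh], [CYh, DYh]] =
          block_mat [[S, 0\<^sub>m k p, 0\<^sub>m k m], [0\<^sub>m p k, 1\<^sub>m p, 0\<^sub>m p m], [0\<^sub>m m k, 0\<^sub>m m p, 1\<^sub>m m]] *
          block_mat [[Q, F], [LX, RX], [LY, RY]] * (block_mat [[Ui, 0\<^sub>m k p], [0\<^sub>m p k, 1\<^sub>m p]])\<^sup>T"
  shows "Ah = S * Q * Ui\<^sup>T" "Bh = S * F" "CXh = LX * Ui\<^sup>T" "DXh = RX" "CYh = LY * Ui\<^sup>T" "DYh = RY"
proof -
  have vars': "Q \<in> carrier_mat k k" "F \<in> carrier_mat k p" "LX \<in> carrier_mat p k" "LY \<in> carrier_mat m k"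
    "RX \<in> carrier_mat p p" "RY \<in> carrier_mat m p" using vars by (auto simp: lmi_vars_def)
  note d = S[THEN carrier_matD(1)] S[THEN carrier_matD(2)] Ui[THEN carrier_matD(1)] Ui[THEN carrier_matD(2)]
    hats[THEN carrier_matD(1)] hats[THEN carrier_matD(2)] vars'[THEN carrier_matD(1)] vars'[THEN carrier_matD(2)]
  have left: "block_mat [[S, 0\<^sub>m k p, 0\<^sub>m k m], [0\<^sub>m p k, 1\<^sub>m p, 0\<^sub>m p m], [0\<^sub>m m k, 0\<^sub>m m p, 1\<^sub>m m]] *
      block_mat [[Q, F], [LX, RX], [LY, RY]] =
      append_cols (S * Q) (S * F) @\<^sub>r (append_cols LX RX @\<^sub>r append_cols LY RY)"
    unfolding block_mat_def
    by (simp add: d append_cols_zero append_mult_right append_mult_inner append_mult_left mat_zero_dim mat_one_dim)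
  have right: "(block_mat [[Ui, 0\<^sub>m k p], [0\<^sub>m p k, 1\<^sub>m p]])\<^sup>T =
      append_cols (Ui\<^sup>T @\<^sub>r 0\<^sub>m p k) (0\<^sub>m k p @\<^sub>r 1\<^sub>m p)"
    unfolding block_mat_def by (simp add: d transpose_append_rows transpose_append_cols)
  have "append_cols Ah Bh @\<^sub>r (append_cols CXh DXh @\<^sub>r append_cols CYh DYh) =
      append_cols (S * Q * Ui\<^sup>T) (S * F) @\<^sub>r (append_cols (LX * Ui\<^sup>T) RX @\<^sub>r append_cols (LY * Ui\<^sup>T) RY)"
    using eq unfolding left right unfolding block_mat_def
    by (simp add: d append_interchange append_cols_add append_mult_right append_mult_inner append_mult_left mat_zero_dim mat_one_dim)
  then show "Ah = S * Q * Ui\<^sup>T" "Bh = S * F" "CXh = LX * Ui\<^sup>T" "DXh = RX" "CYh = LY * Ui\<^sup>T" "DYh = RY"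
    by (simp_all add: d append_rows_inject append_cols_inject)
qed

lemma doubly_coprime_factorizationD:
  assumes fac: "doubly_coprime_factorization p m G Ul Vl Nl Ml Ur Vr Nr Mr"
  shows "Ml * G = Nl" "Ml * Ur - Nl * Vr = 1\<^sub>m p" "Ur \<in> RH_inf p p" "Vr \<in> RH_inf m p"
proof -
  have car: "Ul \<in> carrier_mat m m" "Vl \<in> carrier_mat m p" "Nl \<in> carrier_mat p m" "Ml \<in> carrier_mat p p"
    "Ur \<in> carrier_mat p p" "Vr \<in> carrier_mat m p" "Nr \<in> carrier_mat p m" "Mr \<in> carrier_mat m m"
    and inv: "invertible_mat Ml" and G: "G = minv Ml * Nl"
    and prod: "four_block_mat Ul (- Vl) (- Nl) Ml * four_block_mat Mr Vr Nr Ur = 1\<^sub>m (m + p)"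
    using fac unfolding doubly_coprime_factorization_def RH_inf_def by auto
  show "Ur \<in> RH_inf p p" "Vr \<in> RH_inf m p" using fac unfolding doubly_coprime_factorization_def by auto
  note iM = minv_left_right[OF inv car(4)]
  show "Ml * G = Nl"
    unfolding G using iM car mult_assoc_dim[of Ml "minv Ml" Nl, symmetric] by (simp add: mat_one_dim)
  have "four_block_mat Ul (- Vl) (- Nl) Ml * four_block_mat Mr Vr Nr Ur =
      four_block_mat (Ul * Mr + - Vl * Nr) (Ul * Vr + - Vl * Ur) (- Nl * Mr + Ml * Nr) (- Nl * Vr + Ml * Ur)"
    using car by (intro mult_four_block_mat[of _ m m _ p _ p]) auto
  then have "1\<^sub>m (m + p) = four_block_mat (Ul * Mr + - Vl * Nr) (Ul * Vr + - Vl * Ur) (- Nl * Mr + Ml * Nr) (- Nl * Vr + Ml * Ur)"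
    using prod by simp
  then have e: "(1\<^sub>m (m + p) :: tf_mat) $$ (i + m, j + m) =
     four_block_mat (Ul * Mr + - Vl * Nr) (Ul * Vr + - Vl * Ur) (- Nl * Mr + Ml * Nr) (- Nl * Vr + Ml * Ur) $$ (i + m, j + m)"
    for i j by simp
  show "Ml * Ur - Nl * Vr = 1\<^sub>m p"
  proof (rule eq_matI)
    fix i j assume ij: "i < dim_row (1\<^sub>m p :: tf_mat)" "j < dim_col (1\<^sub>m p :: tf_mat)"
    have "(Ml * Ur - Nl * Vr) $$ (i, j) = (- Nl * Vr + Ml * Ur) $$ (i, j)"
      using ij car mat_distrib_dim(5)[of Nl Vr] by (simp del: index_mult_mat(1))
    also have "\<dots> = (1\<^sub>m p :: tf_mat) $$ (i, j)"
      using e[of i j] ij car by simp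
    finally show "(Ml * Ur - Nl * Vr) $$ (i, j) = (1\<^sub>m p :: tf_mat) $$ (i, j)" .
  qed (use car in auto)
qed

theorem corollary1:
  fixes n m p k :: nat
    and Ap Bp Cp A BM BN C DM DN :: "real mat"
    and G Ul Vl Nl Ml Ur Vr Nr Mr :: tf_mat
  assumes plant_dims: "Ap \<in> carrier_mat n n" "Bp \<in> carrier_mat n m" "Cp \<in> carrier_mat p n"
    and plant_stabilizable: "stabilizable Ap Bp"
    and plant_detectable: "detectable Cp Ap"
    and plant: "G = transfer_mat Ap Bp Cp (0\<^sub>m p m)"
    and factorization: "doubly_coprime_factorization p m G Ul Vl Nl Ml Ur Vr Nr Mr"
    and realization_dims: "A \<in> carrier_mat k k" "BM \<in> carrier_mat k p" "BN \<in> carrier_mat k m"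
      "C \<in> carrier_mat p k" "DM \<in> carrier_mat p p" "DN \<in> carrier_mat p m"
    and realization_Ml: "Ml = transfer_mat A BM C DM"
    and realization_Nl: "Nl = transfer_mat A BN C DN"
  shows
    "(schur_stable A \<longrightarrow>
       ((\<exists>q. \<exists>AK \<in> carrier_mat q q. \<exists>BK \<in> carrier_mat q p.
           \<exists>CK \<in> carrier_mat m q. \<exists>DK \<in> carrier_mat m p.
           internally_stabilizes AK BK CK DK Ap Bp Cp)
        \<longleftrightarrow>
        (\<exists>X Z Q F LX LY RX RY. lmi_vars k p m X Z Q F LX LY RX RY \<and>
           pos_def (lmi_mat k p 1 A BM BN C DM DN X Z Q F LX LY RX RY)))) \<and>
     (\<forall>X Z Q F LX LY RX RY U Ah Bh CXh DXh CYh DYh AK BK CK DK Xt Yt.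
        lmi_vars k p m X Z Q F LX LY RX RY \<longrightarrow>
        pos_def (lmi_mat k p 1 A BM BN C DM DN X Z Q F LX LY RX RY) \<longrightarrow>
        U \<in> carrier_mat k k \<longrightarrow> invertible_mat U \<longrightarrow>
        Ah \<in> carrier_mat k k \<longrightarrow> Bh \<in> carrier_mat k p \<longrightarrow>
        CXh \<in> carrier_mat p k \<longrightarrow> DXh \<in> carrier_mat p p \<longrightarrow>
        CYh \<in> carrier_mat m k \<longrightarrow> DYh \<in> carrier_mat m p \<longrightarrow>
        block_mat [[Ah, Bh], [CXh, DXh], [CYh, DYh]] =
          block_mat [[U\<^sup>T * minv Z, 0\<^sub>m k p, 0\<^sub>m k m],
                     [0\<^sub>m p k, 1\<^sub>m p, 0\<^sub>m p m],
                     [0\<^sub>m m k, 0\<^sub>m m p, 1\<^sub>m m]] *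
          block_mat [[Q, F], [LX, RX], [LY, RY]] *
          (block_mat [[minv U, 0\<^sub>m k p], [0\<^sub>m p k, 1\<^sub>m p]])\<^sup>T \<longrightarrow>
        AK = Ah - Bh * minv DXh * CXh \<longrightarrow>
        BK = - (Bh * minv DXh) \<longrightarrow>
        CK = - CYh + DYh * minv DXh * CXh \<longrightarrow>
        DK = DYh * minv DXh \<longrightarrow>
        Xt = transfer_mat Ah Bh CXh DXh \<longrightarrow>
        Yt = transfer_mat Ah Bh CYh DYh \<longrightarrow>
        invertible_mat Z \<and> invertible_mat DXh \<and> invertible_mat Xt \<and>
        transfer_mat AK BK CK DK = Yt * minv Xt \<and>
        internally_stabilizes AK BK CK DK Ap Bp Cp)"
proof -
  note fac = doubly_coprime_factorizationD[OF factorization]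
  have MG: "transfer_mat A BM C DM * transfer_mat Ap Bp Cp (0\<^sub>m p m) = transfer_mat A BN C DN"
    using fac(1) unfolding plant realization_Ml realization_Nl .
  have DN: "DN = 0\<^sub>m p m" by (rule zero_feedthrough[OF plant_dims realization_dims MG])
  note stabilizes = lmi_controller_stabilizes[OF plant_dims plant_stabilizable plant_detectable realization_dims MG]
  show ?thesis
  proof (rule conjI, goal_cases)
    case 1
    show ?case
    proof (intro impI iffI)
      assume stable: "schur_stable A"
      have bezout: "transfer_mat A BM C DM * Ur - transfer_mat A BN C (0\<^sub>m p m) * Vr = 1\<^sub>m p"
        using fac(2) unfolding realization_Ml realization_Nl DN .
      show "\<exists>X Z Q F LX LY RX RY. lmi_vars k p m X Z Q F LX LY RX RY \<and>
          pos_def (lmi_mat k p 1 A BM BN C DM DN X Z Q F LX LY RX RY)"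
        unfolding DN by (rule lmi_feasible[OF realization_dims(1-5) stable fac(3,4) bezout])
    next
      assume "\<exists>X Z Q F LX LY RX RY. lmi_vars k p m X Z Q F LX LY RX RY \<and>
          pos_def (lmi_mat k p 1 A BM BN C DM DN X Z Q F LX LY RX RY)"
      then obtain X Z Q F LX LY RX RY where vars: "lmi_vars k p m X Z Q F LX LY RX RY"
        and pd: "pos_def (lmi_mat k p 1 A BM BN C DM DN X Z Q F LX LY RX RY)" by blast
      have vars': "Z \<in> carrier_mat k k" "Q \<in> carrier_mat k k" "F \<in> carrier_mat k p" "LX \<in> carrier_mat p k"
        "LY \<in> carrier_mat m k" "RX \<in> carrier_mat p p" "RY \<in> carrier_mat m p"
        using vars by (auto simp: lmi_vars_def)
      note iZ = minv_left_right[OF lmi_stable(2)[OF realization_dims vars pd] vars'(1)]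
      have RX: "invertible_mat RX"
        by (rule lmi_invertible_feedthrough[OF realization_dims(1-5) vars pd[unfolded DN]])
      note iR = minv_left_right[OF RX vars'(6)]
      \<comment> \<open>the controller formula for \<open>U = I\<close>\<close>
      let ?V = "1\<^sub>m k :: real mat" and ?Ah = "minv Z * Q" and ?Bh = "minv Z * F"
      have V: "?V \<in> carrier_mat k k" "invertible_mat ?V"
        using invertible_matI[of ?V k ?V] by auto
      have hat: "?Ah \<in> carrier_mat k k" "?Bh \<in> carrier_mat k p" using iZ(1) vars' by auto
      have "Z * ?V * ?Ah = Q * ?V" "Z * ?V * ?Bh = F"
        using iZ vars' mult_assoc_dim[of Z "minv Z" Q, symmetric] mult_assoc_dim[of Z "minv Z" F, symmetric]
        by (simp_all add: mat_one_dim)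
      from stabilizes[OF vars pd V hat this]
      have "internally_stabilizes (?Ah - ?Bh * minv RX * (LX * ?V)) (- (?Bh * minv RX))
         (- (LY * ?V) + RY * minv RX * (LX * ?V)) (RY * minv RX) Ap Bp Cp" .
      moreover have "?Ah - ?Bh * minv RX * (LX * ?V) \<in> carrier_mat k k" "- (?Bh * minv RX) \<in> carrier_mat k p"
        "- (LY * ?V) + RY * minv RX * (LX * ?V) \<in> carrier_mat m k" "RY * minv RX \<in> carrier_mat m p"
        using iR(1)[THEN carrier_matD(1)] iR(1)[THEN carrier_matD(2)] vars'[THEN carrier_matD(1)] vars'[THEN carrier_matD(2)]
          iZ(1)[THEN carrier_matD(1)] iZ(1)[THEN carrier_matD(2)]
        by (intro carrier_matI; simp)+
      ultimately show "\<exists>q. \<exists>AK \<in> carrier_mat q q. \<exists>BK \<in> carrier_mat q p. \<exists>CK \<in> carrier_mat m q.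
          \<exists>DK \<in> carrier_mat m p. internally_stabilizes AK BK CK DK Ap Bp Cp" by blast
    qed
  next
    case 2
    show ?case
    proof (intro allI impI)
      fix X Z Q F LX LY RX RY U Ah Bh CXh DXh CYh DYh AK BK CK DK :: "real mat" and Xt Yt :: tf_mat
      assume vars: "lmi_vars k p m X Z Q F LX LY RX RY"
        and pd: "pos_def (lmi_mat k p 1 A BM BN C DM DN X Z Q F LX LY RX RY)"
        and U: "U \<in> carrier_mat k k" "invertible_mat U"
        and hats: "Ah \<in> carrier_mat k k" "Bh \<in> carrier_mat k p" "CXh \<in> carrier_mat p k" "DXh \<in> carrier_mat p p"
          "CYh \<in> carrier_mat m k" "DYh \<in> carrier_mat m p"
        and eq: "block_mat [[Ah, Bh], [CXh, DXh], [CYh, DYh]] =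
            block_mat [[U\<^sup>T * minv Z, 0\<^sub>m k p, 0\<^sub>m k m],
                       [0\<^sub>m p k, 1\<^sub>m p, 0\<^sub>m p m],
                       [0\<^sub>m m k, 0\<^sub>m m p, 1\<^sub>m m]] *
            block_mat [[Q, F], [LX, RX], [LY, RY]] *
            (block_mat [[minv U, 0\<^sub>m k p], [0\<^sub>m p k, 1\<^sub>m p]])\<^sup>T"
        and K: "AK = Ah - Bh * minv DXh * CXh" "BK = - (Bh * minv DXh)" "CK = - CYh + DYh * minv DXh * CXh"
          "DK = DYh * minv DXh"
        and XY: "Xt = transfer_mat Ah Bh CXh DXh" "Yt = transfer_mat Ah Bh CYh DYh"
      have vars': "Z \<in> carrier_mat k k" "Q \<in> carrier_mat k k" "F \<in> carrier_mat k p"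
        using vars by (auto simp: lmi_vars_def)
      have Z: "invertible_mat Z" by (rule lmi_stable(2)[OF realization_dims vars pd])
      note iZ = minv_left_right[OF Z vars'(1)] and iU = minv_left_right[OF U(2,1)]
      have S: "U\<^sup>T * minv Z \<in> carrier_mat k k" using U(1) iZ(1) by auto
      note blocks = hat_blocks[OF S iU(1) vars hats eq]
      have D: "invertible_mat DXh"
        unfolding blocks(4) by (rule lmi_invertible_feedthrough[OF realization_dims(1-5) vars pd[unfolded DN]])
      define V where "V = (minv U)\<^sup>T"
      have V: "V \<in> carrier_mat k k" using iU(1) by (simp add: V_def)
      have VU: "V * U\<^sup>T = 1\<^sub>m k"
        using arg_cong[OF iU(2), of transpose_mat] iU(1) U(1) by (simp add: V_def transpose_mult_dim)
      have Vi: "invertible_mat V" by (rule invertible_matI[OF V _ disjI1[OF VU]]) (use U(1) in auto)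
      have ZVS: "Z * V * (U\<^sup>T * minv Z * P) = P" if "dim_row P = k" for P
      proof -
        have "Z * V * (U\<^sup>T * minv Z * P) = Z * ((V * U\<^sup>T) * (minv Z * P))"
          using that vars'(1) V U(1) iZ(1) by (simp add: mult_assoc_dim)
        also have "\<dots> = (Z * minv Z) * P"
          unfolding VU using that vars'(1) iZ(1) by (simp add: mult_assoc_dim mat_one_dim)
        finally show ?thesis unfolding iZ(2) using that by (simp add: mat_one_dim)
      qed
      have Ah: "Z * V * Ah = Q * V"
      proof -
        have "Ah = U\<^sup>T * minv Z * (Q * V)" unfolding blocks(1) V_def using U(1) iZ(1) iU(1) vars'(2) by (simp add: mult_assoc_dim)
        then show ?thesis using ZVS[of "Q * V"] vars'(2) by simp
      qed
      have Bh: "Z * V * Bh = F" unfolding blocks(2) using vars'(3) by (intro ZVS) simp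
      have "internally_stabilizes AK BK CK DK Ap Bp Cp"
        unfolding K blocks(3-6) V_def[symmetric] by (rule stabilizes[OF vars pd V Vi hats(1,2) Ah Bh])
      moreover have "invertible_mat Xt" "transfer_mat AK BK CK DK = Yt * minv Xt"
        unfolding K XY by (rule transfer_mat_quotient[OF hats D])+
      ultimately show "invertible_mat Z \<and> invertible_mat DXh \<and> invertible_mat Xt \<and>
          transfer_mat AK BK CK DK = Yt * minv Xt \<and> internally_stabilizes AK BK CK DK Ap Bp Cp"
        using Z D by blast
    qed
  qed
qed

end
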